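(* Fix integers $r\ge2$ and $\sigma\ge1$ with $\sigma\le r$. For a uniformly random $r$-neighbor cellular automaton rule $f$ with $n$ states, let $C_n=C_{\sigma,n}$ be the number of equivalence classes, modulo translations, of initial configurations that are periodic with minimal spatial period $\sigma$ and are such that the evolution under $f$ never reduces the spatial period. If $\sigma$ is even, then, as $n\to\infty$, $\sigma n^{-\sigma}C_n$ converges in distribution to $1-\tau$, where $\tau=\inf\{t:\eta(t)=0\}$ is the hitting time of $0$ of the Brownian bridge $\eta(t)$, $t\in[0,1]$, that starts at $\eta(0)=1/\sqrt{\sigma}$ and ends at $\eta(1)=0$. If $\sigma$ is odd, then $\sigma n^{-\sigma}C_n\to 1$ in probability as $n\to\infty$.
   Context: Let $\mathbb{Z}_n=\{0,1,\dots,n-1\}$. An $r$-neighbor rule is a function $f:\mathbb{Z}_n^r\to\mathbb{Z}_n$; there are $n^{n^r}$ of them and a random rule is chosen uniformly. Given an initial configuration $\xi_0:\mathbb{Z}\to\mathbb{Z}_n$, the evolution is $\xi_{t+1}(x)=f(\xi_t(x-r+1),\dots,\xi_t(x))$ for all $x\in\mathbb{Z}$, $t\in\mathbb{Z}_+$. A configuration has minimal spatial period $\sigma$ if it is a doubly infinite repetition of a word of length $\sigma$ which cannot be divided into two or more identical words. If $\xi_0$ has minimal period $\sigma$, then the minimal spatial period of each $\xi_t$ divides $\sigma$; the evolution never reduces the spatial period if it equals $\sigma$ for all $t\ge0$. Two configurations are equivalent if one is a translate of the other. *)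

theory Defs
  imports "HOL-Probability.Probability"
begin

section \<open>Cellular automata\<close>

definition words :: "nat \<Rightarrow> nat \<Rightarrow> nat list set" where
  "words r n = {w. length w = r \<and> set w \<subseteq> {..<n}}"

text \<open>Rules are extensional outside \<open>words r n\<close>, so that distinct elements of \<open>rules r n\<close> are
  distinct functions on words.\<close>

definition rules :: "nat \<Rightarrow> nat \<Rightarrow> (nat list \<Rightarrow> nat) set" where
  "rules r n = words r n \<rightarrow>\<^sub>E {..<n}"

definition random_rule :: "nat \<Rightarrow> nat \<Rightarrow> (nat list \<Rightarrow> nat) pmf" where
  "random_rule r n = pmf_of_set (rules r n)"

definition configurations :: "nat \<Rightarrow> (int \<Rightarrow> nat) set" where
  "configurations n = UNIV \<rightarrow> {..<n}"

text \<open>The neighborhood of \<open>x\<close> is the list of sites \<open>x - r + 1, \<dots>, x\<close>, in this order.\<close>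

definition ca_step :: "nat \<Rightarrow> (nat list \<Rightarrow> nat) \<Rightarrow> (int \<Rightarrow> nat) \<Rightarrow> (int \<Rightarrow> nat)" where
  "ca_step r f \<xi> = (\<lambda>x. f (map \<xi> [x - int r + 1..x]))"

definition evolution :: "nat \<Rightarrow> (nat list \<Rightarrow> nat) \<Rightarrow> (int \<Rightarrow> nat) \<Rightarrow> nat \<Rightarrow> (int \<Rightarrow> nat)" where
  "evolution r f \<xi> t = (ca_step r f ^^ t) \<xi>"


section \<open>Periodic configurations\<close>

definition divisible_word :: "nat list \<Rightarrow> bool" where
  "divisible_word w \<longleftrightarrow> (\<exists>k u. k \<ge> 2 \<and> w = concat (replicate k u))"

definition repetition :: "nat list \<Rightarrow> (int \<Rightarrow> nat)" where
  "repetition w = (\<lambda>x. w ! nat (x mod int (length w)))"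

definition has_minimal_period :: "(int \<Rightarrow> nat) \<Rightarrow> nat \<Rightarrow> bool" where
  "has_minimal_period \<xi> \<sigma> \<longleftrightarrow>
     (\<exists>w. w \<noteq> [] \<and> length w = \<sigma> \<and> \<not> divisible_word w \<and> \<xi> = repetition w)"

definition never_reduces_period ::
  "nat \<Rightarrow> (nat list \<Rightarrow> nat) \<Rightarrow> nat \<Rightarrow> (int \<Rightarrow> nat) \<Rightarrow> bool" where
  "never_reduces_period r f \<sigma> \<xi> \<longleftrightarrow> (\<forall>t. has_minimal_period (evolution r f \<xi> t) \<sigma>)"

definition translation_rel :: "((int \<Rightarrow> nat) \<times> (int \<Rightarrow> nat)) set" where
  "translation_rel = {(\<xi>, \<zeta>). \<exists>k. \<forall>x. \<zeta> x = \<xi> (x + k)}"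

definition persistent_configurations ::
  "nat \<Rightarrow> nat \<Rightarrow> nat \<Rightarrow> (nat list \<Rightarrow> nat) \<Rightarrow> (int \<Rightarrow> nat) set" where
  "persistent_configurations r \<sigma> n f =
     {\<xi> \<in> configurations n. has_minimal_period \<xi> \<sigma> \<and> never_reduces_period r f \<sigma> \<xi>}"

definition num_classes :: "nat \<Rightarrow> nat \<Rightarrow> nat \<Rightarrow> (nat list \<Rightarrow> nat) \<Rightarrow> nat" where
  "num_classes r \<sigma> n f = card (persistent_configurations r \<sigma> n f // translation_rel)"

definition scaled_classes :: "nat \<Rightarrow> nat \<Rightarrow> nat \<Rightarrow> (nat list \<Rightarrow> nat) \<Rightarrow> real" where
  "scaled_classes r \<sigma> n f = real \<sigma> * real (num_classes r \<sigma> n f) / real n ^ \<sigma>"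


section \<open>The Brownian bridge\<close>

definition normal_measure :: "real \<Rightarrow> real \<Rightarrow> real measure" where
  "normal_measure m s =
     (if s = 0 then return borel m else density lborel (\<lambda>x. ennreal (normal_density m s x)))"

text \<open>Joint normality of the finite-dimensional marginals is expressed by normality, possibly
  degenerate, of all their linear combinations.\<close>

definition gaussian_process :: "'a measure \<Rightarrow> real set \<Rightarrow> (real \<Rightarrow> 'a \<Rightarrow> real) \<Rightarrow> bool" where
  "gaussian_process M T X \<longleftrightarrow>
     prob_space M \<and> (\<forall>t\<in>T. X t \<in> borel_measurable M) \<and>
     (\<forall>J c. finite J \<and> J \<subseteq> T \<longrightarrow>
        (\<exists>m s. s \<ge> 0 \<and> distr M borel (\<lambda>\<omega>. \<Sum>t\<in>J. c t * X t \<omega>) = normal_measure m s))"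

definition brownian_bridge ::
  "'a measure \<Rightarrow> real \<Rightarrow> real \<Rightarrow> (real \<Rightarrow> 'a \<Rightarrow> real) \<Rightarrow> bool" where
  "brownian_bridge M a b \<eta> \<longleftrightarrow>
     gaussian_process M {0..1} \<eta> \<and>
     (\<forall>\<omega>\<in>space M. continuous_on {0..1} (\<lambda>t. \<eta> t \<omega>) \<and> \<eta> 0 \<omega> = a \<and> \<eta> 1 \<omega> = b) \<and>
     (\<forall>t\<in>{0..1}. (\<integral>\<omega>. \<eta> t \<omega> \<partial>M) = a + (b - a) * t) \<and>
     (\<forall>s\<in>{0..1}. \<forall>t\<in>{0..1}.
        (\<integral>\<omega>. (\<eta> s \<omega> - (a + (b - a) * s)) * (\<eta> t \<omega> - (a + (b - a) * t)) \<partial>M) = min s t - s * t)"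

text \<open>For the processes used below the set is never empty, since the bridge ends at \<open>0\<close>.\<close>

definition hitting_time_zero :: "(real \<Rightarrow> 'a \<Rightarrow> real) \<Rightarrow> 'a \<Rightarrow> real" where
  "hitting_time_zero \<eta> \<omega> = Inf {t \<in> {0..1}. \<eta> t \<omega> = 0}"


section \<open>Well-formedness of the definitions\<close>

lemma finite_words: "finite (words r n)"
  unfolding words_def using finite_lists_length_eq[of "{..<n}" r] by (simp add: conj_commute)

lemma card_words: "card (words r n) = n ^ r"
  unfolding words_def using card_lists_length_eq[of "{..<n}" r] by (simp add: conj_commute)

lemma finite_rules: "finite (rules r n)"
  unfolding rules_def by (intro finite_PiE finite_words) auto

lemma card_rules: "card (rules r n) = n ^ (n ^ r)"
  unfolding rules_def by (simp add: card_PiE finite_words card_words)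

lemma rules_nonempty: "n > 0 \<Longrightarrow> rules r n \<noteq> {}"
  unfolding rules_def by (auto simp: PiE_eq_empty_iff)

lemma evolution_0: "evolution r f \<xi> 0 = \<xi>"
  by (simp add: evolution_def)

lemma evolution_Suc:
  "evolution r f \<xi> (Suc t) x = f (map (evolution r f \<xi> t) [x - int r + 1..x])"
  by (simp add: evolution_def ca_step_def)

lemma equiv_translation_rel: "equiv UNIV translation_rel"
proof (rule equivI)
  show "refl translation_rel"
    by (auto simp: refl_on_def translation_rel_def intro!: exI[of _ 0])
  show "sym translation_rel"
    unfolding sym_def translation_rel_def
    by (clarsimp, metis diff_add_cancel add_uminus_conv_diff)
  show "trans translation_rel"
    unfolding trans_def translation_rel_def by (clarsimp, metis add.assoc)
qed auto

lemma finite_persistent_configurations: "finite (persistent_configurations r \<sigma> n f)"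
proof (rule finite_subset)
  show "persistent_configurations r \<sigma> n f \<subseteq> repetition ` words \<sigma> n"
  proof
    fix \<xi> assume "\<xi> \<in> persistent_configurations r \<sigma> n f"
    then obtain w where w: "w \<noteq> []" "length w = \<sigma>" "\<xi> = repetition w" and c: "\<xi> \<in> configurations n"
      by (auto simp: persistent_configurations_def has_minimal_period_def)
    have "w ! i < n" if "i < length w" for i
    proof -
      have "\<xi> (int i) = w ! i"
        using that by (simp add: w(3) repetition_def)
      then show ?thesis
        using c by (auto simp: configurations_def dest!: Pi_mem[of _ _ _ "int i"])
    qed
    then have "w \<in> words \<sigma> n"
      using w by (auto simp: words_def in_set_conv_nth)
    then show "\<xi> \<in> repetition ` words \<sigma> n"
      using w by blast
  qed
qed (simp add: finite_words)

lemma finite_persistent_classes: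
  "finite (persistent_configurations r \<sigma> n f // translation_rel)"
  unfolding quotient_def using finite_persistent_configurations by auto

end

theory Submission
  imports Defs "HOL-Real_Asymp.Real_Asymp"
begin

text \<open>Since \<open>\<sigma> \<le> r\<close>, the windows seen by the distinct translates of the configurations of minimal period
  \<open>\<sigma>\<close> are all different, so a uniform rule induces a uniform map from the \<open>N\<close> translation classes to
  the \<open>n ^ \<sigma>\<close> periodic configurations: each class is hit through \<open>\<sigma>\<close> targets, and the \<open>d\<close>
  configurations of smaller period are dead targets. Counting forests gives the exact probability
  that \<open>m\<close> classes survive, \<open>(N choose m) * (m * \<sigma>) ^ m * d * (d + l * \<sigma>) ^ (l - 1) / (d + N * \<sigma>) ^ N\<close>
  with \<open>l = N - m\<close>. The number \<open>d\<close> is of order \<open>n ^ (\<sigma> / 2)\<close>, that is of order \<open>sqrt N\<close>, exactly if \<open>\<sigma>\<close>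
  is even. Then Stirling's formula yields a limiting density for \<open>m / N\<close>; for odd \<open>\<sigma>\<close> the mass below
  \<open>(1 - \<epsilon>) * N\<close> vanishes.

  On the other side, the part of the bridge after the hitting time is symmetric, so the reflection
  principle gives \<open>P (\<tau> \<le> t) = 2 * P (\<eta> t \<le> 0)\<close>, whose explicit Gaussian form has the same density.\<close>

section \<open>Random maps with dead targets\<close>

text \<open>The starting point 1 / sqrt \<sigma> of the bridge is the limit of d / (\<sigma> * sqrt
  N): d is asymptotic to n ^ (\<sigma> / 2) and N to n ^ \<sigma> / \<sigma>. This limit is the
  parameter \<open>a\<close> of both the local limit and the bridge. Two obstacles shape the
  argument. \<open>brownian_bridge\<close> provides normality of linear combinations, means and
  covariances, but no Markov property. The reflection is therefore done at the first low value on a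
  finite grid, where flipping the sign of a centred increment is a statement about characteristic
  functions; continuity of the paths then leads to the hitting time itself. The local limit, in
  turn, is only pointwise, without a bound uniform up to the ends m = 0 and m = N. It bounds the
  mass of compact subintervals of (0, 1) from below; since the limiting density has total mass one
  there, no mass can hide at the ends, and intervals on the two sides of a point determine the
  distribution function at that point.\<close>

text \<open>A map \<open>g\<close> sends points to targets: \<open>B j\<close> is the set of targets that stand for the point \<open>j\<close>, and
  the targets outside all of these sets are dead.\<close>

definition closed_under :: "('i \<Rightarrow> 'y set) \<Rightarrow> ('i \<Rightarrow> 'y) \<Rightarrow> 'i set \<Rightarrow> bool" where
  "closed_under B g S \<longleftrightarrow> (\<forall>i\<in>S. g i \<in> (\<Union>j\<in>S. B j))"

text \<open>Says that every trajectory reaches a target lying over no point of \<open>L\<close>: a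
  trajectory that never does so sweeps out a nonempty closed set. The form by closed sets avoids
  iterating \<open>g\<close>, whose values are targets and not points.\<close>

definition dying :: "('i \<Rightarrow> 'y set) \<Rightarrow> 'i set \<Rightarrow> ('i \<Rightarrow> 'y) \<Rightarrow> bool" where
  "dying B L g \<longleftrightarrow> (\<forall>S\<subseteq>L. closed_under B g S \<longrightarrow> S = {})"

text \<open>Closed sets are stable under unions, so this is the largest one; its points are those
  that never have to reach a dead target.\<close>

definition alive :: "('i \<Rightarrow> 'y set) \<Rightarrow> 'i set \<Rightarrow> ('i \<Rightarrow> 'y) \<Rightarrow> 'i set" where
  "alive B R g = \<Union>{S. S \<subseteq> R \<and> closed_under B g S}"

text \<open>For \<open>s = 1\<close> this is Cayley's number of forests on \<open>d + l\<close>
  labelled vertices with \<open>d\<close> prescribed roots. At \<open>l = 0\<close> the product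
  formula would give \<open>d\<close> instead of the single empty map.\<close>

definition forest_count :: "nat \<Rightarrow> nat \<Rightarrow> nat \<Rightarrow> nat" where
  "forest_count s l d = (if l = 0 then 1 else d * (d + l * s) ^ (l - 1))"

text \<open>Factors a count of maps when conditions on two disjoint sets of points do not interact;
  used once for a layer of a forest and once for the surviving set.\<close>

lemma card_restrict_pair:
  assumes "J \<inter> K = {}" "G1 \<subseteq> extensional J" "G2 \<subseteq> extensional K"
  shows "card {g \<in> extensional (J \<union> K). restrict g J \<in> G1 \<and> restrict g K \<in> G2} = card G1 * card G2"
proof -
  have "bij_betw (\<lambda>g. (restrict g J, restrict g K))
      {g \<in> extensional (J \<union> K). restrict g J \<in> G1 \<and> restrict g K \<in> G2} (G1 \<times> G2)"
  proof (rule bij_betw_byWitness[where f' = "\<lambda>(a, b) i. if i \<in> J then a i else b i"])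
    show "\<forall>g\<in>{g \<in> extensional (J \<union> K). restrict g J \<in> G1 \<and> restrict g K \<in> G2}.
       (case (restrict g J, restrict g K) of (a, b) \<Rightarrow> \<lambda>i. if i \<in> J then a i else b i) = g"
      by (auto simp: fun_eq_iff extensional_def)
    have *: "restrict (\<lambda>i. if i \<in> J then a i else b i) J = a"
      "restrict (\<lambda>i. if i \<in> J then a i else b i) K = b" if "a \<in> G1" "b \<in> G2" for a b
      using that assms unfolding extensional_def by (fastforce simp: fun_eq_iff)+
    show "\<forall>x\<in>G1 \<times> G2.
       (restrict (case x of (a, b) \<Rightarrow> \<lambda>i. if i \<in> J then a i else b i) J,
        restrict (case x of (a, b) \<Rightarrow> \<lambda>i. if i \<in> J then a i else b i) K) = x"
      using * by auto
    show "(\<lambda>g. (restrict g J, restrict g K)) `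
       {g \<in> extensional (J \<union> K). restrict g J \<in> G1 \<and> restrict g K \<in> G2} \<subseteq> G1 \<times> G2"
      by auto
    show "(\<lambda>(a, b) i. if i \<in> J then a i else b i) ` (G1 \<times> G2) \<subseteq>
       {g \<in> extensional (J \<union> K). restrict g J \<in> G1 \<and> restrict g K \<in> G2}"
      using * assms by (auto simp: extensional_def)
  qed
  then show ?thesis
    by (simp add: bij_betw_same_card card_cartesian_product)
qed

lemma closed_under_cong:
  "(\<And>i. i \<in> S \<Longrightarrow> g i = h i) \<Longrightarrow> closed_under B g S = closed_under B h S"
  by (auto simp: closed_under_def)

lemma dying_cong:
  "(\<And>i. i \<in> L \<Longrightarrow> g i = h i) \<Longrightarrow> dying B L g = dying B L h"
  unfolding dying_def by (metis closed_under_cong subsetD)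

lemma sum_Pow_card:
  assumes "finite L"
  shows "(\<Sum>J\<in>Pow L. (f (card J) :: nat)) = (\<Sum>j\<le>card L. (card L choose j) * f j)"
proof -
  have "(\<Sum>J\<in>Pow L. f (card J)) = (\<Sum>j\<le>card L. \<Sum>J\<in>{J \<in> Pow L. card J = j}. f (card J))"
    using assms by (intro sum.group[symmetric]) (auto intro: card_mono)
  also have "\<dots> = (\<Sum>j\<le>card L. card {J \<in> Pow L. card J = j} * f j)"
    by (intro sum.cong) auto
  also have "\<dots> = (\<Sum>j\<le>card L. (card L choose j) * f j)"
    using n_subsets[OF assms] by (simp add: Pow_def)
  finally show ?thesis .
qed

lemma card_UN_fibres:
  assumes "finite L" "\<And>i. i \<in> L \<Longrightarrow> finite (B i)" "\<And>i. i \<in> L \<Longrightarrow> card (B i) = s"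
    "disjoint_family_on B L"
  shows "card (\<Union>i\<in>L. B i) = card L * s"
  using assms by (subst card_UN_disjoint) (auto simp: disjoint_family_on_def)

text \<open>The index \<open>j\<close> is the number of points sent directly to dead targets. The
  factor \<open>j\<close> in the inner count is absorbed by the binomial coefficient, and
  \<open>j * s + (l - j) * s = l * s\<close> makes the base of the power independent of
  \<open>j\<close>, so that the binomial theorem remains.\<close>

lemma forest_count_layers:
  assumes "l > 0"
  shows "forest_count s l d = (\<Sum>j=1..l. (l choose j) * (d ^ j * forest_count s (l - j) (j * s)))"
proof -
  obtain k where k: "l = Suc k"
    using assms gr0_implies_Suc by blast
  have "(\<Sum>j=1..l. (l choose j) * (d ^ j * forest_count s (l - j) (j * s)))
      = (\<Sum>j=0..k. (l choose Suc j) * (d ^ Suc j * forest_count s (l - Suc j) (Suc j * s)))"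
    unfolding k One_nat_def by (subst sum.atLeast_Suc_atMost_Suc_shift) simp
  also have "\<dots> = (\<Sum>j=0..k. d * ((k choose j) * d ^ j * (l * s) ^ (k - j)))"
  proof (intro sum.cong refl)
    fix j assume "j \<in> {0..k}"
    then have j: "j \<le> k" by simp
    show "(l choose Suc j) * (d ^ Suc j * forest_count s (l - Suc j) (Suc j * s)) =
      d * ((k choose j) * d ^ j * (l * s) ^ (k - j))"
    \<comment> \<open>For \<open>j = k\<close> no point is left over and \<open>forest_count\<close>
      takes its exceptional value 1.\<close>
    proof (cases "j = k")
      case True
      then show ?thesis by (simp add: k forest_count_def)
    next
      case False
      have e: "(l choose Suc j) * Suc j = l * (k choose j)"
        unfolding k by (metis Suc_times_binomial_eq)
      have e2: "Suc j * s + (l - Suc j) * s = l * s"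
        using j unfolding k by (simp flip: add_mult_distrib)
      have e3: "k - j = Suc (l - Suc j - 1)"
        using j False unfolding k by simp
      have f: "forest_count s (l - Suc j) (Suc j * s) = Suc j * s * (l * s) ^ (l - Suc j - 1)"
        using j False unfolding forest_count_def e2 by (simp add: k)
      have "(l choose Suc j) * (d ^ Suc j * forest_count s (l - Suc j) (Suc j * s))
          = ((l choose Suc j) * Suc j) * s * d ^ Suc j * (l * s) ^ (l - Suc j - 1)"
        unfolding f by (simp only: ac_simps)
      also have "\<dots> = d * ((k choose j) * d ^ j * ((l * s) * (l * s) ^ (l - Suc j - 1)))"
        unfolding e power_Suc by (simp only: ac_simps)
      also have "\<dots> = d * ((k choose j) * d ^ j * (l * s) ^ (k - j))"
        unfolding e3 power_Suc ..
      finally show ?thesis .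
    qed
  qed
  also have "\<dots> = d * (\<Sum>j\<le>k. (k choose j) * d ^ j * (l * s) ^ (k - j))"
    by (simp add: sum_distrib_left atLeast0AtMost)
  also have "\<dots> = d * (d + l * s) ^ k"
    by (simp add: binomial)
  finally show ?thesis
    by (simp add: forest_count_def k)
qed

text \<open>Split off the set \<open>K\<close> of points sent directly to a dead target: for the remaining points the
  fibres over \<open>K\<close> take over the role of the dead targets.\<close>

lemma card_dying:
  assumes "finite L" "finite Y" "\<And>i. i \<in> L \<Longrightarrow> B i \<subseteq> Y" "\<And>i. i \<in> L \<Longrightarrow> card (B i) = s"
    "disjoint_family_on B L" "card Y = d + card L * s"
  shows "card {g \<in> L \<rightarrow>\<^sub>E Y. dying B L g} = forest_count s (card L) d"
  using assms
proof (induction "card L" arbitrary: L Y d rule: less_induct)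
  case less
  note fin = \<open>finite L\<close> \<open>finite Y\<close>
  show ?case
  proof (cases "L = {}")
    case True
    then show ?thesis
      by (simp add: forest_count_def dying_def)
  next
    case False
    define U where "U = (\<Union>i\<in>L. B i)"
    have UY: "U \<subseteq> Y" using less.prems by (auto simp: U_def)
    have finU: "finite U" using UY fin finite_subset by blast
    have finB: "finite (B i)" if "i \<in> L" for i
      using less.prems(3)[OF that] fin finite_subset by blast
    have cU: "card U = card L * s"
      unfolding U_def using less.prems finB by (intro card_UN_fibres) auto
    have cd: "card (Y - U) = d"
      using less.prems(6) cU UY by (simp add: card_Diff_subset finU)
    define J where "J g = {i\<in>L. g i \<notin> U}" for g
    define G where "G = {g \<in> L \<rightarrow>\<^sub>E Y. dying B L g}"
    have finG: "finite G"
      unfolding G_def using fin by (intro finite_subset[OF _ finite_PiE[of L "\<lambda>_. Y"]]) auto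
    have "card G = (\<Sum>K\<in>Pow L. card {g\<in>G. J g = K})"
    proof -
      have "(\<Sum>K\<in>Pow L. \<Sum>g\<in>{g\<in>G. J g = K}. 1::nat) = (\<Sum>g\<in>G. 1)"
        using fin finG by (intro sum.group) (auto simp: J_def)
      then show ?thesis by simp
    qed
    also have "\<dots> = (\<Sum>K\<in>Pow L. if card K = 0 then 0 else d ^ card K * forest_count s (card L - card K) (card K * s))"
    proof (intro sum.cong refl)
      fix K assume "K \<in> Pow L"
      then have K: "K \<subseteq> L" by simp
      have finK: "finite K" using K fin finite_subset by blast
      show "card {g\<in>G. J g = K} =
        (if card K = 0 then 0 else d ^ card K * forest_count s (card L - card K) (card K * s))"
      proof (cases "K = {}")
        case True
        \<comment> \<open>Without a point leaving \<open>U\<close> the whole nonempty set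
          \<open>L\<close> is closed, so the first layer of a dying map cannot be empty.\<close>
        have "\<not> dying B L g" if "J g = {}" for g
        proof -
          have "closed_under B g L"
            using that by (auto simp: closed_under_def J_def U_def)
          then show ?thesis using False by (auto simp: dying_def)
        qed
        then have "{g\<in>G. J g = K} = {}"
          using True by (auto simp: G_def)
        then show ?thesis using True by (metis card.empty)
      next
        case nonempty: False
        have eq: "{g\<in>G. J g = K} = {g \<in> extensional (K \<union> (L - K)).
            restrict g K \<in> (K \<rightarrow>\<^sub>E (Y - U)) \<and>
            restrict g (L - K) \<in> {g \<in> (L - K) \<rightarrow>\<^sub>E U. dying B (L - K) g}}" (is "_ = ?rhs")
        proof (intro equalityI subsetI)
          fix g assume g: "g \<in> {g\<in>G. J g = K}"
          have "dying B (L - K) g"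
            using g by (auto simp: G_def dying_def)
          then have "dying B (L - K) (restrict g (L - K))"
            by (subst dying_cong[of _ _ g]) auto
          moreover have "g \<in> extensional (K \<union> (L - K))"
            using g K by (auto simp: G_def PiE_def extensional_def)
          moreover have "restrict g K \<in> (K \<rightarrow>\<^sub>E (Y - U))"
            using g by (auto simp: G_def J_def)
          moreover have "restrict g (L - K) \<in> (L - K) \<rightarrow>\<^sub>E U"
            using g by (auto simp: G_def J_def)
          ultimately show "g \<in> ?rhs" by simp
        next
          fix g assume g: "g \<in> ?rhs"
          have gK: "g i \<in> Y - U" if "i \<in> K" for i
            using g that by (auto simp: PiE_def Pi_def)
          have gL: "g i \<in> U" if "i \<in> L - K" for i
            using g that by (auto simp: PiE_def Pi_def)
          have dy: "dying B (L - K) g"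
            using g by (subst dying_cong[of _ _ "restrict g (L - K)"]) auto
          have "dying B L g"
            unfolding dying_def
          proof (intro allI impI)
            fix S assume S: "S \<subseteq> L" "closed_under B g S"
            \<comment> \<open>Points of a closed set are sent into \<open>U\<close>, whereas points
              of \<open>K\<close> are sent outside of it.\<close>
            have "S \<inter> K = {}"
            proof (rule ccontr)
              assume "S \<inter> K \<noteq> {}"
              then obtain i where i: "i \<in> S" "i \<in> K" by auto
              moreover have "g i \<in> U"
                using S i unfolding closed_under_def U_def by blast
              ultimately show False using gK[OF i(2)] by auto
            qed
            then have "S \<subseteq> L - K" using S by auto
            then show "S = {}" using dy S by (auto simp: dying_def)
          qed
          moreover have "g \<in> L \<rightarrow>\<^sub>E Y"
            using g K gK gL UY by (auto simp: PiE_def extensional_def)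
          moreover have "J g = K"
            using gK gL K by (auto simp: J_def)
          ultimately show "g \<in> {g\<in>G. J g = K}"
            by (simp add: G_def)
        qed
        have "card {g \<in> (L - K) \<rightarrow>\<^sub>E U. dying B (L - K) g}
            = forest_count s (card (L - K)) (card K * s)"
        proof (rule less.hyps)
          show "card (L - K) < card L"
            using K nonempty fin by (intro psubset_card_mono) auto
          show "disjoint_family_on B (L - K)"
            using less.prems(5) by (rule disjoint_family_on_mono[rotated]) auto
          show "card U = card K * s + card (L - K) * s"
            using K fin finK card_mono[of L K]
            by (simp add: cU card_Diff_subset flip: add_mult_distrib)
        qed (use less.prems finU in \<open>auto simp: U_def\<close>)
        moreover have "card {g\<in>G. J g = K} = card (K \<rightarrow>\<^sub>E (Y - U)) *
            card {g \<in> (L - K) \<rightarrow>\<^sub>E U. dying B (L - K) g}"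
          unfolding eq by (intro card_restrict_pair) (auto simp: PiE_def)
        ultimately show ?thesis
          using K nonempty finK cd by (simp add: card_PiE card_Diff_subset)
      qed
    qed
    also have "\<dots> = (\<Sum>j\<le>card L. (card L choose j) *
        (if j = 0 then 0 else d ^ j * forest_count s (card L - j) (j * s)))"
      by (rule sum_Pow_card[OF fin(1)])
    also have "\<dots> = (\<Sum>j=1..card L. (card L choose j) * (d ^ j * forest_count s (card L - j) (j * s)))"
      by (intro sum.mono_neutral_cong_right) auto
    also have "\<dots> = forest_count s (card L) d"
      using False fin by (intro forest_count_layers[symmetric]) (simp add: card_gt_0_iff)
    finally show ?thesis by (simp add: G_def)
  qed
qed

section \<open>Maps with a prescribed surviving set\<close>

lemma alive_subset: "alive B R g \<subseteq> R"
  by (auto simp: alive_def)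

lemma closed_under_alive: "closed_under B g (alive B R g)"
  unfolding closed_under_def
proof
  fix i assume "i \<in> alive B R g"
  then obtain S where S: "S \<subseteq> R" "closed_under B g S" "i \<in> S"
    by (auto simp: alive_def)
  then obtain j where "j \<in> S" "g i \<in> B j"
    by (auto simp: closed_under_def)
  then show "g i \<in> (\<Union>j\<in>alive B R g. B j)"
    using S by (auto simp: alive_def)
qed

text \<open>The first condition concerns \<open>g\<close> on \<open>S\<close> only and the other two
  concern \<open>g\<close> on \<open>R - S\<close> only, so the count factorises. The second one
  expresses maximality: a point sent into a fibre over \<open>S\<close> could be added to
  \<open>S\<close>.\<close>

lemma alive_eq_iff:
  assumes "S \<subseteq> R" "disjoint_family_on B R"
  shows "alive B R g = S \<longleftrightarrow>
    closed_under B g S \<and> (\<forall>i\<in>R - S. g i \<notin> (\<Union>j\<in>S. B j)) \<and> dying B (R - S) g"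
    (is "_ \<longleftrightarrow> ?c1 \<and> ?c2 \<and> ?c3")
proof
  assume eq: "alive B R g = S"
  have c1: ?c1 using closed_under_alive[of B g R] eq by simp
  have max: "T \<subseteq> S" if "T \<subseteq> R" "closed_under B g T" for T
    using that eq by (auto simp: alive_def)
  have ?c2
  proof (intro ballI notI)
    fix i assume i: "i \<in> R - S" "g i \<in> (\<Union>j\<in>S. B j)"
    have "closed_under B g (insert i S)"
      using c1 i by (auto simp: closed_under_def)
    then show False using max[of "insert i S"] i assms by auto
  qed
  moreover have ?c3
    unfolding dying_def
  proof (intro allI impI)
    fix T assume T: "T \<subseteq> R - S" "closed_under B g T"
    then show "T = {}" using max[of T] by auto
  qed
  ultimately show "?c1 \<and> ?c2 \<and> ?c3" using c1 by simp
next
  assume c: "?c1 \<and> ?c2 \<and> ?c3"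
  have "T \<subseteq> S" if T: "T \<subseteq> R" "closed_under B g T" for T
  proof -
    \<comment> \<open>Points outside \<open>S\<close> never enter the fibres over \<open>S\<close>,
      so removing \<open>S\<close> from a closed set leaves a closed set, and this one must be
      empty.\<close>
    have "closed_under B g (T - S)"
      unfolding closed_under_def
    proof
      fix i assume i: "i \<in> T - S"
      then obtain j where j: "j \<in> T" "g i \<in> B j"
        using T by (auto simp: closed_under_def)
      have "j \<notin> S" using c i j T by auto
      then show "g i \<in> (\<Union>j\<in>T - S. B j)" using j by auto
    qed
    then have "T - S = {}"
      using c T unfolding dying_def by (metis Diff_mono order_refl)
    then show ?thesis by auto
  qed
  then show "alive B R g = S"
    using c assms by (auto simp: alive_def)
qed

text \<open>On \<open>S\<close> every target over \<open>S\<close> is allowed. On the rest exactly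
  these targets are forbidden, which leaves the original \<open>d\<close> dead ones, and
  \<open>card_dying\<close> applies.\<close>

lemma card_alive_eq:
  assumes "finite R" "finite Y" "\<And>i. i \<in> R \<Longrightarrow> B i \<subseteq> Y" "\<And>i. i \<in> R \<Longrightarrow> card (B i) = s"
    "disjoint_family_on B R" "card Y = d + card R * s" "S \<subseteq> R"
  shows "card {g \<in> R \<rightarrow>\<^sub>E Y. alive B R g = S} =
    (card S * s) ^ card S * forest_count s (card R - card S) d"
proof -
  define U where "U = (\<Union>i\<in>S. B i)"
  have finS: "finite S" using assms finite_subset by blast
  have finB: "finite (B i)" if "i \<in> R" for i
    using assms(3)[OF that] assms finite_subset by blast
  have UY: "U \<subseteq> Y" using assms by (auto simp: U_def)
  have finU: "finite U" using UY assms finite_subset by blast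
  have cU: "card U = card S * s"
    unfolding U_def using assms finB finS by (intro card_UN_fibres) (auto intro: disjoint_family_on_mono)
  have eq: "{g \<in> R \<rightarrow>\<^sub>E Y. alive B R g = S} = {g \<in> extensional (S \<union> (R - S)).
      restrict g S \<in> (S \<rightarrow>\<^sub>E U) \<and>
      restrict g (R - S) \<in> {g \<in> (R - S) \<rightarrow>\<^sub>E (Y - U). dying B (R - S) g}}" (is "_ = ?rhs")
  proof (intro equalityI subsetI)
    fix g assume g: "g \<in> {g \<in> R \<rightarrow>\<^sub>E Y. alive B R g = S}"
    then have c: "closed_under B g S" "\<forall>i\<in>R - S. g i \<notin> U" "dying B (R - S) g"
      using alive_eq_iff[OF assms(7,5), of g] by (auto simp: U_def)
    have "dying B (R - S) (restrict g (R - S))"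
      using c(3) by (subst dying_cong[of _ _ g]) auto
    moreover have "restrict g S \<in> (S \<rightarrow>\<^sub>E U)"
      using c(1) by (auto simp: closed_under_def U_def)
    moreover have "restrict g (R - S) \<in> (R - S) \<rightarrow>\<^sub>E (Y - U)"
      using c(2) g by auto
    moreover have "g \<in> extensional (S \<union> (R - S))"
      using g assms(7) by (auto simp: PiE_def extensional_def)
    ultimately show "g \<in> ?rhs" by simp
  next
    fix g assume g: "g \<in> ?rhs"
    have gS: "g i \<in> U" if "i \<in> S" for i
      using g that by (auto simp: PiE_def Pi_def)
    have gR: "g i \<in> Y - U" if "i \<in> R - S" for i
      using g that by (auto simp: PiE_def Pi_def)
    have "dying B (R - S) g"
      using g by (subst dying_cong[of _ _ "restrict g (R - S)"]) auto
    then have "alive B R g = S"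
      using gS gR by (subst alive_eq_iff[OF assms(7,5)]) (auto simp: closed_under_def U_def)
    moreover have "g \<in> R \<rightarrow>\<^sub>E Y"
      using g gS gR UY assms(7) by (auto simp: PiE_def extensional_def)
    ultimately show "g \<in> {g \<in> R \<rightarrow>\<^sub>E Y. alive B R g = S}" by simp
  qed
  have "card {g \<in> (R - S) \<rightarrow>\<^sub>E (Y - U). dying B (R - S) g} = forest_count s (card (R - S)) d"
  proof (rule card_dying)
    fix i assume i: "i \<in> R - S"
    then have "B i \<inter> B j = {}" if "j \<in> S" for j
      using assms(5,7) that i unfolding disjoint_family_on_def
      by (metis DiffD1 DiffD2 subsetD)
    then have "B i \<inter> U = {}"
      by (auto simp: U_def)
    then show "B i \<subseteq> Y - U" using assms(3) i by auto
  next
    show "disjoint_family_on B (R - S)"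
      using assms(5) by (rule disjoint_family_on_mono[rotated]) auto
    have "card R = card S + card (R - S)"
      using assms(1,7) finS card_mono[of R S] by (simp add: card_Diff_subset)
    then have "card Y = d + card (R - S) * s + card U"
      by (simp add: assms(6) cU add_mult_distrib)
    then show "card (Y - U) = d + card (R - S) * s"
      by (simp add: card_Diff_subset finU UY)
  qed (use assms in auto)
  moreover have "card {g \<in> R \<rightarrow>\<^sub>E Y. alive B R g = S} = card (S \<rightarrow>\<^sub>E U) *
      card {g \<in> (R - S) \<rightarrow>\<^sub>E (Y - U). dying B (R - S) g}"
    unfolding eq by (intro card_restrict_pair) (auto simp: PiE_def)
  ultimately show ?thesis
    using assms(1,7) finS cU by (simp add: card_PiE card_Diff_subset)
qed

lemma card_card_alive_eq:
  assumes "finite R" "finite Y" "\<And>i. i \<in> R \<Longrightarrow> B i \<subseteq> Y" "\<And>i. i \<in> R \<Longrightarrow> card (B i) = s"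
    "disjoint_family_on B R" "card Y = d + card R * s"
  shows "card {g \<in> R \<rightarrow>\<^sub>E Y. card (alive B R g) = m} =
    (card R choose m) * ((m * s) ^ m * forest_count s (card R - m) d)"
proof -
  have "{g \<in> R \<rightarrow>\<^sub>E Y. card (alive B R g) = m} =
      (\<Union>S\<in>{S. S \<subseteq> R \<and> card S = m}. {g \<in> R \<rightarrow>\<^sub>E Y. alive B R g = S})"
    using alive_subset[of B R] by auto
  moreover have "card \<dots> = (\<Sum>S\<in>{S. S \<subseteq> R \<and> card S = m}. card {g \<in> R \<rightarrow>\<^sub>E Y. alive B R g = S})"
    using assms(1,2)
    by (intro card_UN_disjoint) (auto intro!: finite_subset[OF _ finite_PiE[of R "\<lambda>_. Y"]])
  moreover have "\<dots> = (\<Sum>S\<in>{S. S \<subseteq> R \<and> card S = m}. (m * s) ^ m * forest_count s (card R - m) d)"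
    using assms by (intro sum.cong refl) (auto simp: card_alive_eq[where d = d and s = s and Y = Y])
  ultimately show ?thesis
    using n_subsets[OF assms(1), of m] by simp
qed

section \<open>Sign flips of a random variable given an event\<close>

text \<open>Reduces to \<open>Levy_uniqueness\<close> by normalising: the characteristic function at
  0 is the total mass, so both measures may be divided by the same constant unless both
  vanish.\<close>

lemma finite_measure_eqI_char:
  fixes \<mu> \<nu> :: "real measure"
  assumes fin: "finite_measure \<mu>" "finite_measure \<nu>"
    and sets: "sets \<mu> = sets borel" "sets \<nu> = sets borel"
    and char: "\<And>t. char \<mu> t = char \<nu> t"
  shows "\<mu> = \<nu>"
proof -
  have sp: "space \<mu> = UNIV" "space \<nu> = UNIV"
    using sets_eq_imp_space_eq[OF sets(1)] sets_eq_imp_space_eq[OF sets(2)] by simp_all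
  define c where "c = measure \<mu> UNIV"
  have c2: "c = measure \<nu> UNIV"
    using char[of 0] by (simp add: char_def c_def sp)
  have em: "emeasure \<mu> UNIV = ennreal c" "emeasure \<nu> UNIV = ennreal c"
    using finite_measure.emeasure_eq_measure[OF fin(1), of UNIV]
      finite_measure.emeasure_eq_measure[OF fin(2), of UNIV] c2 by (auto simp: c_def)
  have c0: "c \<ge> 0" by (simp add: c_def)
  show ?thesis
  proof (cases "c = 0")
    case True
    have "emeasure \<mu> A = emeasure \<nu> A" if "A \<in> sets \<mu>" for A
    proof -
      have "emeasure \<mu> A \<le> emeasure \<mu> UNIV" "emeasure \<nu> A \<le> emeasure \<nu> UNIV"
        using sets by (auto intro!: emeasure_mono)
      then show ?thesis using em True by simp
    qed
    then show ?thesis using sets by (intro measure_eqI) auto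
  next
    case False
    then have cpos: "c > 0" using c0 by simp
    define \<mu>' where "\<mu>' = density \<mu> (\<lambda>_. ennreal (1 / c))"
    define \<nu>' where "\<nu>' = density \<nu> (\<lambda>_. ennreal (1 / c))"
    have e': "emeasure \<mu>' A = ennreal (1 / c) * emeasure \<mu> A"
      "emeasure \<nu>' A = ennreal (1 / c) * emeasure \<nu> A" if "A \<in> sets borel" for A
      using that sets by (simp_all add: \<mu>'_def \<nu>'_def emeasure_density_const)
    have "prob_space \<mu>'" "prob_space \<nu>'"
      using cpos e'[of UNIV] em
      by (auto intro!: prob_spaceI simp: \<mu>'_def \<nu>'_def sp simp flip: ennreal_mult)
    then have rd: "real_distribution \<mu>'" "real_distribution \<nu>'"
      using sets by (auto simp: real_distribution_def real_distribution_axioms_def \<mu>'_def \<nu>'_def)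
    have "char \<mu>' = char \<nu>'"
    proof
      fix t
      have "(\<lambda>x. iexp (t * x)) \<in> borel_measurable \<mu>" "(\<lambda>x. iexp (t * x)) \<in> borel_measurable \<nu>"
        by (auto simp: measurable_cong_sets[OF sets(1) refl] measurable_cong_sets[OF sets(2) refl])
      then have "char \<mu>' t = (1 / c) *\<^sub>R char \<mu> t" "char \<nu>' t = (1 / c) *\<^sub>R char \<nu> t"
        using cpos unfolding char_def \<mu>'_def \<nu>'_def by (subst integral_density; simp)+
      then show "char \<mu>' t = char \<nu>' t" using char by simp
    qed
    then have eq: "\<mu>' = \<nu>'" using Levy_uniqueness rd by blast
    have "emeasure \<mu> A = emeasure \<nu> A" if "A \<in> sets \<mu>" for A
    proof -
      have A: "A \<in> sets borel" using that sets by simp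
      have "ennreal (1 / c) * emeasure \<mu> A = ennreal (1 / c) * emeasure \<nu> A"
        using e'[OF A] eq by simp
      then have "ennreal c * (ennreal (1 / c) * emeasure \<mu> A) = ennreal c * (ennreal (1 / c) * emeasure \<nu> A)"
        by simp
      then show ?thesis
        using cpos by (simp add: mult.assoc[symmetric] flip: ennreal_mult)
    qed
    then show ?thesis using sets by (intro measure_eqI) auto
  qed
qed

text \<open>A signed weight is no density, but \<open>W + K\<close> and \<open>K\<close> are. Their
  image measures under \<open>X\<close> have equal characteristic functions because the contribution
  of \<open>W\<close> vanishes; hence they agree on \<open>B\<close>, and subtracting gives the
  claim.\<close>

lemma (in finite_measure) integral_weight_indicator_zero_real:
  fixes W X :: "'a \<Rightarrow> real"
  assumes W[measurable]: "W \<in> borel_measurable M" and X[measurable]: "X \<in> borel_measurable M"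
    and bound: "\<And>x. x \<in> space M \<Longrightarrow> \<bar>W x\<bar> \<le> K" "K \<ge> 0"
    and zero: "\<And>u. (CLINT x|M. W x *\<^sub>R iexp (u * X x)) = 0"
    and B[measurable]: "B \<in> sets borel"
  shows "(LINT x|M. W x * indicator B (X x)) = 0"
proof -
  define D1 where "D1 = density M (\<lambda>x. ennreal (W x + K))"
  define D2 where "D2 = density M (\<lambda>x. ennreal K)"
  have [measurable_cong]: "sets D1 = sets M" "sets D2 = sets M"
    by (simp_all add: D1_def D2_def)
  have nn: "W x + K \<ge> 0" if "x \<in> space M" for x
    using bound(1)[OF that] by linarith
  have nnAE: "AE x in M. 0 \<le> W x + K" using nn by auto
  have fM: "emeasure M (space M) < \<infinity>"
    using emeasure_finite[of "space M"] by (simp add: less_top[symmetric])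
  have "emeasure D1 (space D1) = (\<integral>\<^sup>+x. ennreal (W x + K) \<partial>M)"
    by (simp add: D1_def emeasure_density nn_integral_set_ennreal[symmetric] cong: nn_integral_cong_simp)
  also have "\<dots> \<le> (\<integral>\<^sup>+x. ennreal (2 * K) \<partial>M)"
    using bound by (intro nn_integral_mono ennreal_leI) (fastforce simp: abs_le_iff)
  also have "\<dots> < \<infinity>" using fM by (simp add: ennreal_mult_less_top)
  finally have f1: "finite_measure D1" by (auto intro!: finite_measureI)
  have f2: "finite_measure D2"
    using fM by (auto intro!: finite_measureI simp: D2_def emeasure_density_const ennreal_mult_eq_top_iff)
  define \<mu> where "\<mu> = distr D1 borel X"
  define \<nu> where "\<nu> = distr D2 borel X"
  have int_iexp: "complex_integrable M (\<lambda>x. iexp (u * X x))" for u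
    by (rule integrable_const_bound[where B=1]) auto
  have int_W: "complex_integrable M (\<lambda>x. W x *\<^sub>R iexp (u * X x))" for u
    using bound by (intro integrable_const_bound[where B=K]) (auto simp: norm_mult)
  have "\<mu> = \<nu>"
  proof (rule finite_measure_eqI_char)
    show "finite_measure \<mu>" "finite_measure \<nu>"
      unfolding \<mu>_def \<nu>_def using f1 f2 by (auto intro!: finite_measure.finite_measure_distr)
    show "sets \<mu> = sets borel" "sets \<nu> = sets borel" by (simp_all add: \<mu>_def \<nu>_def)
    fix u
    have "char \<mu> u = (CLINT x|M. (W x + K) *\<^sub>R iexp (u * X x))"
      unfolding char_def \<mu>_def D1_def by (simp add: integral_distr integral_density[OF _ _ nnAE])
    also have "\<dots> = (CLINT x|M. W x *\<^sub>R iexp (u * X x) + K *\<^sub>R iexp (u * X x))"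
      by (simp add: scaleR_add_left)
    also have "\<dots> = (CLINT x|M. W x *\<^sub>R iexp (u * X x)) + (CLINT x|M. K *\<^sub>R iexp (u * X x))"
      using int_W int_iexp by (intro Bochner_Integration.integral_add integrable_scaleR_right)
    also have "\<dots> = (CLINT x|M. K *\<^sub>R iexp (u * X x))"
      by (simp only: zero add_0_left)
    also have "\<dots> = char \<nu> u"
      unfolding char_def \<nu>_def D2_def using bound(2) by (simp add: integral_distr integral_density)
    finally show "char \<mu> u = char \<nu> u" .
  qed
  moreover have "(LINT x|\<mu>. indicator B x :: real) = (LINT x|M. (W x + K) * indicator B (X x))"
    unfolding \<mu>_def D1_def
    by (subst integral_distr, simp, simp, subst integral_density[OF _ _ nnAE]) auto
  moreover have "(LINT x|\<nu>. indicator B x :: real) = (LINT x|M. K * indicator B (X x))"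
    unfolding \<nu>_def D2_def using bound(2)
    by (subst integral_distr, simp, simp, subst integral_density) auto
  ultimately have "(LINT x|M. (W x + K) * indicator B (X x)) = (LINT x|M. K * indicator B (X x))"
    by metis
  moreover have "integrable M (\<lambda>x. W x * indicator B (X x))"
    using bound by (intro integrable_const_bound[where B=K]) (auto simp: abs_mult indicator_def)
  moreover have "integrable M (\<lambda>x. K * indicator B (X x))"
    using bound(2) by (intro integrable_const_bound[where B=K]) (auto simp: abs_mult indicator_def)
  ultimately show ?thesis
    by (simp add: distrib_right)
qed

text \<open>Conjugation only replaces \<open>u\<close> by \<open>- u\<close>, so the hypothesis
  passes to the conjugate weight and therefore to the real and imaginary parts of
  \<open>W\<close>.\<close>

lemma (in finite_measure) integral_weight_indicator_zero:
  fixes W :: "'a \<Rightarrow> complex" and X :: "'a \<Rightarrow> real"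
  assumes W[measurable]: "W \<in> borel_measurable M" and X[measurable]: "X \<in> borel_measurable M"
    and bound: "\<And>x. x \<in> space M \<Longrightarrow> norm (W x) \<le> K" "K \<ge> 0"
    and zero: "\<And>u. (CLINT x|M. W x * iexp (u * X x)) = 0"
    and B[measurable]: "B \<in> sets borel"
  shows "(CLINT x|M. W x * indicator B (X x)) = 0"
proof -
  have int: "complex_integrable M (\<lambda>x. W x * iexp (u * X x))" for u
    using bound by (intro integrable_const_bound[where B=K]) (auto simp: norm_mult)
  have [measurable]: "(\<lambda>x. cnj (W x)) \<in> borel_measurable M"
    by (rule borel_measurable_continuous_on[OF _ W]) (intro continuous_intros)
  have intc: "complex_integrable M (\<lambda>x. cnj (W x) * iexp (u * X x))" for u
    using bound by (intro integrable_const_bound[where B=K]) (auto simp: norm_mult)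
  have zeroc: "(CLINT x|M. cnj (W x) * iexp (u * X x)) = 0" for u
  proof -
    have "(CLINT x|M. cnj (W x) * iexp (u * X x)) = (CLINT x|M. cnj (W x * iexp (- u * X x)))"
      by (simp add: exp_cnj)
    also have "\<dots> = cnj (CLINT x|M. W x * iexp (- u * X x))"
      by (rule Bochner_Integration.integral_cnj)
    finally show ?thesis using zero[of "- u"] by simp
  qed
  have re: "(LINT x|M. Re (W x) * indicator B (X x)) = 0"
  proof (rule integral_weight_indicator_zero_real[OF _ X _ bound(2) _ B])
    show "\<bar>Re (W x)\<bar> \<le> K" if "x \<in> space M" for x
      using bound(1)[OF that] abs_Re_le_cmod[of "W x"] by linarith
    fix u
    have "(CLINT x|M. Re (W x) *\<^sub>R iexp (u * X x)) =
        (CLINT x|M. (1/2) * (W x * iexp (u * X x) + cnj (W x) * iexp (u * X x)))"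
      by (intro Bochner_Integration.integral_cong refl)
        (simp add: scaleR_conv_of_real complex_add_cnj flip: distrib_right)
    also have "\<dots> = 0" using int intc zero zeroc by simp
    finally show "(CLINT x|M. Re (W x) *\<^sub>R iexp (u * X x)) = 0" .
  qed simp
  have im: "(LINT x|M. Im (W x) * indicator B (X x)) = 0"
  proof (rule integral_weight_indicator_zero_real[OF _ X _ bound(2) _ B])
    show "\<bar>Im (W x)\<bar> \<le> K" if "x \<in> space M" for x
      using bound(1)[OF that] abs_Im_le_cmod[of "W x"] by linarith
    fix u
    have *: "complex_of_real (Im z) = (- \<i> / 2) * (z - cnj z)" for z
      by (simp add: complex_eq_iff)
    have "(CLINT x|M. Im (W x) *\<^sub>R iexp (u * X x)) =
        (CLINT x|M. (- \<i> / 2) * (W x * iexp (u * X x) - cnj (W x) * iexp (u * X x)))"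
      by (intro Bochner_Integration.integral_cong refl)
        (simp only: scaleR_conv_of_real * mult.assoc left_diff_distrib)
    also have "\<dots> = 0" using int intc zero zeroc by simp
    finally show "(CLINT x|M. Im (W x) *\<^sub>R iexp (u * X x)) = 0" .
  qed simp
  have intB: "complex_integrable M (\<lambda>x. W x * indicator B (X x))"
    using bound by (intro integrable_const_bound[where B=K]) (auto simp: norm_mult indicator_def)
  show ?thesis
  proof (rule complex_eqI)
    have "Re (CLINT x|M. W x * indicator B (X x)) = (LINT x|M. Re (W x * indicator B (X x)))"
      using intB by (rule integral_Re[symmetric])
    also have "\<dots> = (LINT x|M. Re (W x) * indicator B (X x))"
      by (intro Bochner_Integration.integral_cong) (auto simp: indicator_def)
    finally show "Re (CLINT x|M. W x * indicator B (X x)) = Re 0" using re by simp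
    have "Im (CLINT x|M. W x * indicator B (X x)) = (LINT x|M. Im (W x * indicator B (X x)))"
      using intB by (rule integral_Im[symmetric])
    also have "\<dots> = (LINT x|M. Im (W x) * indicator B (X x))"
      by (intro Bochner_Integration.integral_cong) (auto simp: indicator_def)
    finally show "Im (CLINT x|M. W x * indicator B (X x)) = Im 0" using im by simp
  qed
qed

text \<open>In place of a uniqueness theorem in several dimensions, the exponentials in the
  \<open>X i\<close> are exchanged for indicators one coordinate at a time. What remains at the end
  is that \<open>Y\<close> has a symmetric law under the measure restricted to the event given by
  the \<open>B i\<close>.\<close>

lemma (in prob_space) prob_symmetric_given:
  fixes X :: "nat \<Rightarrow> 'a \<Rightarrow> real" and Y :: "'a \<Rightarrow> real"
  assumes X[measurable]: "\<And>i. i < k \<Longrightarrow> X i \<in> borel_measurable M" and Y[measurable]: "Y \<in> borel_measurable M"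
    and B[measurable]: "\<And>i. i < k \<Longrightarrow> B i \<in> sets borel"
    and sym: "\<And>u v. (CLINT x|M. iexp ((\<Sum>i<k. u i * X i x) + v * Y x)) =
                (CLINT x|M. iexp ((\<Sum>i<k. u i * X i x) - v * Y x))"
  shows "prob {x \<in> space M. (\<forall>i<k. X i x \<in> B i) \<and> Y x < 0} =
         prob {x \<in> space M. (\<forall>i<k. X i x \<in> B i) \<and> Y x > 0}"
proof -
  \<comment> \<open>The first \<open>j\<close> coordinates already carry indicators, the others
    still exponentials. It must hold for all \<open>u\<close>, since the frequency of coordinate
    \<open>j\<close> is the free variable of the next uniqueness argument.\<close>
  have ind: "(CLINT x|M. (\<Prod>i<j. indicator (B i) (X i x)) *
      (iexp (\<Sum>i=j..<k. u i * X i x) * (iexp (v * Y x) - iexp (- (v * Y x))))) = 0"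
    if "j \<le> k" for j u v
    using that
  proof (induction j arbitrary: u v)
    case 0
    have i1: "complex_integrable M (\<lambda>x. iexp ((\<Sum>i<k. u i * X i x) + v * Y x))"
      "complex_integrable M (\<lambda>x. iexp ((\<Sum>i<k. u i * X i x) - v * Y x))"
      by (auto intro!: integrable_const_bound[where B=1])
    have "(CLINT x|M. (\<Prod>i<0. indicator (B i) (X i x)) *
      (iexp (\<Sum>i=0..<k. u i * X i x) * (iexp (v * Y x) - iexp (- (v * Y x))))) =
      (CLINT x|M. iexp ((\<Sum>i<k. u i * X i x) + v * Y x) - iexp ((\<Sum>i<k. u i * X i x) - v * Y x))"
      by (intro Bochner_Integration.integral_cong refl)
        (simp add: atLeast0LessThan right_diff_distrib ring_distribs exp_add exp_diff exp_minus divide_inverse del: of_real_sum)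
    also have "\<dots> = 0" using i1 sym[of u v] by simp
    finally show ?case .
  next
    case (Suc j)
    define W where "W x = (\<Prod>i<j. indicator (B i) (X i x)) *
      (iexp (\<Sum>i=Suc j..<k. u i * X i x) * (iexp (v * Y x) - iexp (- (v * Y x))))" for x
    have jk: "j < k" using Suc.prems by simp
    have "(CLINT x|M. W x * indicator (B j) (X j x)) = 0"
    proof (rule integral_weight_indicator_zero[where K=2])
      have [measurable]: "(\<lambda>x. indicator (B i) (X i x) :: complex) \<in> borel_measurable M" if "i < k" for i
        using that by measurable
      have [measurable]: "(\<lambda>x. \<Prod>i<j. indicator (B i) (X i x) :: complex) \<in> borel_measurable M"
        using jk by (intro borel_measurable_prod) auto
      have [measurable]: "(\<lambda>x. \<Sum>i=Suc j..<k. u i * X i x) \<in> borel_measurable M"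
        by (intro borel_measurable_sum borel_measurable_times X) auto
      show "W \<in> borel_measurable M" unfolding W_def by measurable
      show "X j \<in> borel_measurable M" "B j \<in> sets borel" using jk by auto
      show "norm (W x) \<le> 2" for x
      proof -
        have 1: "norm (\<Prod>i<j. indicator (B i) (X i x) :: complex) \<le> 1"
          by (auto simp: prod_norm[symmetric] indicator_def intro!: prod_le_1)
        have 2: "norm (iexp (v * Y x) - iexp (- (v * Y x))) \<le> 2"
          by (rule order_trans[OF norm_triangle_ineq4]) simp
        have "norm (W x) = norm (\<Prod>i<j. indicator (B i) (X i x) :: complex) *
            norm (iexp (v * Y x) - iexp (- (v * Y x)))"
          by (simp add: W_def norm_mult)
        also have "\<dots> \<le> 1 * 2" using 1 2 by (intro mult_mono) auto
        finally show ?thesis by simp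
      qed
      fix w
      have "W x * iexp (w * X j x) = (\<Prod>i<j. indicator (B i) (X i x)) *
        (iexp (\<Sum>i=j..<k. (u(j := w)) i * X i x) * (iexp (v * Y x) - iexp (- (v * Y x))))" for x
      proof -
        have "(\<Sum>i=j..<k. (u(j := w)) i * X i x) = w * X j x + (\<Sum>i=Suc j..<k. u i * X i x)"
          using jk by (subst sum.atLeast_Suc_lessThan) auto
        then show ?thesis
          unfolding W_def by (simp add: ring_distribs exp_add mult_ac)
      qed
      then show "(CLINT x|M. W x * iexp (w * X j x)) = 0"
        using Suc.IH[of "u(j := w)" v] jk by simp
    qed simp
    then show ?case
      by (simp add: W_def mult_ac)
  qed
  define A where "A = {x \<in> space M. \<forall>i<k. X i x \<in> B i}"
  have A[measurable]: "A \<in> sets M"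
    unfolding A_def by measurable
  have prodA: "(\<Prod>i<k. indicator (B i) (X i x)) = (indicator A x :: complex)" if "x \<in> space M" for x
    using that by (auto simp: A_def indicator_def prod_zero_iff)
  \<comment> \<open>The restriction of the measure to the event \<open>A\<close>; it is finite but
    in general not a probability measure.\<close>
  define D where "D = density M (\<lambda>x. ennreal (indicator A x))"
  have [measurable_cong]: "sets D = sets M" by (simp add: D_def)
  have emD: "emeasure D C = emeasure M (A \<inter> C)" if C: "C \<in> sets M" for C
  proof -
    have "emeasure D C = (\<integral>\<^sup>+x. indicator (A \<inter> C) x \<partial>M)"
      unfolding D_def using C
      by (subst emeasure_density) (simp, simp, intro nn_integral_cong, simp add: indicator_def)
    then show ?thesis using C by simp
  qed
  have "emeasure D (space D) = emeasure M (A \<inter> space M)"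
    using emD[of "space M"] by (simp add: D_def)
  then have fD: "finite_measure D" by (intro finite_measureI) simp
  have "distr D borel Y = distr D borel (\<lambda>x. - Y x)"
  proof (rule finite_measure_eqI_char)
    show "finite_measure (distr D borel Y)" "finite_measure (distr D borel (\<lambda>x. - Y x))"
      using fD by (auto intro!: finite_measure.finite_measure_distr)
    fix v
    have i: "complex_integrable M (\<lambda>x. indicator A x *\<^sub>R iexp (v * Y x))"
      "complex_integrable M (\<lambda>x. indicator A x *\<^sub>R iexp (- (v * Y x)))"
      by (auto intro!: integrable_const_bound[where B=1] simp: indicator_def)
    have "(CLINT x|M. indicator A x *\<^sub>R iexp (v * Y x)) - (CLINT x|M. indicator A x *\<^sub>R iexp (- (v * Y x)))
      = (CLINT x|M. (\<Prod>i<k. indicator (B i) (X i x)) *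
        (iexp (\<Sum>i=k..<k. 0 * X i x) * (iexp (v * Y x) - iexp (- (v * Y x)))))"
    proof -
      have "(CLINT x|M. indicator A x *\<^sub>R iexp (v * Y x)) - (CLINT x|M. indicator A x *\<^sub>R iexp (- (v * Y x)))
        = (CLINT x|M. indicator A x *\<^sub>R iexp (v * Y x) - indicator A x *\<^sub>R iexp (- (v * Y x)))"
        by (rule Bochner_Integration.integral_diff[symmetric, OF i])
      then show ?thesis
        by (simp only:, intro Bochner_Integration.integral_cong refl, subst prodA, simp)
          (simp add: indicator_def)
    qed
    also have "\<dots> = 0" using ind[of k "\<lambda>_. 0" v] by simp
    finally show "char (distr D borel Y) v = char (distr D borel (\<lambda>x. - Y x)) v"
      unfolding char_def D_def by (simp add: integral_distr integral_density)
  qed auto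
  then have "measure (distr D borel Y) {..<0} = measure (distr D borel (\<lambda>x. - Y x)) {..<0}"
    by simp
  moreover have "measure (distr D borel Y) {..<0} = prob {x \<in> space M. (\<forall>i<k. X i x \<in> B i) \<and> Y x < 0}"
  proof -
    have "emeasure (distr D borel Y) {..<0} = emeasure M (A \<inter> (Y -` {..<0} \<inter> space M))"
      using emD by (simp add: emeasure_distr D_def)
    also have "A \<inter> (Y -` {..<0} \<inter> space M) = {x \<in> space M. (\<forall>i<k. X i x \<in> B i) \<and> Y x < 0}"
      by (auto simp: A_def)
    finally show ?thesis by (simp add: measure_def)
  qed
  moreover have "measure (distr D borel (\<lambda>x. - Y x)) {..<0} = prob {x \<in> space M. (\<forall>i<k. X i x \<in> B i) \<and> Y x > 0}"
  proof -
    have "emeasure (distr D borel (\<lambda>x. - Y x)) {..<0} = emeasure M (A \<inter> ((\<lambda>x. - Y x) -` {..<0} \<inter> space M))"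
      using emD by (simp add: emeasure_distr D_def)
    also have "A \<inter> ((\<lambda>x. - Y x) -` {..<0} \<inter> space M) = {x \<in> space M. (\<forall>i<k. X i x \<in> B i) \<and> Y x > 0}"
      by (auto simp: A_def)
    finally show ?thesis by (simp add: measure_def)
  qed
  ultimately show ?thesis by simp
qed

section \<open>The hitting time of the Brownian bridge\<close>

lemma normal_measure_moments:
  assumes "s \<ge> 0"
  shows "integrable (normal_measure m s) (\<lambda>x. x)" "(LINT x|normal_measure m s. x) = m"
    "integrable (normal_measure m s) (\<lambda>x. (x - m)\<^sup>2)" "(LINT x|normal_measure m s. (x - m)\<^sup>2) = s\<^sup>2"
proof -
  have "integrable (normal_measure m s) (\<lambda>x. x) \<and> (LINT x|normal_measure m s. x) = m \<and>
    integrable (normal_measure m s) (\<lambda>x. (x - m)\<^sup>2) \<and> (LINT x|normal_measure m s. (x - m)\<^sup>2) = s\<^sup>2"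
  proof (cases "s = 0")
    case True
    interpret R: prob_space "return borel m" by (rule prob_space_return) simp
    have ae: "AE x in return borel m. x = m" by (subst AE_return) auto
    have 1: "integrable (return borel m) (\<lambda>x. x)"
      by (rule R.integrable_const_bound[where B="\<bar>m\<bar>"]) (use ae in auto)
    have 2: "integrable (return borel m) (\<lambda>x. (x - m)\<^sup>2)"
      by (rule R.integrable_const_bound[where B=0]) (use ae in auto)
    have 3: "(LINT x|return borel m. x) = m" "(LINT x|return borel m. (x - m)\<^sup>2) = 0"
      by (simp_all add: integral_return)
    show ?thesis using 1 2 3 True by (simp add: normal_measure_def)
  next
    case False
    then have s: "s > 0" using assms by simp
    have 1: "integrable (density lborel (\<lambda>x. ennreal (normal_density m s x))) (\<lambda>x. x)"
      using integrable_normal_moment_nz_1[OF s] by (subst integrable_density) auto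
    have 2: "integrable (density lborel (\<lambda>x. ennreal (normal_density m s x))) (\<lambda>x. (x - m)\<^sup>2)"
      using integrable_normal_moment[OF s, of m 2] by (subst integrable_density) auto
    have 3: "(LINT x|density lborel (\<lambda>x. ennreal (normal_density m s x)). x) = m"
      using integral_normal_moment_nz_1[OF s] by (subst integral_density) auto
    have 4: "(LINT x|density lborel (\<lambda>x. ennreal (normal_density m s x)). (x - m)\<^sup>2) = s\<^sup>2"
      using integral_normal_moment_even[OF s, of m 1] by (subst integral_density) (auto simp: fact_numeral)
    show ?thesis using 1 2 3 4 False by (simp add: normal_measure_def)
  qed
  then show "integrable (normal_measure m s) (\<lambda>x. x)" "(LINT x|normal_measure m s. x) = m"
    "integrable (normal_measure m s) (\<lambda>x. (x - m)\<^sup>2)" "(LINT x|normal_measure m s. (x - m)\<^sup>2) = s\<^sup>2"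
    by auto
qed

lemma normal_variable_moments:
  assumes Z[measurable]: "Z \<in> borel_measurable M" and s: "s \<ge> 0" and d: "distr M borel Z = normal_measure m s"
  shows "integrable M Z" "(LINT \<omega>|M. Z \<omega>) = m"
    "integrable M (\<lambda>\<omega>. (Z \<omega> - m)\<^sup>2)" "(LINT \<omega>|M. (Z \<omega> - m)\<^sup>2) = s\<^sup>2"
  using normal_measure_moments[OF s, of m] unfolding d[symmetric]
  by (simp_all add: integrable_distr_eq integral_distr)

text \<open>The parameters are known only to exist, so they are recovered as moments;
  \<open>s \<ge> 0\<close> makes the variance determine \<open>s\<close>.\<close>

lemma normal_variables_eq_distr:
  assumes [measurable]: "Z1 \<in> borel_measurable M" "Z2 \<in> borel_measurable M"
    and "\<exists>m s. s \<ge> 0 \<and> distr M borel Z1 = normal_measure m s"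
    and "\<exists>m s. s \<ge> 0 \<and> distr M borel Z2 = normal_measure m s"
    and "(LINT \<omega>|M. Z1 \<omega>) = \<mu>" "(LINT \<omega>|M. Z2 \<omega>) = \<mu>"
    and "(LINT \<omega>|M. (Z1 \<omega> - \<mu>)\<^sup>2) = (LINT \<omega>|M. (Z2 \<omega> - \<mu>)\<^sup>2)"
  shows "distr M borel Z1 = distr M borel Z2"
proof -
  obtain m1 s1 where 1: "s1 \<ge> 0" "distr M borel Z1 = normal_measure m1 s1" using assms by blast
  obtain m2 s2 where 2: "s2 \<ge> 0" "distr M borel Z2 = normal_measure m2 s2" using assms by blast
  have "m1 = \<mu>" "m2 = \<mu>"
    using normal_variable_moments(2)[OF _ 1] normal_variable_moments(2)[OF _ 2] assms by auto
  moreover have "s1\<^sup>2 = s2\<^sup>2"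
    using normal_variable_moments(4)[OF _ 1] normal_variable_moments(4)[OF _ 2] assms calculation by auto
  ultimately show ?thesis using 1 2 by (simp add: power2_eq_iff_nonneg)
qed

lemma integrable_product:
  fixes f g :: "'a \<Rightarrow> real"
  assumes [measurable]: "f \<in> borel_measurable M" "g \<in> borel_measurable M"
    and "integrable M (\<lambda>x. (f x)\<^sup>2)" "integrable M (\<lambda>x. (g x)\<^sup>2)"
  shows "integrable M (\<lambda>x. f x * g x)"
proof (rule Bochner_Integration.integrable_bound)
  show "integrable M (\<lambda>x. (f x)\<^sup>2 + (g x)\<^sup>2)" using assms by auto
  show "AE x in M. norm (f x * g x) \<le> norm ((f x)\<^sup>2 + (g x)\<^sup>2)"
  proof (rule AE_I2)
    fix x
    have "0 \<le> (\<bar>f x\<bar> - \<bar>g x\<bar>)\<^sup>2" by simp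
    then have "2 * (\<bar>f x\<bar> * \<bar>g x\<bar>) \<le> (f x)\<^sup>2 + (g x)\<^sup>2"
      by (simp add: power2_diff)
    moreover have "0 \<le> \<bar>f x\<bar> * \<bar>g x\<bar>" by simp
    ultimately have "\<bar>f x\<bar> * \<bar>g x\<bar> \<le> (f x)\<^sup>2 + (g x)\<^sup>2" by linarith
    then show "norm (f x * g x) \<le> norm ((f x)\<^sup>2 + (g x)\<^sup>2)" by (simp add: abs_mult)
  qed
qed simp

text \<open>The infimum is attained because the zero set is closed. A nonpositive value witnesses an
  earlier zero by the intermediate value theorem, as the path starts above 0.\<close>

lemma hitting_path:
  fixes f :: "real \<Rightarrow> real"
  assumes cont: "continuous_on {0..1} f" and f0: "f 0 > 0" and f1: "f 1 = 0"
  defines "\<tau> \<equiv> Inf {t \<in> {0..1}. f t = 0}"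
  shows "\<tau> \<in> {0<..1}" "f \<tau> = 0" "\<And>s. s \<in> {0..1} \<Longrightarrow> f s \<le> 0 \<Longrightarrow> \<tau> \<le> s"
proof -
  let ?Z = "{t \<in> {0..1}. f t = 0}"
  have "closed ?Z"
    using continuous_closed_preimage_constant[OF cont, of 0] by simp
  moreover have "?Z \<noteq> {}" using f1 by (auto intro!: exI[of _ 1])
  moreover have bdd: "bdd_below ?Z" by (auto intro!: bdd_belowI[of _ 0])
  ultimately have "\<tau> \<in> ?Z"
    unfolding \<tau>_def by (intro closed_contains_Inf) auto
  then show \<tau>: "f \<tau> = 0" "\<tau> \<in> {0<..1}"
    using f0 by (auto simp: less_le)
  fix s assume s: "s \<in> {0..1}" "f s \<le> 0"
  have "\<exists>x\<ge>0. x \<le> s \<and> f x = 0"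
    using s f0 by (intro IVT2' continuous_on_subset[OF cont]) auto
  then obtain x where "0 \<le> x" "x \<le> s" "f x = 0" by blast
  then show "\<tau> \<le> s"
    unfolding \<tau>_def using s bdd by (intro cInf_lower2[of x]) auto
qed

locale bridge_to_zero =
  fixes M :: "'a measure" and a :: real and \<eta> :: "real \<Rightarrow> 'a \<Rightarrow> real"
  assumes bridge: "brownian_bridge M a 0 \<eta>" and a_pos: "a > 0"
begin

lemma gaussian: "gaussian_process M {0..1} \<eta>"
  using bridge by (simp add: brownian_bridge_def)

sublocale prob_space M
  using gaussian by (simp add: gaussian_process_def)

lemma measurable_\<eta>: "t \<in> {0..1} \<Longrightarrow> \<eta> t \<in> borel_measurable M"
  using gaussian by (simp add: gaussian_process_def)

lemma path:
  assumes "\<omega> \<in> space M"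
  shows "continuous_on {0..1} (\<lambda>t. \<eta> t \<omega>)" "\<eta> 0 \<omega> = a" "\<eta> 1 \<omega> = 0"
  using bridge assms by (auto simp: brownian_bridge_def)

lemma mean: "t \<in> {0..1} \<Longrightarrow> (LINT \<omega>|M. \<eta> t \<omega>) = a * (1 - t)"
  using bridge by (auto simp: brownian_bridge_def algebra_simps)

lemma covariance:
  assumes "s \<in> {0..1}" "t \<in> {0..1}"
  shows "(LINT \<omega>|M. (\<eta> s \<omega> - a * (1 - s)) * (\<eta> t \<omega> - a * (1 - t))) = min s t - s * t"
proof -
  have "a + (0 - a) * u = a * (1 - u)" for u by (simp add: algebra_simps)
  then show ?thesis using bridge assms unfolding brownian_bridge_def by simp
qed

text \<open>\<open>gaussian_process\<close> sums over a set of times, whereas an indexed family may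
  repeat a time; coefficients belonging to the same time are added up.\<close>

lemma linear_combination_normal:
  assumes "finite I" "T ` I \<subseteq> {0..1}"
  shows "\<exists>m s. s \<ge> 0 \<and> distr M borel (\<lambda>\<omega>. \<Sum>i\<in>I. c i * \<eta> (T i) \<omega>) = normal_measure m s"
proof -
  have "(\<Sum>i\<in>I. c i * \<eta> (T i) \<omega>) = (\<Sum>t\<in>T ` I. (\<Sum>i\<in>{i\<in>I. T i = t}. c i) * \<eta> t \<omega>)" for \<omega>
  proof -
    have "(\<Sum>i\<in>I. c i * \<eta> (T i) \<omega>) = (\<Sum>t\<in>T ` I. \<Sum>i\<in>{i\<in>I. T i = t}. c i * \<eta> (T i) \<omega>)"
      by (rule sum.image_gen[OF assms(1)])
    also have "\<dots> = (\<Sum>t\<in>T ` I. (\<Sum>i\<in>{i\<in>I. T i = t}. c i) * \<eta> t \<omega>)"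
      by (intro sum.cong refl) (simp add: sum_distrib_right)
    finally show ?thesis .
  qed
  moreover have "finite (T ` I) \<and> T ` I \<subseteq> {0..1}" using assms by simp
  ultimately show ?thesis
    using gaussian unfolding gaussian_process_def by presburger
qed

lemma single_normal:
  assumes "t \<in> {0..1}"
  shows "distr M borel (\<eta> t) = normal_measure (a * (1 - t)) (sqrt (t * (1 - t)))"
proof -
  obtain m s where ms: "s \<ge> 0" "distr M borel (\<eta> t) = normal_measure m s"
    using linear_combination_normal[of "{0::nat}" "\<lambda>_. t" "\<lambda>_. 1"] assms by auto
  note mom = normal_variable_moments[OF measurable_\<eta>[OF assms] ms]
  have m: "m = a * (1 - t)" using mom(2) mean[OF assms] by simp
  have "s\<^sup>2 = t * (1 - t)"
    using mom(4) covariance[OF assms assms] by (simp add: m power2_eq_square algebra_simps)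
  then have "s = sqrt (t * (1 - t))" using ms(1) by (simp add: real_sqrt_unique)
  then show ?thesis using ms m by simp
qed

lemma integrable_\<eta>: "t \<in> {0..1} \<Longrightarrow> integrable M (\<eta> t)"
  by (rule normal_variable_moments(1)[OF measurable_\<eta> _ single_normal]) auto

lemma integrable_products:
  assumes "s \<in> {0..1}" "t \<in> {0..1}"
  shows "integrable M (\<lambda>\<omega>. (\<eta> s \<omega> - a * (1 - s)) * (\<eta> t \<omega> - a * (1 - t)))"
proof -
  have [measurable]: "\<eta> s \<in> borel_measurable M" "\<eta> t \<in> borel_measurable M"
    using assms measurable_\<eta> by auto
  show ?thesis
    using normal_variable_moments(3)[OF measurable_\<eta> _ single_normal] assms
    by (intro integrable_product) auto
qed

text \<open>The increment \<open>\<eta> t - c * \<eta> q\<close> is centred and uncorrelated with the path up to time \<open>q\<close>,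
  so flipping its sign preserves mean and variance of every linear combination, hence the joint law.\<close>

lemma prob_flip_increment:
  fixes T :: "nat \<Rightarrow> real"
  assumes q: "0 \<le> q" "q < 1" and t: "q \<le> t" "t \<le> 1"
    and T: "\<And>i. i < k \<Longrightarrow> T i \<in> {0..q}" and B: "\<And>i. i < k \<Longrightarrow> B i \<in> sets borel"
  defines "Y \<equiv> \<lambda>\<omega>. \<eta> t \<omega> - (1 - t) / (1 - q) * \<eta> q \<omega>"
  shows "prob {\<omega> \<in> space M. (\<forall>i<k. \<eta> (T i) \<omega> \<in> B i) \<and> Y \<omega> < 0} =
         prob {\<omega> \<in> space M. (\<forall>i<k. \<eta> (T i) \<omega> \<in> B i) \<and> Y \<omega> > 0}"
proof (rule prob_symmetric_given)
  \<comment> \<open>For \<open>q > 0\<close> this is the regression coefficient of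
    \<open>\<eta> t\<close> on \<open>\<eta> q\<close>, namely q * (1 - t) / (q * (1 - q)). It makes
    both the mean of \<open>Y\<close> and its covariance with every value up to time
    \<open>q\<close> vanish.\<close>
  define c where "c = (1 - t) / (1 - q)"
  have cq: "c * (1 - q) = 1 - t" using q by (simp add: c_def)
  have t01: "t \<in> {0..1}" and q01: "q \<in> {0..1}" using q t by auto
  have T01: "T i \<in> {0..1}" if "i < k" for i using T[OF that] q by auto
  show mT: "\<eta> (T i) \<in> borel_measurable M" if "i < k" for i using measurable_\<eta> T01[OF that] by simp
  have mt[measurable]: "\<eta> t \<in> borel_measurable M" and mq[measurable]: "\<eta> q \<in> borel_measurable M"
    using measurable_\<eta> t01 q01 by auto
  show mY[measurable]: "Y \<in> borel_measurable M" by (simp add: Y_def)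
  show "B i \<in> sets borel" if "i < k" for i using B[OF that] .
  fix u :: "nat \<Rightarrow> real" and v :: real
  define Z where "Z e = (\<lambda>\<omega>. (\<Sum>i<k. u i * \<eta> (T i) \<omega>) + e * (v * Y \<omega>))" for e :: real
  define \<mu> where "\<mu> = (\<Sum>i<k. u i * (a * (1 - T i)))"
  define U where "U \<omega> = (\<Sum>i<k. u i * (\<eta> (T i) \<omega> - a * (1 - T i)))" for \<omega>
  have [measurable]: "(\<lambda>\<omega>. \<Sum>i<k. u i * \<eta> (T i) \<omega>) \<in> borel_measurable M"
    using mT by (intro borel_measurable_sum borel_measurable_times) auto
  have mZ[measurable]: "Z e \<in> borel_measurable M" for e by (simp add: Z_def)
  have normal: "\<exists>m s. s \<ge> 0 \<and> distr M borel (Z e) = normal_measure m s" for e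
  proof -
    \<comment> \<open>The index \<open>k\<close> carries the time \<open>q\<close> and the index
      \<open>k + 1\<close> the time \<open>t\<close>, so that normality of \<open>Z e\<close> is an
      instance of the Gaussian property.\<close>
    have "Z e = (\<lambda>\<omega>. \<Sum>i<k+2. (if i < k then u i else if i = k then - e * v * c else e * v) *
        \<eta> (if i < k then T i else if i = k then q else t) \<omega>)"
    proof
      fix \<omega>
      have "Y \<omega> = \<eta> t \<omega> - c * \<eta> q \<omega>" by (simp add: Y_def c_def)
      then show "Z e \<omega> = (\<Sum>i<k+2. (if i < k then u i else if i = k then - e * v * c else e * v) *
        \<eta> (if i < k then T i else if i = k then q else t) \<omega>)"
        by (simp add: Z_def right_diff_distrib mult.assoc)
    qed
    then show ?thesis
      using T01 t01 q01
      linear_combination_normal[of "{..<k+2}" "\<lambda>i. if i < k then T i else if i = k then q else t"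
        "\<lambda>i. if i < k then u i else if i = k then - e * v * c else e * v"]
      by (auto simp: image_subset_iff)
  qed
  have intY: "integrable M Y"
    unfolding Y_def using integrable_\<eta> t01 q01 by auto
  have EY: "(LINT \<omega>|M. Y \<omega>) = 0"
  proof -
    have "(LINT \<omega>|M. Y \<omega>) = a * (1 - t) - c * (a * (1 - q))"
      unfolding Y_def c_def[symmetric] using integrable_\<eta> t01 q01 mean by simp
    also have "\<dots> = 0" using cq by (simp add: mult.left_commute)
    finally show ?thesis .
  qed
  have EZ: "(LINT \<omega>|M. Z e \<omega>) = \<mu>" for e
  proof -
    have "(LINT \<omega>|M. Z e \<omega>) = (LINT \<omega>|M. (\<Sum>i<k. u i * \<eta> (T i) \<omega>)) + (LINT \<omega>|M. e * (v * Y \<omega>))"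
      unfolding Z_def using intY integrable_\<eta> T01
      by (intro Bochner_Integration.integral_add integrable_sum integrable_mult_right) auto
    also have "\<dots> = (\<Sum>i<k. (LINT \<omega>|M. u i * \<eta> (T i) \<omega>))"
      using integrable_\<eta> T01 EY by (subst Bochner_Integration.integral_sum) auto
    also have "\<dots> = \<mu>"
      unfolding \<mu>_def using mean T01 by (intro sum.cong) auto
    finally show ?thesis .
  qed
  have Zmu: "Z e \<omega> - \<mu> = U \<omega> + e * (v * Y \<omega>)" for e \<omega>
    by (simp add: Z_def \<mu>_def U_def right_diff_distrib sum_subtractf)
  have uncorr: "integrable M (\<lambda>\<omega>. U \<omega> * Y \<omega>) \<and> (LINT \<omega>|M. U \<omega> * Y \<omega>) = 0"
  proof -
    have Y: "Y \<omega> = (\<eta> t \<omega> - a * (1 - t)) - c * (\<eta> q \<omega> - a * (1 - q))" for \<omega>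
    proof -
      have "c * (\<eta> q \<omega> - a * (1 - q)) = c * \<eta> q \<omega> - a * (c * (1 - q))"
        by (simp add: algebra_simps)
      then show ?thesis by (simp add: Y_def cq c_def[symmetric])
    qed
    have UY: "U \<omega> * Y \<omega> = (\<Sum>i<k. u i * ((\<eta> (T i) \<omega> - a * (1 - T i)) * (\<eta> t \<omega> - a * (1 - t)) -
        c * ((\<eta> (T i) \<omega> - a * (1 - T i)) * (\<eta> q \<omega> - a * (1 - q)))))" for \<omega>
      unfolding U_def Y sum_distrib_right by (intro sum.cong refl) (simp add: algebra_simps)
    have summand: "integrable M (\<lambda>\<omega>. (\<eta> (T i) \<omega> - a * (1 - T i)) * (\<eta> t \<omega> - a * (1 - t)) -
        c * ((\<eta> (T i) \<omega> - a * (1 - T i)) * (\<eta> q \<omega> - a * (1 - q)))) \<and>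
        (LINT \<omega>|M. (\<eta> (T i) \<omega> - a * (1 - T i)) * (\<eta> t \<omega> - a * (1 - t)) -
        c * ((\<eta> (T i) \<omega> - a * (1 - T i)) * (\<eta> q \<omega> - a * (1 - q)))) = 0" if "i < k" for i
    proof -
      note i1 = integrable_products[OF T01[OF that] t01] and i2 = integrable_products[OF T01[OF that] q01]
      have le: "T i \<le> q" using T[OF that] by simp
      have "(T i - T i * t) - c * (T i - T i * q) = T i * (1 - t) - T i * (c * (1 - q))"
        by (simp add: algebra_simps)
      also have "\<dots> = 0" by (simp add: cq)
      finally have z: "(T i - T i * t) - c * (T i - T i * q) = 0" .
      show ?thesis
        using i1 i2 covariance[OF T01[OF that] t01] covariance[OF T01[OF that] q01] le t z
        by (auto simp: min_absorb1)
    qed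
    show ?thesis
      unfolding UY using summand by (auto simp: Bochner_Integration.integral_sum)
  qed
  have sqint: "integrable M (\<lambda>\<omega>. (Z e \<omega> - \<mu>)\<^sup>2)" for e
  proof -
    obtain m s where ms: "s \<ge> 0" "distr M borel (Z e) = normal_measure m s" using normal[of e] by blast
    show ?thesis
      using normal_variable_moments(2,3)[OF mZ ms] EZ[of e] by simp
  qed
  \<comment> \<open>The squares for the two signs differ by four times a mixed term, whose
    expectation is the vanishing covariance.\<close>
  have "(LINT \<omega>|M. (Z 1 \<omega> - \<mu>)\<^sup>2) - (LINT \<omega>|M. (Z (-1) \<omega> - \<mu>)\<^sup>2) =
      (LINT \<omega>|M. (Z 1 \<omega> - \<mu>)\<^sup>2 - (Z (-1) \<omega> - \<mu>)\<^sup>2)"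
    using sqint by simp
  also have "\<dots> = (LINT \<omega>|M. (4 * v) * (U \<omega> * Y \<omega>))"
    unfolding Zmu by (intro Bochner_Integration.integral_cong refl) (simp add: power2_eq_square algebra_simps)
  also have "\<dots> = 0" using uncorr by simp
  finally have var: "(LINT \<omega>|M. (Z 1 \<omega> - \<mu>)\<^sup>2) = (LINT \<omega>|M. (Z (-1) \<omega> - \<mu>)\<^sup>2)" by simp
  have "distr M borel (Z 1) = distr M borel (Z (-1))"
    using normal EZ var by (intro normal_variables_eq_distr[where \<mu> = \<mu>]) auto
  then have "(CLINT x|distr M borel (Z 1). iexp x) = (CLINT x|distr M borel (Z (-1)). iexp x)"
    by simp
  then have "(CLINT \<omega>|M. iexp (Z 1 \<omega>)) = (CLINT \<omega>|M. iexp (Z (-1) \<omega>))"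
    by (simp add: integral_distr)
  then show "(CLINT x|M. iexp ((\<Sum>i<k. u i * \<eta> (T i) x) + v * Y x)) =
      (CLINT x|M. iexp ((\<Sum>i<k. u i * \<eta> (T i) x) - v * Y x))"
    by (simp add: Z_def)
qed

end

section \<open>The standard normal distribution function\<close>

abbreviation std_normal_cdf :: "real \<Rightarrow> real" where
  "std_normal_cdf \<equiv> cdf std_normal_distribution"

lemma std_normal_cdf_has_derivative:
  "(std_normal_cdf has_real_derivative std_normal_density x) (at x)"
proof -
  interpret real_distribution std_normal_distribution by (rule real_dist_normal_dist)
  have cont: "continuous_on S std_normal_density" for S
    unfolding std_normal_density_def by (intro continuous_intros) auto
  \<comment> \<open>A base point to the left of \<open>x\<close>: the distribution function differs
    from an integral over a compact interval by a constant, and the fundamental theorem of calculus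
    applies.\<close>
  define c where "c = x - 1"
  have eq: "std_normal_cdf y = std_normal_cdf c + integral {c..y} std_normal_density" if "c \<le> y" for y
  proof -
    have "set_integrable lborel {c..y} std_normal_density"
      using integrable_mult_indicator[OF _ integrable_normal_density[of 1 0], of "{c..y}"]
      unfolding set_integrable_def by simp
    then have "integral {c..y} std_normal_density = (LINT x:{c..y}|lborel. std_normal_density x)"
      by (rule set_borel_integral_eq_integral(2)[symmetric])
    also have "\<dots> = (LINT x|std_normal_distribution. indicator {c..y} x)"
      unfolding set_lebesgue_integral_def by (subst integral_density) (auto simp: mult.commute)
    also have "\<dots> = measure std_normal_distribution {c..y}"
      by simp
    also have "\<dots> = measure std_normal_distribution {c<..y}"
    proof (rule measure_eq_AE)
      have "AE z in lborel. z \<noteq> c" by (rule AE_lborel_singleton)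
      then show "AE z in std_normal_distribution. (z \<in> {c..y}) = (z \<in> {c<..y})"
        by (subst AE_density) (auto elim!: eventually_mono)
    qed auto
    also have "\<dots> = std_normal_cdf y - std_normal_cdf c"
    proof (cases "c = y")
      case False
      then show ?thesis using that by (subst cdf_diff_eq) auto
    qed simp
    finally show ?thesis by simp
  qed
  have "((\<lambda>y. integral {c..y} std_normal_density) has_real_derivative std_normal_density x) (at x within {c..x+1})"
    by (rule integral_has_real_derivative[OF cont]) (auto simp: c_def)
  then have "((\<lambda>y. integral {c..y} std_normal_density) has_real_derivative std_normal_density x) (at x)"
    by (subst (asm) at_within_Icc_at) (auto simp: c_def)
  then have "((\<lambda>y. std_normal_cdf c + integral {c..y} std_normal_density) has_real_derivative std_normal_density x) (at x)"
    by (auto intro!: derivative_eq_intros)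
  then show ?thesis
  proof (rule has_field_derivative_transform_within[where d = 1])
    fix y assume "dist y x < 1"
    then have "c \<le> y" by (auto simp: c_def dist_real_def)
    then show "std_normal_cdf c + integral {c..y} std_normal_density = std_normal_cdf y"
      by (rule eq[symmetric])
  qed auto
qed

lemma continuous_std_normal_cdf: "isCont std_normal_cdf x"
  using std_normal_cdf_has_derivative by (rule DERIV_isCont)

lemma std_normal_cdf_0: "std_normal_cdf 0 = 1 / 2"
proof -
  interpret real_distribution std_normal_distribution by (rule real_dist_normal_dist)
  have "measure std_normal_distribution {..0} = measure std_normal_distribution {0..}"
  proof -
    have "emeasure std_normal_distribution {..0} = (\<integral>\<^sup>+x. ennreal (std_normal_density x) * indicator {..0} x \<partial>lborel)"
      by (simp add: emeasure_density)
    also have "\<dots> = (\<integral>\<^sup>+x. ennreal (std_normal_density (- x)) * indicator {..0} (- x) \<partial>lborel)"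
      by (subst nn_integral_real_affine[of _ "-1" 0]) auto
    also have "\<dots> = (\<integral>\<^sup>+x. ennreal (std_normal_density x) * indicator {0..} x \<partial>lborel)"
      by (intro nn_integral_cong) (auto simp: std_normal_density_def indicator_def)
    also have "\<dots> = emeasure std_normal_distribution {0..}"
      by (simp add: emeasure_density)
    finally show ?thesis by (simp add: measure_def)
  qed
  also have "measure std_normal_distribution {0..} = measure std_normal_distribution {0<..}"
  proof (rule measure_eq_AE)
    have "AE z in lborel. z \<noteq> (0::real)" by (rule AE_lborel_singleton)
    then show "AE z in std_normal_distribution. (z \<in> {0..}) = (z \<in> {0<..})"
      by (subst AE_density) (auto elim!: eventually_mono)
  qed auto
  also have "\<dots> = 1 - measure std_normal_distribution {..0}"
    using prob_compl[of "{..0}"] by (simp add: Compl_eq_Diff_UNIV[symmetric])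
  finally show ?thesis by (simp add: cdf_def)
qed

section \<open>The reflection principle on a grid\<close>

context bridge_to_zero
begin

text \<open>The grid consists of the times \<open>t * i / n\<close>. One Borel set is given per grid
  time because this is the shape of event that \<open>prob_flip_increment\<close> handles.\<close>

definition first_hit :: "real \<Rightarrow> nat \<Rightarrow> real \<Rightarrow> nat \<Rightarrow> 'a set" where
  "first_hit t n \<delta> k = {\<omega> \<in> space M. \<forall>i<Suc k. \<eta> (t * real i / n) \<omega> \<in> (if i < k then {\<delta><..} else {..\<delta>})}"

text \<open>The part of \<open>\<eta> t\<close> that is uncorrelated with the path up to the grid
  time \<open>t * k / n\<close>, that is, the increment flipped in
  \<open>prob_flip_increment\<close>.\<close>

definition residual :: "real \<Rightarrow> nat \<Rightarrow> nat \<Rightarrow> 'a \<Rightarrow> real" where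
  "residual t n k \<omega> = \<eta> t \<omega> - (1 - t) / (1 - t * real k / n) * \<eta> (t * real k / n) \<omega>"

definition below_on_grid :: "real \<Rightarrow> nat \<Rightarrow> real \<Rightarrow> 'a set" where
  "below_on_grid t n \<delta> = {\<omega> \<in> space M. \<exists>i\<le>n. \<eta> (t * real i / n) \<omega> \<le> \<delta>}"

lemma grid_in:
  assumes "0 \<le> t" "t \<le> 1" "i \<le> n"
  shows "t * real i / real n \<in> {0..t}" "t * real i / real n \<in> {0..1}"
proof -
  have "real i / real n \<le> 1" using assms by (cases "n = 0") auto
  then have "t * (real i / real n) \<le> t" using mult_left_mono[of "real i / real n" 1 t] assms by simp
  then show "t * real i / real n \<in> {0..t}" "t * real i / real n \<in> {0..1}" using assms by auto
qed

lemma event_in_sets: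
  assumes "s \<in> {0..1}" "A \<in> sets borel"
  shows "{\<omega> \<in> space M. \<eta> s \<omega> \<in> A} \<in> sets M"
  using measurable_sets[OF measurable_\<eta>[OF assms(1)] assms(2)]
  by (simp add: vimage_def Int_def conj_commute)

lemma measurable_first_hit:
  assumes "0 \<le> t" "t \<le> 1" "k \<le> n"
  shows "first_hit t n \<delta> k \<in> sets M"
proof -
  have "{\<omega> \<in> space M. \<forall>i\<in>{..<Suc k}. \<eta> (t * real i / n) \<omega> \<in> (if i < k then {\<delta><..} else {..\<delta>})} \<in> sets M"
  proof (rule sets.sets_Collect_finite_All)
    fix i assume "i \<in> {..<Suc k}"
    then show "{\<omega> \<in> space M. \<eta> (t * real i / n) \<omega> \<in> (if i < k then {\<delta><..} else {..\<delta>})} \<in> sets M"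
      using assms grid_in(2)[of t i n] by (intro event_in_sets) auto
  qed simp
  then show ?thesis by (simp only: first_hit_def Ball_def lessThan_iff)
qed

lemma measurable_residual:
  assumes "0 \<le> t" "t \<le> 1" "k \<le> n"
  shows "residual t n k \<in> borel_measurable M"
  unfolding residual_def[abs_def] using assms grid_in(2)[of t k n]
  by (intro borel_measurable_diff borel_measurable_times measurable_\<eta> borel_measurable_const) auto

lemma below_on_grid_eq: "below_on_grid t n \<delta> = (\<Union>k\<le>n. first_hit t n \<delta> k)"
proof (intro equalityI subsetI)
  fix \<omega> assume \<omega>: "\<omega> \<in> below_on_grid t n \<delta>"
  then obtain i where i: "i \<le> n" "\<eta> (t * real i / n) \<omega> \<le> \<delta>" by (auto simp: below_on_grid_def)
  define k where "k = (LEAST i. \<eta> (t * real i / n) \<omega> \<le> \<delta>)"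
  have k: "\<eta> (t * real k / n) \<omega> \<le> \<delta>" "k \<le> i"
    unfolding k_def using i by (auto intro: LeastI Least_le)
  have "\<delta> < \<eta> (t * real j / n) \<omega>" if "j < k" for j
    using not_less_Least[of j "\<lambda>i. \<eta> (t * real i / n) \<omega> \<le> \<delta>"] that by (simp add: k_def not_le)
  then have "\<omega> \<in> first_hit t n \<delta> k"
    using \<omega> k by (auto simp: first_hit_def below_on_grid_def less_Suc_eq)
  then show "\<omega> \<in> (\<Union>k\<le>n. first_hit t n \<delta> k)" using k i by auto
next
  fix \<omega> assume "\<omega> \<in> (\<Union>k\<le>n. first_hit t n \<delta> k)"
  then obtain k where k: "k \<le> n" "\<omega> \<in> first_hit t n \<delta> k" by auto
  then have "\<omega> \<in> space M" "\<eta> (t * real k / n) \<omega> \<le> \<delta>"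
    by (auto simp: first_hit_def dest: spec[of _ k])
  then show "\<omega> \<in> below_on_grid t n \<delta>" using k by (auto simp: below_on_grid_def)
qed

lemma measurable_below_on_grid:
  assumes "0 \<le> t" "t \<le> 1"
  shows "below_on_grid t n \<delta> \<in> sets M"
  unfolding below_on_grid_eq using assms
  by (intro sets.finite_UN) (auto intro!: measurable_first_hit)

lemma disjoint_first_hit: "disjoint_family_on (first_hit t n \<delta>) A"
proof -
  have "first_hit t n \<delta> j \<inter> first_hit t n \<delta> k = {}" if "j < k" for j k
  proof (rule ccontr)
    assume "first_hit t n \<delta> j \<inter> first_hit t n \<delta> k \<noteq> {}"
    then obtain \<omega> where "\<omega> \<in> first_hit t n \<delta> j" "\<omega> \<in> first_hit t n \<delta> k" by auto
    then have "\<eta> (t * real j / n) \<omega> \<le> \<delta>" "\<delta> < \<eta> (t * real j / n) \<omega>"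
      using that by (auto simp: first_hit_def dest!: spec[of _ j])
    then show False by simp
  qed
  then show ?thesis
    unfolding disjoint_family_on_def by (metis Int_commute linorder_neqE_nat)
qed

text \<open>Given the first grid hit, the residual is symmetric. It may vanish with positive
  probability, and for \<open>k = n > 0\<close> it is identically 0; so the strict inequality serves
  for the lower bound and the weak one for the upper bound.\<close>

lemma first_hit_half:
  assumes t: "0 \<le> t" "t < 1" and k: "k \<le> n"
  shows "2 * prob {\<omega> \<in> first_hit t n \<delta> k. residual t n k \<omega> < 0} \<le> prob (first_hit t n \<delta> k)"
    "prob (first_hit t n \<delta> k) \<le> 2 * prob {\<omega> \<in> first_hit t n \<delta> k. residual t n k \<omega> \<le> 0}"
proof -
  let ?F = "first_hit t n \<delta> k"
  have [measurable]: "?F \<in> sets M" "residual t n k \<in> borel_measurable M"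
    using measurable_first_hit measurable_residual t k by auto
  have sub: "?F \<subseteq> space M" by (auto simp: first_hit_def)
  have m: "{\<omega> \<in> ?F. residual t n k \<omega> < 0} \<in> sets M" "{\<omega> \<in> ?F. residual t n k \<omega> > 0} \<in> sets M"
    "{\<omega> \<in> ?F. residual t n k \<omega> = 0} \<in> sets M"
    by measurable
  have "prob {\<omega> \<in> ?F. residual t n k \<omega> < 0} = prob {\<omega> \<in> ?F. residual t n k \<omega> > 0}"
  proof -
    have q: "t * real k / n \<in> {0..t}" using grid_in(1) t k by simp
    have eq: "{\<omega> \<in> ?F. P (residual t n k \<omega>)} = {\<omega> \<in> space M.
        (\<forall>i<Suc k. \<eta> (t * real i / n) \<omega> \<in> (if i < k then {\<delta><..} else {..\<delta>})) \<and> P (residual t n k \<omega>)}" for P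
      by (auto simp: first_hit_def)
    show ?thesis
      unfolding eq[of "\<lambda>x. x < 0"] eq[of "\<lambda>x. 0 < x"] unfolding residual_def
    proof (rule prob_flip_increment)
      show "0 \<le> t * real k / n" "t * real k / n < 1" "t * real k / n \<le> t" "t \<le> 1" using q t by auto
      fix i assume "i < Suc k"
      then show "t * real i / n \<in> {0..t * real k / n}"
        using t by (auto intro!: divide_right_mono mult_left_mono)
    qed auto
  qed
  moreover have "prob ?F = prob {\<omega> \<in> ?F. residual t n k \<omega> < 0} + prob {\<omega> \<in> ?F. residual t n k \<omega> > 0}
      + prob {\<omega> \<in> ?F. residual t n k \<omega> = 0}"
  proof -
    have "prob ?F = prob (({\<omega> \<in> ?F. residual t n k \<omega> < 0} \<union> {\<omega> \<in> ?F. residual t n k \<omega> > 0}) \<union> {\<omega> \<in> ?F. residual t n k \<omega> = 0})"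
      by (rule arg_cong[where f = prob]) auto
    then show ?thesis
      using m by (simp add: finite_measure_Union disjoint_iff)
  qed
  moreover have "prob {\<omega> \<in> ?F. residual t n k \<omega> \<le> 0} = prob {\<omega> \<in> ?F. residual t n k \<omega> < 0} + prob {\<omega> \<in> ?F. residual t n k \<omega> = 0}"
  proof -
    have "prob {\<omega> \<in> ?F. residual t n k \<omega> \<le> 0} = prob ({\<omega> \<in> ?F. residual t n k \<omega> < 0} \<union> {\<omega> \<in> ?F. residual t n k \<omega> = 0})"
      by (rule arg_cong[where f = prob]) auto
    then show ?thesis
      using m by (simp add: finite_measure_Union disjoint_iff)
  qed
  ultimately show "2 * prob {\<omega> \<in> ?F. residual t n k \<omega> < 0} \<le> prob ?F"
    "prob ?F \<le> 2 * prob {\<omega> \<in> ?F. residual t n k \<omega> \<le> 0}"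
    by (simp_all add: measure_nonneg)
qed

lemma prob_below_on_grid:
  assumes "0 \<le> t" "t \<le> 1"
  shows "prob (below_on_grid t n \<delta>) = (\<Sum>k\<le>n. prob (first_hit t n \<delta> k))"
  unfolding below_on_grid_eq using assms
  by (intro finite_measure_finite_Union) (auto intro!: measurable_first_hit disjoint_first_hit)

lemma ratio_in:
  fixes t q :: real
  assumes "q \<le> t" "t < 1"
  shows "0 \<le> (1 - t) / (1 - q)" "(1 - t) / (1 - q) \<le> 1"
  using assms by auto

text \<open>Upper half of the reflection. At the first hit the path is at most
  \<open>\<delta>\<close>, and the regression coefficient lies between 0 and 1, so a nonpositive
  residual forces \<open>\<eta> t\<close> to be at most \<open>\<delta>\<close> as well. At least
  half of each first-hit event has such a residual.\<close>

lemma prob_below_on_grid_le: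
  assumes t: "0 \<le> t" "t < 1" and \<delta>: "\<delta> \<ge> 0"
  shows "prob (below_on_grid t n \<delta>) \<le> 2 * prob {\<omega> \<in> space M. \<eta> t \<omega> \<le> \<delta>}"
proof -
  have [measurable]: "\<eta> t \<in> borel_measurable M" using t by (intro measurable_\<eta>) auto
  have "prob (below_on_grid t n \<delta>) = (\<Sum>k\<le>n. prob (first_hit t n \<delta> k))"
    using t by (intro prob_below_on_grid) auto
  also have "\<dots> \<le> (\<Sum>k\<le>n. 2 * prob {\<omega> \<in> first_hit t n \<delta> k. \<eta> t \<omega> \<le> \<delta>})"
  proof (intro sum_mono)
    fix k assume k: "k \<in> {..n}"
    have F[measurable]: "first_hit t n \<delta> k \<in> sets M" using measurable_first_hit t k by auto
    have "prob {\<omega> \<in> first_hit t n \<delta> k. residual t n k \<omega> \<le> 0} \<le> prob {\<omega> \<in> first_hit t n \<delta> k. \<eta> t \<omega> \<le> \<delta>}"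
    proof (rule finite_measure_mono)
      show "{\<omega> \<in> first_hit t n \<delta> k. \<eta> t \<omega> \<le> \<delta>} \<in> events" by measurable
      show "{\<omega> \<in> first_hit t n \<delta> k. residual t n k \<omega> \<le> 0} \<subseteq> {\<omega> \<in> first_hit t n \<delta> k. \<eta> t \<omega> \<le> \<delta>}"
      proof safe
        fix \<omega> assume \<omega>: "\<omega> \<in> first_hit t n \<delta> k" "residual t n k \<omega> \<le> 0"
        let ?q = "t * real k / n" and ?c = "(1 - t) / (1 - t * real k / n)"
        have "?q \<le> t" using grid_in(1)[of t k n] t k by auto
        note c = ratio_in[OF this t(2)]
        have "\<eta> ?q \<omega> \<le> \<delta>" using \<omega>(1) by (auto simp: first_hit_def dest!: spec[of _ k])
        then have "?c * \<eta> ?q \<omega> \<le> ?c * \<delta>" using c by (intro mult_left_mono) auto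
        also have "\<dots> \<le> 1 * \<delta>" using c \<delta> by (intro mult_right_mono) auto
        finally show "\<eta> t \<omega> \<le> \<delta>" using \<omega>(2) by (simp add: residual_def)
      qed
    qed
    then show "prob (first_hit t n \<delta> k) \<le> 2 * prob {\<omega> \<in> first_hit t n \<delta> k. \<eta> t \<omega> \<le> \<delta>}"
      using first_hit_half(2)[OF t, of k n \<delta>] k by simp
  qed
  also have "\<dots> = 2 * (\<Sum>k\<le>n. prob {\<omega> \<in> first_hit t n \<delta> k. \<eta> t \<omega> \<le> \<delta>})"
    by (simp add: sum_distrib_left)
  also have "(\<Sum>k\<le>n. prob {\<omega> \<in> first_hit t n \<delta> k. \<eta> t \<omega> \<le> \<delta>}) = prob (\<Union>k\<le>n. {\<omega> \<in> first_hit t n \<delta> k. \<eta> t \<omega> \<le> \<delta>})"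
  proof (rule finite_measure_finite_Union[symmetric])
    show "(\<lambda>k. {\<omega> \<in> first_hit t n \<delta> k. \<eta> t \<omega> \<le> \<delta>}) ` {..n} \<subseteq> events"
    proof safe
      fix k assume "k \<le> n"
      then have [measurable]: "first_hit t n \<delta> k \<in> sets M" using measurable_first_hit t by auto
      show "{\<omega> \<in> first_hit t n \<delta> k. \<eta> t \<omega> \<le> \<delta>} \<in> events" by measurable
    qed
    show "disjoint_family_on (\<lambda>k. {\<omega> \<in> first_hit t n \<delta> k. \<eta> t \<omega> \<le> \<delta>}) {..n}"
      using disjoint_first_hit[of t n \<delta> "{..n}"] unfolding disjoint_family_on_def by blast
  qed simp
  also have "\<dots> \<le> prob {\<omega> \<in> space M. \<eta> t \<omega> \<le> \<delta>}"
    by (intro finite_measure_mono) (auto simp: first_hit_def)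
  finally show ?thesis by simp
qed

definition oscillation :: "real \<Rightarrow> nat \<Rightarrow> real \<Rightarrow> 'a set" where
  "oscillation t n \<epsilon> = {\<omega> \<in> space M. \<exists>k<n. \<bar>\<eta> (t * real (Suc k) / n) \<omega> - \<eta> (t * real k / n) \<omega>\<bar> > \<epsilon>}"

lemma measurable_oscillation:
  assumes "0 \<le> t" "t \<le> 1"
  shows "oscillation t n \<epsilon> \<in> sets M"
proof -
  have "{\<omega> \<in> space M. \<exists>k\<in>{..<n}. \<bar>\<eta> (t * real (Suc k) / n) \<omega> - \<eta> (t * real k / n) \<omega>\<bar> > \<epsilon>} \<in> sets M"
  proof (rule sets.sets_Collect_finite_Ex)
    fix k assume "k \<in> {..<n}"
    then have "(\<lambda>\<omega>. \<eta> (t * real (Suc k) / n) \<omega> - \<eta> (t * real k / n) \<omega>) \<in> borel_measurable M"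
      using assms grid_in(2)[of t k n] grid_in(2)[of t "Suc k" n]
      by (intro borel_measurable_diff measurable_\<eta>) auto
    then show "{\<omega> \<in> space M. \<bar>\<eta> (t * real (Suc k) / n) \<omega> - \<eta> (t * real k / n) \<omega>\<bar> > \<epsilon>} \<in> sets M"
      by measurable
  qed simp
  then show ?thesis by (simp only: oscillation_def Bex_def lessThan_iff)
qed

text \<open>Lower half of the reflection. A path on a grid may jump over 0: if it ends below
  \<open>- \<epsilon>\<close> although the residual is not negative, it was below
  \<open>- \<epsilon>\<close> already at the first hit, coming from a positive value one grid step
  earlier. The oscillation event collects these paths.\<close>

lemma prob_below_on_grid_ge:
  assumes t: "0 \<le> t" "t < 1" and n: "n > 0" and \<epsilon>: "\<epsilon> \<ge> 0"
  shows "prob (below_on_grid t n 0) \<ge> 2 * (prob {\<omega> \<in> space M. \<eta> t \<omega> < - \<epsilon>} - prob (oscillation t n \<epsilon>))"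
proof -
  let ?G = "\<lambda>k. {\<omega> \<in> first_hit t n 0 k. residual t n k \<omega> < 0}"
  have [measurable]: "\<eta> t \<in> borel_measurable M" using t by (intro measurable_\<eta>) auto
  have mG: "?G k \<in> sets M" if "k \<le> n" for k
  proof -
    have [measurable]: "first_hit t n 0 k \<in> sets M" "residual t n k \<in> borel_measurable M"
      using measurable_first_hit measurable_residual t that by auto
    show ?thesis by measurable
  qed
  have mO: "oscillation t n \<epsilon> \<in> sets M" using t by (intro measurable_oscillation) auto
  have "{\<omega> \<in> space M. \<eta> t \<omega> < - \<epsilon>} \<subseteq> (\<Union>k\<le>n. ?G k) \<union> oscillation t n \<epsilon>"
  proof
    fix \<omega> assume \<omega>: "\<omega> \<in> {\<omega> \<in> space M. \<eta> t \<omega> < - \<epsilon>}"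
    \<comment> \<open>The last grid time is \<open>t\<close> itself, where the path is
      negative.\<close>
    have "\<omega> \<in> below_on_grid t n 0"
      using \<omega> n \<epsilon> by (auto simp: below_on_grid_def intro!: exI[of _ n])
    then obtain k where k: "k \<le> n" "\<omega> \<in> first_hit t n 0 k" unfolding below_on_grid_eq by auto
    show "\<omega> \<in> (\<Union>k\<le>n. ?G k) \<union> oscillation t n \<epsilon>"
    proof (cases "residual t n k \<omega> < 0")
      case False
      let ?q = "t * real k / n" and ?c = "(1 - t) / (1 - t * real k / n)"
      have "?q \<le> t" using grid_in(1)[of t k n] t k by auto
      note c = ratio_in[OF this t(2)]
      have q: "\<eta> ?q \<omega> \<le> 0" using k(2) by (auto simp: first_hit_def dest!: spec[of _ k])
      have "1 * \<eta> ?q \<omega> \<le> ?c * \<eta> ?q \<omega>" using c q by (intro mult_right_mono_neg) auto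
      also have "\<dots> \<le> \<eta> t \<omega>" using False by (simp add: residual_def)
      finally have less: "\<eta> ?q \<omega> < - \<epsilon>" using \<omega> by auto
      \<comment> \<open>The path starts at \<open>a > 0\<close>, so the first hit has a preceding
        grid point.\<close>
      have "k \<noteq> 0"
      proof
        assume "k = 0"
        then have "\<eta> 0 \<omega> \<le> 0" using q by simp
        then show False using path(2) a_pos \<omega> by auto
      qed
      then obtain j where j: "k = Suc j" using not0_implies_Suc by blast
      have "\<eta> (t * real j / n) \<omega> > 0" using k(2) by (auto simp: first_hit_def j dest!: spec[of _ j])
      then have "\<bar>\<eta> (t * real (Suc j) / n) \<omega> - \<eta> (t * real j / n) \<omega>\<bar> > \<epsilon>"
        using less unfolding j by linarith
      moreover have "j < n" using k(1) j by simp
      ultimately show ?thesis using \<omega> by (auto simp: oscillation_def)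
    qed (use k in auto)
  qed
  then have "prob {\<omega> \<in> space M. \<eta> t \<omega> < - \<epsilon>} \<le> prob ((\<Union>k\<le>n. ?G k) \<union> oscillation t n \<epsilon>)"
    using mG mO by (intro finite_measure_mono) auto
  also have "\<dots> \<le> prob (\<Union>k\<le>n. ?G k) + prob (oscillation t n \<epsilon>)"
    using mG mO by (intro measure_Un_le) auto
  also have "prob (\<Union>k\<le>n. ?G k) \<le> (\<Sum>k\<le>n. prob (?G k))"
    using mG by (intro finite_measure_subadditive_finite) auto
  also have "\<dots> \<le> (\<Sum>k\<le>n. prob (first_hit t n 0 k) / 2)"
  proof (intro sum_mono)
    fix k assume "k \<in> {..n}"
    then have "k \<le> n" by simp
    from first_hit_half(1)[OF t this, of 0]
    show "prob (?G k) \<le> prob (first_hit t n 0 k) / 2" by linarith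
  qed
  also have "\<dots> = prob (below_on_grid t n 0) / 2"
    using t by (subst prob_below_on_grid) (auto simp: sum_divide_distrib)
  finally show ?thesis by simp
qed

text \<open>By uniform continuity each path belongs to only finitely many of these events; dominated
  convergence turns this into a statement about probabilities.\<close>

lemma oscillation_tendsto_0:
  assumes t: "0 \<le> t" "t \<le> 1" and \<epsilon>: "\<epsilon> > 0"
  shows "(\<lambda>n. prob (oscillation t n \<epsilon>)) \<longlonglongrightarrow> 0"
proof -
  have "(\<lambda>n. LINT \<omega>|M. indicator (oscillation t n \<epsilon>) \<omega>) \<longlonglongrightarrow> (LINT \<omega>|M. 0 :: real)"
  proof (rule integral_dominated_convergence[where w = "\<lambda>_. 1"])
    show "(\<lambda>\<omega>. indicator (oscillation t n \<epsilon>) \<omega> :: real) \<in> borel_measurable M" for n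
      using measurable_oscillation[OF t] by simp
    show "AE \<omega> in M. (\<lambda>n. indicator (oscillation t n \<epsilon>) \<omega> :: real) \<longlonglongrightarrow> 0"
    proof (rule AE_I2)
      fix \<omega> assume \<omega>: "\<omega> \<in> space M"
      have "uniformly_continuous_on {0..1} (\<lambda>t. \<eta> t \<omega>)"
        using path(1)[OF \<omega>] by (intro compact_uniformly_continuous) auto
      then obtain d where d: "d > 0" "\<And>x y. x \<in> {0..1} \<Longrightarrow> y \<in> {0..1} \<Longrightarrow> \<bar>y - x\<bar> < d \<Longrightarrow> \<bar>\<eta> y \<omega> - \<eta> x \<omega>\<bar> < \<epsilon>"
        using \<epsilon> unfolding uniformly_continuous_on_def dist_real_def by metis
      have "eventually (\<lambda>n. t / real n < d) sequentially"
        by (rule order_tendstoD(2)[OF lim_const_over_n d(1)])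
      then have "eventually (\<lambda>n. indicator (oscillation t n \<epsilon>) \<omega> = (0::real)) sequentially"
      proof (rule eventually_mono)
        fix n assume n: "t / real n < d"
        have "\<bar>\<eta> (t * real (Suc k) / n) \<omega> - \<eta> (t * real k / n) \<omega>\<bar> < \<epsilon>" if "k < n" for k
        proof (rule d(2))
          show "t * real k / n \<in> {0..1}" "t * real (Suc k) / n \<in> {0..1}"
            using grid_in(2)[OF t, of k n] grid_in(2)[OF t, of "Suc k" n] that by auto
          have "t * real (Suc k) / n - t * real k / n = t / n"
            by (simp add: field_simps flip: diff_divide_distrib)
          then show "\<bar>t * real (Suc k) / n - t * real k / n\<bar> < d" using n t by simp
        qed
        then have "\<omega> \<notin> oscillation t n \<epsilon>" by (force simp: oscillation_def not_less)
        then show "indicator (oscillation t n \<epsilon>) \<omega> = (0::real)" by simp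
      qed
      then show "(\<lambda>n. indicator (oscillation t n \<epsilon>) \<omega> :: real) \<longlonglongrightarrow> 0"
        by (rule tendsto_eventually)
    qed
  qed auto
  then show ?thesis using measurable_oscillation[OF t] by simp
qed

lemma cdf_single:
  assumes "0 < t" "t < 1"
  shows "prob {\<omega> \<in> space M. \<eta> t \<omega> \<le> y} = std_normal_cdf ((y - a * (1 - t)) / sqrt (t * (1 - t)))"
proof -
  define m where "m = a * (1 - t)"
  define s where "s = sqrt (t * (1 - t))"
  have s: "s > 0" using assms by (simp add: s_def)
  have t01: "t \<in> {0..1}" using assms by auto
  have [measurable]: "\<eta> t \<in> borel_measurable M" using measurable_\<eta>[OF t01] .
  have "distr M borel (\<eta> t) = density lborel (\<lambda>x. ennreal (normal_density m s x))"
    using single_normal[OF t01] s by (simp add: normal_measure_def flip: m_def s_def)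
  then have "distributed M lborel (\<eta> t) (\<lambda>x. ennreal (normal_density m s x))"
    by (simp add: distributed_def cong: distr_cong)
  then have D: "distributed M lborel (\<lambda>\<omega>. (\<eta> t \<omega> - m) / s) std_normal_density"
    using normal_standard_normal_convert[OF s] by simp
  have "prob {\<omega> \<in> space M. \<eta> t \<omega> \<le> y} = measure (distr M borel (\<lambda>\<omega>. (\<eta> t \<omega> - m) / s)) {..(y - m) / s}"
    using s by (subst measure_distr) (auto intro!: arg_cong[where f = prob] simp: divide_right_mono divide_le_cancel)
  also have "distr M borel (\<lambda>\<omega>. (\<eta> t \<omega> - m) / s) = std_normal_distribution"
    using D by (simp add: distributed_def cong: distr_cong)
  finally show ?thesis by (simp add: cdf_def m_def s_def)
qed

section \<open>The hitting time as a limit of grid events\<close>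

abbreviation "\<tau> \<equiv> hitting_time_zero \<eta>"

lemma \<tau>_path:
  assumes "\<omega> \<in> space M"
  shows "\<tau> \<omega> \<in> {0<..1}" "\<eta> (\<tau> \<omega>) \<omega> = 0" "\<And>s. s \<in> {0..1} \<Longrightarrow> \<eta> s \<omega> \<le> 0 \<Longrightarrow> \<tau> \<omega> \<le> s"
  using hitting_path[of "\<lambda>t. \<eta> t \<omega>"] path[OF assms] a_pos unfolding hitting_time_zero_def by auto

text \<open>Dyadic grids are nested, which makes the events increase and their probabilities
  converge to that of the union.\<close>

lemma below_on_grid_mono: "below_on_grid t (2 ^ n) \<delta> \<subseteq> below_on_grid t (2 ^ Suc n) \<delta>"
proof
  fix \<omega> assume "\<omega> \<in> below_on_grid t (2 ^ n) \<delta>"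
  then obtain i where i: "i \<le> 2 ^ n" "\<eta> (t * real i / 2 ^ n) \<omega> \<le> \<delta>" "\<omega> \<in> space M"
    by (auto simp: below_on_grid_def)
  then have "2 * i \<le> 2 ^ Suc n" "\<eta> (t * real (2 * i) / 2 ^ Suc n) \<omega> \<le> \<delta>" by auto
  then show "\<omega> \<in> below_on_grid t (2 ^ Suc n) \<delta>"
    using i(3) by (auto simp: below_on_grid_def intro!: exI[of _ "2 * i"])
qed

text \<open>The hitting time need not be a grid time; the tolerance \<open>\<delta>\<close> pays for
  rounding it to a sufficiently fine grid.\<close>

lemma hit_imp_below_on_grid:
  assumes \<omega>: "\<omega> \<in> space M" and t: "0 < t" "t \<le> 1" and hit: "\<tau> \<omega> \<le> t" and \<delta>: "\<delta> > 0"
  shows "\<exists>n. \<omega> \<in> below_on_grid t (2 ^ n) \<delta>"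
proof -
  have tau01: "\<tau> \<omega> \<in> {0..1}" using \<tau>_path(1)[OF \<omega>] by auto
  have "\<exists>d>0. \<forall>s\<in>{0..1}. \<bar>s - \<tau> \<omega>\<bar> < d \<longrightarrow> \<bar>\<eta> s \<omega> - \<eta> (\<tau> \<omega>) \<omega>\<bar> < \<delta>"
    using path(1)[OF \<omega>] tau01 \<delta> unfolding continuous_on_iff dist_real_def by blast
  then obtain d where d: "d > 0" "\<And>s. s \<in> {0..1} \<Longrightarrow> \<bar>s - \<tau> \<omega>\<bar> < d \<Longrightarrow> \<eta> s \<omega> < \<delta>"
    using \<tau>_path(2)[OF \<omega>] by force
  have "eventually (\<lambda>n. t / 2 ^ n < d) sequentially"
    by (rule order_tendstoD(2)[OF LIMSEQ_divide_realpow_zero d(1)]) simp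
  then obtain n where n: "t / 2 ^ n < d" by (auto simp: eventually_sequentially)
  \<comment> \<open>The index of the last grid time not after the hitting time; rounding down keeps
    the index at most \<open>2 ^ n\<close>.\<close>
  define i where "i = nat \<lfloor>\<tau> \<omega> * 2 ^ n / t\<rfloor>"
  have nn: "\<tau> \<omega> * 2 ^ n / t \<ge> 0" using tau01 t by simp
  have i1: "real i \<le> \<tau> \<omega> * 2 ^ n / t" using nn by (simp add: i_def)
  have i2: "\<tau> \<omega> * 2 ^ n / t < real i + 1" using nn by (simp add: i_def)
  have "\<tau> \<omega> * 2 ^ n / t \<le> 2 ^ n" using hit t by (simp add: field_simps)
  then have "real i \<le> 2 ^ n" using i1 by linarith
  then have in': "i \<le> 2 ^ n" by (metis of_nat_le_iff of_nat_numeral of_nat_power)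
  have "\<bar>t * real i / 2 ^ n - \<tau> \<omega>\<bar> < d"
  proof -
    have "t * real i / 2 ^ n \<le> \<tau> \<omega>" using i1 t by (simp add: field_simps)
    moreover have "\<tau> \<omega> - t * real i / 2 ^ n < t / 2 ^ n"
    proof -
      have "\<tau> \<omega> * 2 ^ n < (real i + 1) * t" using i2 t by (simp add: pos_divide_less_eq)
      then have "\<tau> \<omega> < (real i + 1) * t / 2 ^ n" by (simp add: pos_less_divide_eq)
      also have "\<dots> = t * real i / 2 ^ n + t / 2 ^ n"
        unfolding distrib_right add_divide_distrib by simp
      finally show ?thesis by simp
    qed
    ultimately show ?thesis using n by linarith
  qed
  then have "\<eta> (t * real i / 2 ^ n) \<omega> < \<delta>"
    using d(2) grid_in(2)[of t i "2 ^ n"] in' t by auto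
  then have "\<omega> \<in> below_on_grid t (2 ^ n) \<delta>"
    using \<omega> in' by (auto simp: below_on_grid_def intro!: exI[of _ i])
  then show ?thesis by blast
qed

text \<open>The grids may vary with the tolerance. The minimum of the path over the compact interval
  up to \<open>t\<close> is attained and lies below every tolerance, hence it is
  nonpositive.\<close>

lemma below_on_grid_imp_hit:
  assumes \<omega>: "\<omega> \<in> space M" and t: "0 < t" "t \<le> 1"
    and below: "\<And>j. \<exists>n. \<omega> \<in> below_on_grid t n (1 / real (Suc j))"
  shows "\<tau> \<omega> \<le> t"
proof -
  have "continuous_on {0..t} (\<lambda>s. \<eta> s \<omega>)"
    using path(1)[OF \<omega>] t by (auto intro: continuous_on_subset)
  then obtain s where s: "s \<in> {0..t}" "\<And>y. y \<in> {0..t} \<Longrightarrow> \<eta> s \<omega> \<le> \<eta> y \<omega>"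
    using continuous_attains_inf[of "{0..t}" "\<lambda>s. \<eta> s \<omega>"] t by auto
  have "\<eta> s \<omega> \<le> 1 / real (Suc j)" for j
  proof -
    obtain n i where "i \<le> n" "\<eta> (t * real i / real n) \<omega> \<le> 1 / real (Suc j)"
      using below[of j] by (auto simp: below_on_grid_def)
    then show ?thesis using s(2)[of "t * real i / real n"] grid_in(1)[of t i n] t by auto
  qed
  then have "\<eta> s \<omega> \<le> 0"
    by (intro LIMSEQ_le_const[OF LIMSEQ_Suc[OF lim_1_over_n]]) blast
  then show ?thesis using \<tau>_path(3)[OF \<omega>, of s] s(1) t by auto
qed

text \<open>Serves measurability: the hitting time is an infimum over uncountably many times, while
  the right-hand side involves countably many grid events.\<close>

lemma hit_event_eq:
  assumes t: "0 < t" "t \<le> 1"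
  shows "{\<omega> \<in> space M. \<tau> \<omega> \<le> t} = (\<Inter>j. \<Union>n. below_on_grid t (2 ^ n) (1 / real (Suc j)))"
proof (intro equalityI subsetI)
  fix \<omega> assume "\<omega> \<in> {\<omega> \<in> space M. \<tau> \<omega> \<le> t}"
  then show "\<omega> \<in> (\<Inter>j. \<Union>n. below_on_grid t (2 ^ n) (1 / real (Suc j)))"
    using hit_imp_below_on_grid[OF _ t] by auto
next
  fix \<omega> assume \<omega>: "\<omega> \<in> (\<Inter>j. \<Union>n. below_on_grid t (2 ^ n) (1 / real (Suc j)))"
  then have "\<omega> \<in> space M" by (auto simp: below_on_grid_def)
  then show "\<omega> \<in> {\<omega> \<in> space M. \<tau> \<omega> \<le> t}"
    using below_on_grid_imp_hit[OF _ t] \<omega> by blast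
qed

lemma measurable_\<tau>[measurable]: "\<tau> \<in> borel_measurable M"
proof (rule borel_measurableI_le)
  fix t :: real
  consider "t \<le> 0" | "0 < t" "t \<le> 1" | "t > 1" by linarith
  then show "{\<omega> \<in> space M. \<tau> \<omega> \<le> t} \<in> sets M"
  proof cases
    case 1
    then have "{\<omega> \<in> space M. \<tau> \<omega> \<le> t} = {}" by (auto dest: \<tau>_path(1))
    then show ?thesis by (metis sets.empty_sets)
  next
    case 2
    have "(\<Inter>j. \<Union>n. below_on_grid t (2 ^ n) (1 / real (Suc j))) \<in> sets M"
      using measurable_below_on_grid[of t] 2 by (intro sets.countable_INT sets.countable_UN) auto
    then show ?thesis using hit_event_eq[OF 2] by simp
  next
    case 3
    then have "{\<omega> \<in> space M. \<tau> \<omega> \<le> t} = space M" by (auto dest: \<tau>_path(1))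
    then show ?thesis by simp
  qed
qed

text \<open>The probability is squeezed between twice the law of \<open>\<eta> t\<close> at
  \<open>- \<epsilon>\<close> and at \<open>\<delta>\<close>: dyadic grids with tolerance give the
  upper bound, grids with vanishing oscillation the lower one. Continuity of the normal distribution
  function closes the gap.\<close>

theorem prob_hit:
  assumes t: "0 < t" "t < 1"
  shows "prob {\<omega> \<in> space M. \<tau> \<omega> \<le> t} = 2 * std_normal_cdf (- a * sqrt ((1 - t) / t))"
proof -
  have mg: "below_on_grid t n \<delta> \<in> sets M" for n \<delta> using t by (intro measurable_below_on_grid) auto
  have [measurable]: "\<eta> t \<in> borel_measurable M" using t by (intro measurable_\<eta>) auto
  define H where "H y = std_normal_cdf ((y - a * (1 - t)) / sqrt (t * (1 - t)))" for y
  have contH: "isCont H y" for y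
    unfolding H_def using t by (intro isCont_o2[OF _ continuous_std_normal_cdf] continuous_intros) auto
  have up: "prob {\<omega> \<in> space M. \<tau> \<omega> \<le> t} \<le> 2 * H \<delta>" if \<delta>: "\<delta> > 0" for \<delta>
  proof -
    have "incseq (\<lambda>n. below_on_grid t (2 ^ n) \<delta>)"
      by (intro incseq_SucI below_on_grid_mono)
    then have lim: "(\<lambda>n. prob (below_on_grid t (2 ^ n) \<delta>)) \<longlonglongrightarrow> prob (\<Union>n. below_on_grid t (2 ^ n) \<delta>)"
      using mg by (intro finite_Lim_measure_incseq) auto
    have "prob {\<omega> \<in> space M. \<tau> \<omega> \<le> t} \<le> prob (\<Union>n. below_on_grid t (2 ^ n) \<delta>)"
      using hit_imp_below_on_grid[of _ t \<delta>] t \<delta> mg by (intro finite_measure_mono) auto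
    also have "\<dots> \<le> 2 * H \<delta>"
      using prob_below_on_grid_le[of t \<delta>] cdf_single[OF t, of \<delta>] t \<delta>
      by (intro LIMSEQ_le_const2[OF lim]) (auto simp: H_def)
    finally show ?thesis .
  qed
  have low: "prob {\<omega> \<in> space M. \<tau> \<omega> \<le> t} \<ge> 2 * H (- \<epsilon>)" if \<epsilon>: "\<epsilon> > 0" for \<epsilon>
  proof -
    \<comment> \<open>Halving \<open>\<epsilon>\<close> turns the weak inequality of a distribution
      function into the strict one of \<open>prob_below_on_grid_ge\<close>.\<close>
    have "H (- \<epsilon>) \<le> prob {\<omega> \<in> space M. \<eta> t \<omega> < - (\<epsilon> / 2)}"
      unfolding H_def cdf_single[OF t, symmetric] using \<epsilon> by (intro finite_measure_mono) auto
    moreover have "2 * (prob {\<omega> \<in> space M. \<eta> t \<omega> < - (\<epsilon> / 2)} - 0) \<le> prob {\<omega> \<in> space M. \<tau> \<omega> \<le> t}"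
    proof (rule LIMSEQ_le_const2)
      show "(\<lambda>n. 2 * (prob {\<omega> \<in> space M. \<eta> t \<omega> < - (\<epsilon> / 2)} - prob (oscillation t n (\<epsilon> / 2))))
          \<longlonglongrightarrow> 2 * (prob {\<omega> \<in> space M. \<eta> t \<omega> < - (\<epsilon> / 2)} - 0)"
        using t \<epsilon> by (intro tendsto_intros oscillation_tendsto_0) auto
      have "prob (below_on_grid t n 0) \<le> prob {\<omega> \<in> space M. \<tau> \<omega> \<le> t}" for n
      proof (rule finite_measure_mono)
        show "below_on_grid t n 0 \<subseteq> {\<omega> \<in> space M. \<tau> \<omega> \<le> t}"
        proof
          fix \<omega> assume "\<omega> \<in> below_on_grid t n 0"
          then obtain i where i: "i \<le> n" "\<eta> (t * real i / n) \<omega> \<le> 0" and \<omega>: "\<omega> \<in> space M"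
            by (auto simp: below_on_grid_def)
          have "\<tau> \<omega> \<le> t * real i / n"
            using \<tau>_path(3)[OF \<omega> grid_in(2)[of t i n] i(2)] t i by simp
          also have "\<dots> \<le> t" using grid_in(1)[of t i n] t i by simp
          finally show "\<omega> \<in> {\<omega> \<in> space M. \<tau> \<omega> \<le> t}" using \<omega> by simp
        qed
      qed measurable
      then have "2 * (prob {\<omega> \<in> space M. \<eta> t \<omega> < - (\<epsilon> / 2)} - prob (oscillation t n (\<epsilon> / 2)))
          \<le> prob {\<omega> \<in> space M. \<tau> \<omega> \<le> t}" if "n > 0" for n
        using prob_below_on_grid_ge[of t n "\<epsilon> / 2"] t \<epsilon> that by (meson less_imp_le half_gt_zero order_trans)
      then show "\<exists>N. \<forall>n\<ge>N. 2 * (prob {\<omega> \<in> space M. \<eta> t \<omega> < - (\<epsilon> / 2)} - prob (oscillation t n (\<epsilon> / 2)))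
          \<le> prob {\<omega> \<in> space M. \<tau> \<omega> \<le> t}"
        by (intro exI[of _ 1]) auto
    qed
    ultimately show ?thesis by simp
  qed
  have "prob {\<omega> \<in> space M. \<tau> \<omega> \<le> t} \<le> 2 * H 0"
  proof (rule LIMSEQ_le_const)
    have "(\<lambda>n. H (1 / real (Suc n))) \<longlonglongrightarrow> H 0"
      by (rule isCont_tendsto_compose[OF contH]) (rule LIMSEQ_Suc[OF lim_1_over_n])
    then show "(\<lambda>n. 2 * H (1 / real (Suc n))) \<longlonglongrightarrow> 2 * H 0" by (intro tendsto_intros)
  qed (use up in auto)
  moreover have "2 * H 0 \<le> prob {\<omega> \<in> space M. \<tau> \<omega> \<le> t}"
  proof (rule LIMSEQ_le_const2)
    have "(\<lambda>n. - (1 / real (Suc n))) \<longlonglongrightarrow> - 0"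
      by (intro tendsto_minus LIMSEQ_Suc[OF lim_1_over_n])
    then have "(\<lambda>n. H (- (1 / real (Suc n)))) \<longlonglongrightarrow> H 0"
      by (intro isCont_tendsto_compose[OF contH]) simp
    then show "(\<lambda>n. 2 * H (- (1 / real (Suc n)))) \<longlonglongrightarrow> 2 * H 0" by (intro tendsto_intros)
  qed (use low in auto)
  moreover have "(0 - a * (1 - t)) / sqrt (t * (1 - t)) = - a * sqrt ((1 - t) / t)"
  proof -
    have "(1 - t) / (sqrt t * sqrt (1 - t)) = sqrt (1 - t) / sqrt t"
      using t by (simp add: real_div_sqrt flip: divide_divide_eq_left' divide_divide_eq_left)
    then have "(0 - a * (1 - t)) / (sqrt t * sqrt (1 - t)) = - a * (sqrt (1 - t) / sqrt t)"
      by (simp flip: times_divide_eq_right)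
    then show ?thesis by (simp add: real_sqrt_mult real_sqrt_divide)
  qed
  ultimately show ?thesis by (simp add: H_def)
qed

end

section \<open>Stirling's formula\<close>

definition stirling_ratio :: "nat \<Rightarrow> real" where
  "stirling_ratio n = fact n * exp (real n) / (real n ^ n * sqrt (real n))"

lemma stirling_ratio_pos: "n > 0 \<Longrightarrow> stirling_ratio n > 0"
  by (simp add: stirling_ratio_def)

lemma ln_stirling_ratio_diff:
  assumes n: "n > 0"
  shows "ln (stirling_ratio n) - ln (stirling_ratio (Suc n)) =
    (real n + 1/2) * (ln (real n + 1) - ln (real n)) - 1"
proof -
  have ln: "ln (stirling_ratio k) = ln (fact k) + real k - (real k * ln (real k) + ln (real k) / 2)"
    if "k > 0" for k
    using that by (simp add: stirling_ratio_def ln_div ln_mult ln_realpow ln_sqrt)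
  have "ln (fact (Suc n) :: real) = ln (real n + 1) + ln (fact n)"
    by (simp add: ln_mult add.commute)
  then show ?thesis
    using n by (simp add: ln algebra_simps add_divide_distrib)
qed

text \<open>By convexity of 1 / x, the midpoint rule bounds the logarithmic increment from below and
  the trapezoid rule from above. So the logarithm of the ratio decreases, and it increases after a
  correction that tends to 0.\<close>

lemma stirling_ratio_convergent: "\<exists>C>0. stirling_ratio \<longlonglongrightarrow> C"
proof -
  define b where "b n = ln (stirling_ratio (Suc n))" for n
  \<comment> \<open>The correction comes from the error of the trapezoid bound, 1 / (4 * x * (x +
    1)), which telescopes.\<close>
  define e where "e n = b n - 1 / (4 * real (Suc n))" for n
  have le: "b (Suc n) \<le> b n" for n
  proof -
    have "ln (real (Suc n) + 1) - ln (real (Suc n)) \<ge> 2 * ((real (Suc n) + 1) - real (Suc n)) / (real (Suc n) + (real (Suc n) + 1))"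
      by (rule ln_inverse_approx_ge) auto
    then have "(real (Suc n) + 1/2) * (2 / (2 * real (Suc n) + 1)) \<le> (real (Suc n) + 1/2) * (ln (real (Suc n) + 1) - ln (real (Suc n)))"
      by (intro mult_left_mono) (auto simp: algebra_simps)
    moreover have "(real (Suc n) + 1/2) * (2 / (2 * real (Suc n) + 1)) = 1" by (simp add: field_simps)
    ultimately have "1 \<le> (real (Suc n) + 1/2) * (ln (real (Suc n) + 1) - ln (real (Suc n)))" by linarith
    then show ?thesis
      using ln_stirling_ratio_diff[of "Suc n"] unfolding b_def by linarith
  qed
  have ge: "e n \<le> e (Suc n)" for n
  proof -
    have "ln (real (Suc n) + 1) - ln (real (Suc n)) \<le> 1 * (inverse (real (Suc n)) + inverse (real (Suc n) + 1)) / 2"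
      by (rule ln_inverse_approx_le) auto
    then have "(real (Suc n) + 1/2) * (ln (real (Suc n) + 1) - ln (real (Suc n))) \<le>
      (real (Suc n) + 1/2) * ((inverse (real (Suc n)) + inverse (real (Suc n) + 1)) / 2)"
      by (intro mult_left_mono) auto
    also have "\<dots> = 1 + 1 / (4 * real (Suc n)) - 1 / (4 * real (Suc (Suc n)))"
    proof -
      have "(x + 1/2) * ((inverse x + inverse (x + 1)) / 2) = 1 + 1 / (4 * x) - 1 / (4 * (x + 1))"
        if "x > 0" for x :: real
      proof -
        have "x + 1 \<noteq> 0" using that by simp
        then show ?thesis using that by (simp add: divide_simps) (simp add: algebra_simps)
      qed
      from this[of "real (Suc n)"] show ?thesis by (simp add: add.commute)
    qed
    finally show ?thesis
      using ln_stirling_ratio_diff[of "Suc n"] by (simp add: b_def e_def)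
  qed
  have "e 0 \<le> e n" for n by (induction n) (use ge order_trans in blast)+
  then have "e 0 \<le> b n" for n using e_def[of n] by (smt (verit) divide_nonneg_nonneg of_nat_0_le_iff)
  moreover have dec: "decseq b" using le by (rule decseq_SucI)
  ultimately obtain L where "b \<longlonglongrightarrow> L"
    using decseq_convergent[of b "e 0"] by blast
  then have "(\<lambda>n. exp (b n)) \<longlonglongrightarrow> exp L" by (intro tendsto_exp)
  then have "(\<lambda>n. stirling_ratio (Suc n)) \<longlonglongrightarrow> exp L"
    by (simp add: b_def stirling_ratio_pos)
  then show ?thesis by (intro exI[of _ "exp L"]) (simp add: filterlim_sequentially_Suc)
qed

lemma wallis_product_eq:
  "(\<Prod>k=1..n. (4 * real k ^ 2) / (4 * real k ^ 2 - 1)) = (2 ^ n * fact n) ^ 4 / ((fact (2 * n)) ^ 2 * (2 * real n + 1))"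
proof (induction n)
  case (Suc n)
  have f: "fact (2 * Suc n) = (2 * real n + 2) * (2 * real n + 1) * fact (2 * n)"
    by (simp add: algebra_simps)
  have nz: "(fact (2 * n) :: real) \<noteq> 0" "2 * real n + 1 \<noteq> 0" "2 * real n + 3 \<noteq> 0" "2 * real n + 2 \<noteq> 0" by auto
  have d: "4 * real (Suc n) ^ 2 - 1 = (2 * real n + 1) * (2 * real n + 3)"
    by (simp add: power2_eq_square algebra_simps)
  have "(\<Prod>k=1..Suc n. (4 * real k ^ 2) / (4 * real k ^ 2 - 1)) =
     (2 ^ n * fact n) ^ 4 / ((fact (2 * n)) ^ 2 * (2 * real n + 1)) * ((4 * real (Suc n) ^ 2) / ((2 * real n + 1) * (2 * real n + 3)))"
    using Suc d by simp
  also have "\<dots> = ((2 ^ n * fact n) ^ 4 * (4 * real (Suc n) ^ 2)) * (2 * real n + 2) ^ 2 /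
      (((2 * real n + 2) * (2 * real n + 1) * fact (2 * n)) ^ 2 * (2 * real n + 3))"
    using nz by (simp add: divide_simps power2_eq_square)
  also have "(2 ^ n * fact n) ^ 4 * (4 * real (Suc n) ^ 2) * (2 * real n + 2) ^ 2 = (2 ^ Suc n * fact (Suc n) :: real) ^ 4"
    by (simp add: power_mult_distrib algebra_simps power4_eq_xxxx power2_eq_square)
  finally show ?case by (simp add: f[symmetric] algebra_simps)
qed simp

text \<open>Existence of the limit \<open>C\<close> is settled; Wallis' product, expressed through
  the ratios at \<open>n\<close> and \<open>2 * n\<close>, leaves the equation
  \<open>C ^ 2 / 4 = pi / 2\<close>.\<close>

theorem stirling: "stirling_ratio \<longlonglongrightarrow> sqrt (2 * pi)"
proof -
  obtain C where C: "C > 0" "stirling_ratio \<longlonglongrightarrow> C" using stirling_ratio_convergent by blast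
  have "filterlim (\<lambda>n::nat. 2 * n) at_top sequentially" by real_asymp
  then have C2: "(\<lambda>n. stirling_ratio (2 * n)) \<longlonglongrightarrow> C"
    by (rule filterlim_compose[OF C(2)])
  have w: "(2 ^ n * fact n) ^ 4 / ((fact (2 * n)) ^ 2 * (2 * real n + 1)) =
      stirling_ratio n ^ 4 / stirling_ratio (2 * n) ^ 2 * (real n / (2 * (2 * real n + 1)))" if n: "n > 0" for n
  proof -
    have f: "fact k = stirling_ratio k * (real k ^ k * sqrt (real k)) / exp (real k)" if "k > 0" for k
      using that by (simp add: stirling_ratio_def)
    have s4: "sqrt (real n) ^ 4 = real n ^ 2" "sqrt (2 * real n) ^ 2 = 2 * real n"
      using power_mult[of "sqrt (real n)" 2 2] by auto
    have e: "exp (real n) ^ 4 = exp (2 * real n) ^ 2"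
      by (simp flip: exp_of_nat_mult)
    have p1: "(2 ^ n * (a * (real n ^ n * sqrt (real n)) / exp (real n))) ^ 4 =
       a ^ 4 * (2 ^ n * real n ^ n) ^ 4 * real n ^ 2 / exp (2 * real n) ^ 2" for a :: real
      by (simp add: power_mult_distrib power_divide s4 e)
    have p2: "(b * ((2 * real n) ^ (2 * n) * sqrt (2 * real n)) / exp (2 * real n)) ^ 2 =
       b ^ 2 * (2 ^ n * real n ^ n) ^ 4 * (2 * real n) / exp (2 * real n) ^ 2" for b :: real
    proof -
      have "((2 * real n) ^ (2 * n)) ^ 2 = (2 ^ n * real n ^ n) ^ 4"
        by (simp add: power_mult_distrib flip: power_mult) (simp add: mult_ac)
      then show ?thesis by (simp add: power_mult_distrib power_divide s4)
    qed
    define a b X Y where "a = stirling_ratio n" "b = stirling_ratio (2 * n)"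
      "X = (2 ^ n * real n ^ n) ^ 4" "Y = exp (2 * real n) ^ 2"
    have nz: "b \<noteq> 0" "X \<noteq> 0" "Y \<noteq> 0" "real n \<noteq> 0" "2 * real n + 1 \<noteq> 0"
      using n stirling_ratio_pos[of "2 * n"] by (auto simp: a_b_X_Y_def)
    have "(2 ^ n * fact n) ^ 4 / ((fact (2 * n)) ^ 2 * (2 * real n + 1)) =
      (a ^ 4 * X * real n ^ 2 / Y) / ((b ^ 2 * X * (2 * real n) / Y) * (2 * real n + 1))"
      using f[of n] f[of "2 * n"] n p1[of a] p2[of b] by (simp add: a_b_X_Y_def)
    also have "\<dots> = a ^ 4 / b ^ 2 * (real n / (2 * (2 * real n + 1)))"
    proof -
      have "(A * X * N ^ 2 / Y) / ((B * X * (2 * N) / Y) * W) = A / B * (N / (2 * W))"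
        if "B \<noteq> 0" "N \<noteq> 0" "W \<noteq> 0" for A B N W :: real
        using nz that by (simp add: field_simps power2_eq_square)
      then show ?thesis using nz by simp
    qed
    finally show ?thesis by (simp add: a_b_X_Y_def)
  qed
  have "(\<lambda>n. stirling_ratio n ^ 4 / stirling_ratio (2 * n) ^ 2 * (real n / (2 * (2 * real n + 1))))
      \<longlonglongrightarrow> C ^ 4 / C ^ 2 * (1 / 4)"
  proof (rule tendsto_mult)
    show "(\<lambda>n. stirling_ratio n ^ 4 / stirling_ratio (2 * n) ^ 2) \<longlonglongrightarrow> C ^ 4 / C ^ 2"
      using C by (intro tendsto_divide tendsto_power C2) auto
    show "(\<lambda>n. real n / (2 * (2 * real n + 1))) \<longlonglongrightarrow> 1 / 4" by real_asymp
  qed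
  moreover have "(\<lambda>n. stirling_ratio n ^ 4 / stirling_ratio (2 * n) ^ 2 * (real n / (2 * (2 * real n + 1))))
      \<longlonglongrightarrow> pi / 2"
  proof (rule Lim_transform_eventually[OF wallis])
    show "\<forall>\<^sub>F n in sequentially. (\<Prod>k=1..n. (4 * real k ^ 2) / (4 * real k ^ 2 - 1)) =
        stirling_ratio n ^ 4 / stirling_ratio (2 * n) ^ 2 * (real n / (2 * (2 * real n + 1)))"
      using eventually_gt_at_top[of 0] by eventually_elim (simp only: wallis_product_eq w)
  qed
  ultimately have "C ^ 4 / C ^ 2 * (1 / 4) = pi / 2" by (rule LIMSEQ_unique)
  moreover have "C ^ 4 / C ^ 2 = C ^ 2" using C(1) by (simp add: power4_eq_xxxx power2_eq_square)
  ultimately have "C ^ 2 = 2 * pi" by simp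
  then have "C = sqrt (2 * pi)" using C(1) by (simp add: real_sqrt_unique)
  then show ?thesis using C(2) by simp
qed

section \<open>The local limit of the number of surviving points\<close>

definition alive_size_prob :: "nat \<Rightarrow> nat \<Rightarrow> nat \<Rightarrow> nat \<Rightarrow> real" where
  "alive_size_prob N s d m =
     real ((N choose m) * ((m * s) ^ m * forest_count s (N - m) d)) / real (d + N * s) ^ N"

text \<open>By Stirling's formula this is asymptotically \<open>1 / sqrt (2 * pi * n)\<close>.\<close>

definition borel_weight :: "nat \<Rightarrow> real" where
  "borel_weight n = real n ^ n * exp (- real n) / fact n"

lemma borel_weight_eq: "n > 0 \<Longrightarrow> borel_weight n = 1 / (stirling_ratio n * sqrt (real n))"
  by (simp add: borel_weight_def stirling_ratio_def exp_minus divide_simps)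

text \<open>The form of \<open>alive_size_prob\<close> suited to asymptotics. Each power
  \<open>n ^ n\<close> is paired with its factorial; the exponentials added for this cancel as
  \<open>m + (N - m) = N\<close>. Of \<open>d\<close> and \<open>s\<close> only the quotient
  \<open>c = d / s\<close> survives.\<close>

definition size_weight :: "nat \<Rightarrow> real \<Rightarrow> nat \<Rightarrow> real" where
  "size_weight N c m = borel_weight m * borel_weight (N - m) / borel_weight N *
     ((1 + c / real (N - m)) ^ (N - m) / (1 + c / real N) ^ N) * (c / (c + real (N - m)))"

lemma alive_size_prob_eq:
  assumes "s > 0" "m < N"
  shows "alive_size_prob N s d m = size_weight N (real d / real s) m"
proof -
  define l c S where "l = N - m" "c = real d / real s" "S = real s"
  have l: "l > 0" "N = m + l" and N: "N > 0" using assms by (auto simp: l_c_S_def)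
  have S: "S > 0" and c: "c \<ge> 0" using assms by (auto simp: l_c_S_def)
  have d: "real d = S * c" using S by (simp add: l_c_S_def)
  have fc: "real (forest_count s l d) = (c / (c + real l)) * (S * (c + real l)) ^ l"
  proof -
    obtain k where k: "l = Suc k" using l gr0_implies_Suc by blast
    have "real (forest_count s l d) = real d * (real d + real l * real s) ^ k"
      by (simp add: forest_count_def k distrib_right)
    also have "\<dots> = (S * c) * (S * c + real l * S) ^ k"
      unfolding d by (simp add: l_c_S_def(3))
    also have "S * c + real l * S = S * (c + real l)" by (simp add: algebra_simps)
    also have "(S * c) * (S * (c + real l)) ^ k = (c / (c + real l)) * (S * (c + real l)) ^ l"
      using c l by (simp add: k)
    finally show ?thesis .
  qed
  have pl: "(c + real l) ^ l = real l ^ l * (1 + c / real l) ^ l"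
    using l by (simp add: power_mult_distrib[symmetric] algebra_simps)
  have pN: "(c + real N) ^ N = real N ^ N * (1 + c / real N) ^ N"
    using N by (simp add: power_mult_distrib[symmetric] algebra_simps)
  have tot: "real (d + N * s) = S * (c + real N)"
    by (simp add: d l_c_S_def(3)[symmetric] algebra_simps)
  have bin: "real (N choose m) = fact N / (fact m * fact l)"
    using assms by (simp add: binomial_fact l_c_S_def)
  have ex: "exp (- real m) * exp (- real l) = exp (- real N)"
    using l by (simp flip: exp_add)
  have SN: "S ^ m * S ^ l = S ^ N" using l by (simp add: power_add)
  have "alive_size_prob N s d m = fact N / (fact m * fact l) * ((real m * S) ^ m *
      ((c / (c + real l)) * (S * (c + real l)) ^ l)) / (S * (c + real N)) ^ N"
    unfolding alive_size_prob_def tot of_nat_mult bin fc[symmetric] by (simp add: l_c_S_def)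
  also have "\<dots> = fact N / (fact m * fact l) * (real m ^ m * real l ^ l) * (S ^ m * S ^ l) *
      (1 + c / real l) ^ l * (c / (c + real l)) / (S ^ N * (real N ^ N * (1 + c / real N) ^ N))"
    unfolding power_mult_distrib pl pN by (simp add: mult_ac)
  also have "\<dots> = fact N / (fact m * fact l) * (real m ^ m * real l ^ l) *
      (1 + c / real l) ^ l * (c / (c + real l)) / (real N ^ N * (1 + c / real N) ^ N)"
    unfolding SN using S by simp
  also have "\<dots> = size_weight N c m"
  proof -
    have "borel_weight m * borel_weight l / borel_weight N =
       (real m ^ m * real l ^ l) * (exp (- real m) * exp (- real l)) / (fact m * fact l) * fact N / (real N ^ N * exp (- real N))"
      by (simp add: borel_weight_def)
    also have "\<dots> = fact N / (fact m * fact l) * (real m ^ m * real l ^ l) / real N ^ N"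
      unfolding ex by (simp add: mult_ac)
    finally show ?thesis
      unfolding size_weight_def l_c_S_def(1)[symmetric] by simp
  qed
  finally show ?thesis by (simp add: l_c_S_def)
qed

text \<open>The density of \<open>1 - \<tau>\<close> for a bridge from \<open>a\<close> to 0. The
  algebraic factor stems from Stirling's formula and \<open>c / (c + real (N - m))\<close>, the
  exponential one from the quotient of powers in \<open>size_weight\<close>.\<close>

definition limit_density :: "real \<Rightarrow> real \<Rightarrow> real" where
  "limit_density a x = a / (sqrt (2 * pi) * sqrt x * ((1 - x) * sqrt (1 - x))) * exp (- (a\<^sup>2 / 2) * (x / (1 - x)))"

text \<open>Second order expansion of the logarithm. The linear term \<open>c n\<close> is typically
  unbounded, but it is the same for both powers in \<open>size_weight\<close> and cancels in their
  quotient.\<close>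

lemma log_power_asymp:
  fixes c L :: "nat \<Rightarrow> real"
  assumes c: "(\<lambda>n. (c n)\<^sup>2 / L n) \<longlonglongrightarrow> b" and cL: "(\<lambda>n. c n / L n) \<longlonglongrightarrow> 0"
    and pos: "eventually (\<lambda>n. c n > 0 \<and> L n > 0) sequentially"
  shows "(\<lambda>n. L n * ln (1 + c n / L n) - c n) \<longlonglongrightarrow> - b / 2"
proof -
  have h: "((\<lambda>u::real. (ln (1 + u) - u) / u\<^sup>2) \<longlongrightarrow> - 1 / 2) (at_right 0)"
    by real_asymp
  have "filterlim (\<lambda>n. c n / L n) (at_right 0) sequentially"
    unfolding filterlim_at using cL pos by (auto elim!: eventually_mono)
  then have "(\<lambda>n. (ln (1 + c n / L n) - c n / L n) / (c n / L n)\<^sup>2) \<longlonglongrightarrow> - 1 / 2"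
    by (rule filterlim_compose[OF h])
  then have "(\<lambda>n. (c n)\<^sup>2 / L n * ((ln (1 + c n / L n) - c n / L n) / (c n / L n)\<^sup>2)) \<longlonglongrightarrow> b * (- 1 / 2)"
    by (intro tendsto_mult c)
  moreover have "eventually (\<lambda>n. (c n)\<^sup>2 / L n * ((ln (1 + c n / L n) - c n / L n) / (c n / L n)\<^sup>2) =
      L n * ln (1 + c n / L n) - c n) sequentially"
    using pos
  proof eventually_elim
    case (elim n)
    have "(c n)\<^sup>2 / L n * (z / (c n / L n)\<^sup>2) = L n * z" for z
      using elim by (simp add: power2_eq_square)
    then have "(c n)\<^sup>2 / L n * ((ln (1 + c n / L n) - c n / L n) / (c n / L n)\<^sup>2) =
        L n * (ln (1 + c n / L n) - c n / L n)" .
    also have "\<dots> = L n * ln (1 + c n / L n) - c n"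
      using elim by (simp add: right_diff_distrib)
    finally show ?case .
  qed
  ultimately have "(\<lambda>n. L n * ln (1 + c n / L n) - c n) \<longlonglongrightarrow> b * (- 1 / 2)"
    by (rule Lim_transform_eventually)
  then show ?thesis by simp
qed

text \<open>With m ~ x * N, N - m ~ (1 - x) * N and c ~ a * sqrt N, the quotient of Borel weights
  and the factor c / (c + N - m) are each of order 1 / sqrt N, which the factor \<open>N\<close>
  compensates.\<close>

lemma local_limit:
  fixes N m :: "nat \<Rightarrow> nat" and c :: "nat \<Rightarrow> real"
  assumes N: "filterlim N at_top sequentially" and c: "(\<lambda>n. c n / sqrt (real (N n))) \<longlonglongrightarrow> a"
    and a: "a > 0" and m: "(\<lambda>n. real (m n) / real (N n)) \<longlonglongrightarrow> x" and x: "0 < x" "x < 1"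
  shows "(\<lambda>n. real (N n) * size_weight (N n) (c n) (m n)) \<longlonglongrightarrow> limit_density a x"
proof -
  define l where "l n = N n - m n" for n
  have N0: "eventually (\<lambda>n. N n > 0) sequentially"
    by (rule eventually_compose_filterlim[OF eventually_gt_at_top[of 0] N])
  have rN: "filterlim (\<lambda>n. real (N n)) at_top sequentially"
    by (rule filterlim_compose[OF filterlim_real_sequentially N])
  have m0: "eventually (\<lambda>n. m n > 0) sequentially"
    using order_tendstoD(1)[OF m x(1)] by eventually_elim (auto intro: ccontr)
  have mN: "eventually (\<lambda>n. m n < N n) sequentially"
    using order_tendstoD(2)[OF m x(2)] N0 by eventually_elim (simp add: divide_less_eq)
  have c0: "eventually (\<lambda>n. c n > 0) sequentially"
    using order_tendstoD(1)[OF c a] N0 by eventually_elim (auto simp: zero_less_divide_iff)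
  have l: "(\<lambda>n. real (l n) / real (N n)) \<longlonglongrightarrow> 1 - x"
  proof (rule Lim_transform_eventually)
    show "(\<lambda>n. 1 - real (m n) / real (N n)) \<longlonglongrightarrow> 1 - x" by (intro tendsto_intros m)
    show "\<forall>\<^sub>F n in sequentially. 1 - real (m n) / real (N n) = real (l n) / real (N n)"
      using mN by eventually_elim (simp add: l_def of_nat_diff field_simps)
  qed
  have fm: "filterlim m at_top sequentially"
  proof -
    have "filterlim (\<lambda>n. real (m n) / real (N n) * real (N n)) at_top sequentially"
      by (rule filterlim_tendsto_pos_mult_at_top[OF m x(1) rN])
    moreover have "eventually (\<lambda>n. real (m n) / real (N n) * real (N n) = real (m n)) sequentially"
      using N0 by eventually_elim simp
    ultimately have "filterlim (\<lambda>n. real (m n)) at_top sequentially"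
      by (simp cong: filterlim_cong)
    then show ?thesis by (simp add: filterlim_sequentially_iff_filterlim_real)
  qed
  have fl: "filterlim l at_top sequentially"
  proof -
    have "filterlim (\<lambda>n. real (l n) / real (N n) * real (N n)) at_top sequentially"
      using x by (intro filterlim_tendsto_pos_mult_at_top[OF l _ rN]) auto
    moreover have "eventually (\<lambda>n. real (l n) / real (N n) * real (N n) = real (l n)) sequentially"
      using N0 by eventually_elim simp
    ultimately have "filterlim (\<lambda>n. real (l n)) at_top sequentially"
      by (simp cong: filterlim_cong)
    then show ?thesis by (simp add: filterlim_sequentially_iff_filterlim_real)
  qed
  have cN: "(\<lambda>n. c n / real (N n)) \<longlonglongrightarrow> 0"
  proof (rule Lim_transform_eventually)
    have "filterlim (\<lambda>n. sqrt (real (N n))) at_top sequentially"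
      by (rule filterlim_compose[OF sqrt_at_top rN])
    then show "(\<lambda>n. (c n / sqrt (real (N n))) / sqrt (real (N n))) \<longlonglongrightarrow> 0"
      by (rule real_tendsto_divide_at_top[OF c])
  qed (simp add: field_simps)
  \<comment> \<open>The quotient of powers in exponential form, with the divergent
    \<open>c n\<close> subtracted from both terms.\<close>
  define E where "E n = exp ((real (l n) * ln (1 + c n / real (l n)) - c n) - (real (N n) * ln (1 + c n / real (N n)) - c n))" for n
  have E: "E \<longlonglongrightarrow> exp (- (a\<^sup>2 / (1 - x)) / 2 - (- a\<^sup>2 / 2))"
    unfolding E_def
  proof (intro tendsto_exp tendsto_diff log_power_asymp)
    have "(\<lambda>n. (c n / sqrt (real (N n)))\<^sup>2) \<longlonglongrightarrow> a\<^sup>2" by (intro tendsto_intros c)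
    then show c2: "(\<lambda>n. (c n)\<^sup>2 / real (N n)) \<longlonglongrightarrow> a\<^sup>2" by (simp add: power_divide)
    show "(\<lambda>n. (c n)\<^sup>2 / real (l n)) \<longlonglongrightarrow> a\<^sup>2 / (1 - x)"
    proof (rule Lim_transform_eventually)
      show "(\<lambda>n. ((c n)\<^sup>2 / real (N n)) / (real (l n) / real (N n))) \<longlonglongrightarrow> a\<^sup>2 / (1 - x)"
        using x by (intro tendsto_divide c2 l) auto
      show "\<forall>\<^sub>F n in sequentially. ((c n)\<^sup>2 / real (N n)) / (real (l n) / real (N n)) = (c n)\<^sup>2 / real (l n)"
        using N0 by eventually_elim simp
    qed
    show "(\<lambda>n. c n / real (l n)) \<longlonglongrightarrow> 0"
    proof (rule Lim_transform_eventually)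
      have "(\<lambda>n. (c n / real (N n)) / (real (l n) / real (N n))) \<longlonglongrightarrow> 0 / (1 - x)"
        using x by (intro tendsto_divide cN l) auto
      then show "(\<lambda>n. (c n / real (N n)) / (real (l n) / real (N n))) \<longlonglongrightarrow> 0" by simp
      show "\<forall>\<^sub>F n in sequentially. (c n / real (N n)) / (real (l n) / real (N n)) = c n / real (l n)"
        using N0 by eventually_elim simp
    qed
    show "\<forall>\<^sub>F n in sequentially. 0 < c n \<and> 0 < real (l n)"
      using c0 mN by eventually_elim (simp add: l_def)
    show "(\<lambda>n. c n / real (N n)) \<longlonglongrightarrow> 0" by (rule cN)
    show "\<forall>\<^sub>F n in sequentially. 0 < c n \<and> 0 < real (N n)"
      using c0 N0 by eventually_elim simp
  qed
  \<comment> \<open>Every quantity is divided by the power of \<open>N\<close> at which it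
    converges, so that the limit can be taken factor by factor.\<close>
  define Q where "Q n = stirling_ratio (N n) / (stirling_ratio (m n) * stirling_ratio (l n)) *
      ((c n / sqrt (real (N n))) / (sqrt (real (m n) / real (N n)) * sqrt (real (l n) / real (N n)) *
       (c n / real (N n) + real (l n) / real (N n)))) * E n" for n
  have "Q \<longlonglongrightarrow> sqrt (2 * pi) / (sqrt (2 * pi) * sqrt (2 * pi)) *
      (a / (sqrt x * sqrt (1 - x) * (0 + (1 - x)))) * exp (- (a\<^sup>2 / (1 - x)) / 2 - (- a\<^sup>2 / 2))"
    unfolding Q_def using x
    by (intro tendsto_mult tendsto_divide tendsto_add tendsto_real_sqrt E c m l cN
        filterlim_compose[OF stirling N] filterlim_compose[OF stirling fm] filterlim_compose[OF stirling fl]) auto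
  also have "sqrt (2 * pi) / (sqrt (2 * pi) * sqrt (2 * pi)) *
      (a / (sqrt x * sqrt (1 - x) * (0 + (1 - x)))) * exp (- (a\<^sup>2 / (1 - x)) / 2 - (- a\<^sup>2 / 2)) = limit_density a x"
  proof -
    have e: "- (a\<^sup>2 / (1 - x)) / 2 - (- a\<^sup>2 / 2) = - (a\<^sup>2 / 2) * (x / (1 - x))"
      using x by (simp add: field_simps)
    have div_square: "r / (r * r) = 1 / r" if "r > 0" for r :: real using that by simp
    have q: "sqrt (2 * pi) / (sqrt (2 * pi) * sqrt (2 * pi)) = 1 / sqrt (2 * pi)" by (rule div_square) simp
    show ?thesis unfolding q e limit_density_def by (simp add: mult_ac)
  qed
  finally show ?thesis
  proof (rule Lim_transform_eventually)
    show "\<forall>\<^sub>F n in sequentially. Q n = real (N n) * size_weight (N n) (c n) (m n)"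
      using N0 m0 mN c0
    proof eventually_elim
      case (elim n)
      have ln0: "l n > 0" using elim by (simp add: l_def)
      have pe: "(1 + c n / real k) ^ k = exp (real k * ln (1 + c n / real k))" if "k > 0" for k
        using elim that by (simp add: exp_of_nat_mult add_pos_pos)
      have p1: "(1 + c n / real (l n)) ^ l n / (1 + c n / real (N n)) ^ N n = E n"
        using elim ln0 by (simp add: pe E_def flip: exp_diff)
      have p2: "real (N n) * (borel_weight (m n) * borel_weight (l n) / borel_weight (N n)) * (c n / (c n + real (l n)))
         = stirling_ratio (N n) / (stirling_ratio (m n) * stirling_ratio (l n)) *
      ((c n / sqrt (real (N n))) / (sqrt (real (m n) / real (N n)) * sqrt (real (l n) / real (N n)) *
       (c n / real (N n) + real (l n) / real (N n))))"
      proof -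
        have "M * M * (1 / (A * u) * (1 / (B * v)) / (1 / (D * M))) * (C / (C + L)) =
            D / (A * B) * ((C / M) / ((u / M) * (v / M) * (C / (M * M) + L / (M * M))))"
          if "M > 0" "u > 0" "v > 0" "A > 0" "B > 0" "C > 0" "D > 0" "L > 0" for M A B C D L u v :: real
        proof -
          have "C / (M * M) + L / (M * M) = (C + L) / (M * M)" by (simp add: add_divide_distrib)
          moreover have "C + L > 0" using that by simp
          ultimately show ?thesis using that by (simp add: field_simps)
        qed
        from this[of "sqrt (real (N n))" "sqrt (real (m n))" "sqrt (real (l n))" "stirling_ratio (m n)" "stirling_ratio (l n)"
            "c n" "stirling_ratio (N n)" "real (l n)"]
        show ?thesis using elim ln0 by (simp add: borel_weight_eq stirling_ratio_pos real_sqrt_divide)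
      qed
      have "real (N n) * size_weight (N n) (c n) (m n) =
          (real (N n) * (borel_weight (m n) * borel_weight (l n) / borel_weight (N n)) * (c n / (c n + real (l n)))) *
          ((1 + c n / real (l n)) ^ l n / (1 + c n / real (N n)) ^ N n)"
        unfolding size_weight_def l_def[symmetric] by (simp only: mult_ac)
      then show ?case unfolding p1 p2 Q_def by simp
    qed
  qed
qed

text \<open>One minus the value of \<open>prob_hit\<close> at \<open>t = 1 - x\<close>.\<close>

definition limit_cdf :: "real \<Rightarrow> real \<Rightarrow> real" where
  "limit_cdf a x = 1 - 2 * std_normal_cdf (- a * sqrt (x / (1 - x)))"

text \<open>Here the two sides of the theorem meet: the law from the reflection principle has the
  density found by counting forests.\<close>

lemma limit_cdf_has_derivative:
  assumes x: "0 < x" "x < 1"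
  shows "(limit_cdf a has_real_derivative limit_density a x) (at x)"
proof -
  define z where "z = (\<lambda>x::real. - a * sqrt (x / (1 - x)))"
  define z' where "z' = - a * (inverse (sqrt (x / (1 - x))) / 2 * ((1 * (1 - x) - x * (- 1)) / ((1 - x) * (1 - x))))"
  have "x / (1 - x) > 0" using x by simp
  then have z: "(z has_real_derivative z') (at x)"
    unfolding z_def z'_def using x by (auto intro!: derivative_eq_intros simp: divide_less_0_iff)
  have "((\<lambda>x. 1 - 2 * std_normal_cdf (z x)) has_real_derivative 0 - 2 * (std_normal_density (z x) * z')) (at x)"
    by (intro DERIV_diff DERIV_const DERIV_cmult DERIV_chain2[OF std_normal_cdf_has_derivative z])
  moreover have "0 - 2 * (std_normal_density (z x) * z') = limit_density a x"
  proof -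
    have "(z x)\<^sup>2 = a\<^sup>2 * (x / (1 - x))" using x by (simp add: z_def power_mult_distrib real_sqrt_pow2)
    then have e: "std_normal_density (z x) = 1 / sqrt (2 * pi) * exp (- (a\<^sup>2 / 2) * (x / (1 - x)))"
      by (simp add: std_normal_density_def)
    have "inverse (sqrt (x / (1 - x))) / ((1 - x) * (1 - x)) = 1 / (sqrt x * ((1 - x) * sqrt (1 - x)))"
    proof -
      have "inverse (u / v) / (v * v * (v * v)) = 1 / (u * (v * v * v))" if "u > 0" "v > 0" for u v :: real
        using that by (simp add: field_simps)
      from this[of "sqrt x" "sqrt (1 - x)"] show ?thesis using x by (simp add: real_sqrt_divide)
    qed
    moreover have "z' = - a / 2 * (inverse (sqrt (x / (1 - x))) / ((1 - x) * (1 - x)))"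
      by (simp add: z'_def)
    ultimately have "z' = - a / 2 * (1 / (sqrt x * ((1 - x) * sqrt (1 - x))))"
      by simp
    then show ?thesis by (simp add: e limit_density_def mult_ac)
  qed
  ultimately show ?thesis by (simp add: limit_cdf_def[abs_def] z_def)
qed

lemma limit_density_nonneg: "a > 0 \<Longrightarrow> 0 < x \<Longrightarrow> x < 1 \<Longrightarrow> limit_density a x \<ge> 0"
  by (simp add: limit_density_def)

lemma borel_measurable_limit_density[measurable]: "limit_density a \<in> borel_measurable borel"
  unfolding limit_density_def[abs_def] by measurable

lemma nn_integral_limit_density:
  assumes "a > 0" "0 < u" "u < v" "v < 1"
  shows "(\<integral>\<^sup>+x. ennreal (limit_density a x) * indicator {u..v} x \<partial>lborel) = ennreal (limit_cdf a v - limit_cdf a u)"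
proof (rule nn_integral_FTC_Icc)
  fix x assume "x \<in> {u..v}"
  then have x: "0 < x" "x < 1" using assms by auto
  show "(limit_cdf a has_real_derivative limit_density a x) (at x)"
    by (rule limit_cdf_has_derivative[OF x])
  show "0 \<le> limit_density a x" using limit_density_nonneg x assms by blast
qed (use assms in auto)

lemma continuous_limit_cdf:
  assumes "0 \<le> x" "x < 1"
  shows "isCont (limit_cdf a) x"
  unfolding limit_cdf_def using assms
  by (intro continuous_intros isCont_o2[OF _ continuous_std_normal_cdf]) auto

lemma limit_cdf_0: "limit_cdf a 0 = 0"
  by (simp add: limit_cdf_def std_normal_cdf_0)

lemma limit_cdf_tendsto_1:
  assumes "a > 0"
  shows "(limit_cdf a \<longlongrightarrow> 1) (at_left 1)"
proof -
  interpret real_distribution std_normal_distribution by (rule real_dist_normal_dist)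
  have "filterlim (\<lambda>x::real. - a * sqrt (x / (1 - x))) at_bot (at_left 1)"
    using assms by real_asymp
  then have "((\<lambda>x. std_normal_cdf (- a * sqrt (x / (1 - x)))) \<longlongrightarrow> 0) (at_left 1)"
    by (rule filterlim_compose[OF cdf_lim_at_bot])
  then have "((\<lambda>x. 1 - 2 * std_normal_cdf (- a * sqrt (x / (1 - x)))) \<longlongrightarrow> 1 - 2 * 0) (at_left 1)"
    by (intro tendsto_intros)
  then show ?thesis by (simp add: limit_cdf_def[abs_def])
qed

text \<open>Read as step functions on a grid of mesh \<open>1 / K n\<close>, point masses with a local limit
  satisfy Fatou's lemma; only lower bounds are needed, because both laws have total mass one.\<close>

lemma sum_point_masses_ge:
  fixes P :: "nat \<Rightarrow> nat \<Rightarrow> real" and K :: "nat \<Rightarrow> real"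
  assumes K: "\<And>n. K n > 0" and P: "\<And>n m. P n m \<ge> 0"
    and lim: "\<And>x. u \<le> x \<Longrightarrow> x \<le> v \<Longrightarrow> (\<lambda>n. K n * P n (nat \<lfloor>K n * x\<rfloor>)) \<longlonglongrightarrow> g x"
    and u: "0 \<le> u"
    and J: "(\<integral>\<^sup>+x. ennreal (g x) * indicator {u..v} x \<partial>lborel) = ennreal J" and \<epsilon>: "\<epsilon> > 0"
  shows "eventually (\<lambda>n. (\<Sum>m\<in>{nat \<lfloor>K n * u\<rfloor>..nat \<lfloor>K n * v\<rfloor>}. P n m) > J - \<epsilon>) sequentially"
\<comment> \<open>\<open>ennreal\<close> maps all negative numbers to 0, so the strict inequality
  used below needs a positive \<open>J\<close>.\<close>
proof (cases "J \<le> 0")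
  case True
  have "(\<Sum>m\<in>{nat \<lfloor>K n * u\<rfloor>..nat \<lfloor>K n * v\<rfloor>}. P n m) \<ge> 0" for n
    using P by (intro sum_nonneg) auto
  then show ?thesis using True \<epsilon> by (intro always_eventually allI) (smt (verit))
next
  case False
  define f where "f n x = ennreal (K n * P n (nat \<lfloor>K n * x\<rfloor>)) * indicator {u..v} x" for n x
  define S where "S n = {nat \<lfloor>K n * u\<rfloor>..nat \<lfloor>K n * v\<rfloor>}" for n
  have meas[measurable]: "f n \<in> borel_measurable borel" for n
    unfolding f_def by measurable
  have bound: "(\<integral>\<^sup>+x. f n x \<partial>lborel) \<le> ennreal (\<Sum>m\<in>S n. P n m)" for n
  proof -
    \<comment> \<open>The cell of \<open>m\<close> has length \<open>1 / K n\<close>, so its term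
      integrates to \<open>P n m\<close>. Closed cells overlap at endpoints, which an upper bound
      tolerates.\<close>
    have "f n x \<le> (\<Sum>m\<in>S n. ennreal (K n * P n m) * indicator {real m / K n..(real m + 1) / K n} x)" for x
    proof (cases "x \<in> {u..v}")
      case True
      let ?m = "nat \<lfloor>K n * x\<rfloor>"
      have Kx: "K n * u \<le> K n * x" "K n * x \<le> K n * v" "0 \<le> K n * x"
        using True K[of n] u by auto
      have m: "?m \<in> S n"
        unfolding S_def using Kx by (auto intro!: nat_mono floor_mono)
      have "real ?m \<le> K n * x" "K n * x \<le> real ?m + 1"
        using Kx by linarith+
      then have "x \<in> {real ?m / K n..(real ?m + 1) / K n}"
        using K[of n] by (simp add: field_simps)
      then have "f n x = ennreal (K n * P n ?m) * indicator {real ?m / K n..(real ?m + 1) / K n} x"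
        using True by (simp add: f_def)
      also have "\<dots> \<le> (\<Sum>m\<in>S n. ennreal (K n * P n m) * indicator {real m / K n..(real m + 1) / K n} x)"
        using m by (intro member_le_sum) (auto simp: S_def)
      finally show ?thesis .
    qed (simp add: f_def)
    then have "(\<integral>\<^sup>+x. f n x \<partial>lborel) \<le>
        (\<integral>\<^sup>+x. (\<Sum>m\<in>S n. ennreal (K n * P n m) * indicator {real m / K n..(real m + 1) / K n} x) \<partial>lborel)"
      by (intro nn_integral_mono)
    also have "\<dots> = (\<Sum>m\<in>S n. ennreal (K n * P n m) * emeasure lborel {real m / K n..(real m + 1) / K n})"
      by (subst nn_integral_sum) (auto simp: nn_integral_cmult_indicator)
    also have "\<dots> = (\<Sum>m\<in>S n. ennreal (P n m))"
    proof (intro sum.cong refl)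
      fix m
      have "(real m + 1) / K n - real m / K n = 1 / K n" by (simp add: add_divide_distrib)
      then have "emeasure lborel {real m / K n..(real m + 1) / K n} = ennreal (1 / K n)"
        using K[of n] by (subst emeasure_lborel_Icc) (auto simp: divide_right_mono)
      then show "ennreal (K n * P n m) * emeasure lborel {real m / K n..(real m + 1) / K n} = ennreal (P n m)"
        using K[of n] P[of n m] by (simp flip: ennreal_mult)
    qed
    also have "\<dots> = ennreal (\<Sum>m\<in>S n. P n m)"
      using P by (intro sum_ennreal) auto
    finally show ?thesis .
  qed
  have "(\<lambda>n. f n x) \<longlonglongrightarrow> ennreal (g x) * indicator {u..v} x" for x
    using lim[of x] by (cases "x \<in> {u..v}") (auto simp: f_def intro!: tendsto_ennrealI)
  then have "(\<integral>\<^sup>+x. ennreal (g x) * indicator {u..v} x \<partial>lborel) = (\<integral>\<^sup>+x. liminf (\<lambda>n. f n x) \<partial>lborel)"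
    by (intro nn_integral_cong) (metis lim_imp_Liminf trivial_limit_sequentially)
  also have "\<dots> \<le> liminf (\<lambda>n. \<integral>\<^sup>+x. f n x \<partial>lborel)"
    by (rule nn_integral_liminf) simp
  also have "\<dots> \<le> liminf (\<lambda>n. ennreal (\<Sum>m\<in>S n. P n m))"
    using bound by (intro Liminf_mono) auto
  finally have "ennreal J \<le> liminf (\<lambda>n. ennreal (\<Sum>m\<in>S n. P n m))" using J by simp
  moreover have "ennreal (J - \<epsilon>) < ennreal J" using False \<epsilon> by (simp add: ennreal_less_iff ennreal_lessI)
  ultimately have "eventually (\<lambda>n. ennreal (J - \<epsilon>) < ennreal (\<Sum>m\<in>S n. P n m)) sequentially"
    by (simp add: le_Liminf_iff)
  then show ?thesis
  proof eventually_elim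
    case (elim n)
    have "(\<Sum>m\<in>S n. P n m) \<ge> 0" using P by (intro sum_nonneg) auto
    then show ?case
      using elim unfolding S_def[symmetric] by (cases "J - \<epsilon> \<ge> 0") (auto simp: ennreal_less_iff)
  qed
qed

lemma nat_floor_ratio_tendsto:
  fixes K :: "nat \<Rightarrow> real" and N :: "nat \<Rightarrow> nat"
  assumes K: "filterlim K at_top sequentially" and N: "(\<lambda>n. real (N n) / K n) \<longlonglongrightarrow> 1" and x: "x > 0"
  shows "(\<lambda>n. real (nat \<lfloor>K n * x\<rfloor>) / real (N n)) \<longlonglongrightarrow> x"
proof -
  have K0: "eventually (\<lambda>n. K n > 0) sequentially"
    using K by (rule filterlim_at_top_dense[THEN iffD1, rule_format])
  have inv: "(\<lambda>n. 1 / K n) \<longlonglongrightarrow> 0" by (rule real_tendsto_divide_at_top[OF tendsto_const K])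
  have "(\<lambda>n. real (nat \<lfloor>K n * x\<rfloor>) / K n) \<longlonglongrightarrow> x"
  proof (rule tendsto_sandwich)
    show "\<forall>\<^sub>F n in sequentially. x - 1 / K n \<le> real (nat \<lfloor>K n * x\<rfloor>) / K n"
      using K0
    proof eventually_elim
      case (elim n)
      have "K n * x - 1 \<le> real (nat \<lfloor>K n * x\<rfloor>)" using elim x by linarith
      then have "(K n * x - 1) / K n \<le> real (nat \<lfloor>K n * x\<rfloor>) / K n" using elim by (intro divide_right_mono) auto
      then show ?case using elim by (simp add: diff_divide_distrib)
    qed
    show "\<forall>\<^sub>F n in sequentially. real (nat \<lfloor>K n * x\<rfloor>) / K n \<le> x"
      using K0
    proof eventually_elim
      case (elim n)
      have "real (nat \<lfloor>K n * x\<rfloor>) \<le> K n * x" using elim x by simp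
      then show ?case using elim by (simp add: divide_le_eq mult.commute)
    qed
    show "(\<lambda>n. x - 1 / K n) \<longlonglongrightarrow> x" using tendsto_diff[OF tendsto_const[of x] inv] by simp
  qed simp
  then have "(\<lambda>n. (real (nat \<lfloor>K n * x\<rfloor>) / K n) / (real (N n) / K n)) \<longlonglongrightarrow> x / 1"
    by (intro tendsto_divide N) auto
  then have "(\<lambda>n. (real (nat \<lfloor>K n * x\<rfloor>) / K n) / (real (N n) / K n)) \<longlonglongrightarrow> x" by simp
  moreover have "eventually (\<lambda>n. (real (nat \<lfloor>K n * x\<rfloor>) / K n) / (real (N n) / K n) = real (nat \<lfloor>K n * x\<rfloor>) / real (N n)) sequentially"
    using K0 by eventually_elim simp
  ultimately show ?thesis by (rule Lim_transform_eventually)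
qed

text \<open>Here \<open>K n\<close> is the number of targets divided by the fibre size \<open>s\<close>.\<close>

lemma alive_size_prob_sum_ge:
  fixes N d :: "nat \<Rightarrow> nat" and s :: nat
  assumes s: "s > 0" and N: "filterlim N at_top sequentially" and a: "a > 0"
    and c: "(\<lambda>n. real (d n) / real s / sqrt (real (N n))) \<longlonglongrightarrow> a"
    and Nd: "\<And>n. d n + N n * s > 0"
    and uv: "0 < u" "u < v" "v < 1" and \<epsilon>: "\<epsilon> > 0"
  defines "K \<equiv> \<lambda>n. real (d n + N n * s) / real s"
  shows "eventually (\<lambda>n. (\<Sum>m\<in>{nat \<lfloor>K n * u\<rfloor>..nat \<lfloor>K n * v\<rfloor>}. alive_size_prob (N n) s (d n) m) >
    limit_cdf a v - limit_cdf a u - \<epsilon>) sequentially"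
proof (rule sum_point_masses_ge[where g = "limit_density a"])
  have K0: "K n > 0" for n
  proof -
    have "real (d n + N n * s) > 0" using Nd[of n] by (simp only: of_nat_0_less_iff)
    then show ?thesis using s by (simp add: K_def)
  qed
  then show "K n > 0" for n .
  show "alive_size_prob (N n) s (d n) m \<ge> 0" for n m by (simp add: alive_size_prob_def)
  have K_eq: "K n = real (N n) + real (d n) / real s" for n
    using s by (simp add: K_def add_divide_distrib)
  have rN: "filterlim (\<lambda>n. real (N n)) at_top sequentially"
    by (rule filterlim_compose[OF filterlim_real_sequentially N])
  have K_top: "filterlim K at_top sequentially"
    by (rule filterlim_at_top_mono[OF rN]) (simp add: K_eq)
  have N0: "eventually (\<lambda>n. N n > 0) sequentially"
    by (rule eventually_compose_filterlim[OF eventually_gt_at_top[of 0] N])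
  have cN: "(\<lambda>n. real (d n) / real s / real (N n)) \<longlonglongrightarrow> 0"
  proof (rule Lim_transform_eventually)
    have "filterlim (\<lambda>n. sqrt (real (N n))) at_top sequentially"
      by (rule filterlim_compose[OF sqrt_at_top rN])
    then show "(\<lambda>n. (real (d n) / real s / sqrt (real (N n))) / sqrt (real (N n))) \<longlonglongrightarrow> 0"
      by (rule real_tendsto_divide_at_top[OF c])
  qed simp
  have KN: "(\<lambda>n. K n / real (N n)) \<longlonglongrightarrow> 1"
  proof (rule Lim_transform_eventually)
    show "(\<lambda>n. 1 + real (d n) / real s / real (N n)) \<longlonglongrightarrow> 1"
      using tendsto_add[OF tendsto_const[of 1] cN] by simp
    show "\<forall>\<^sub>F n in sequentially. 1 + real (d n) / real s / real (N n) = K n / real (N n)"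
      using N0 by eventually_elim (simp add: K_eq add_divide_distrib)
  qed
  have NK: "(\<lambda>n. real (N n) / K n) \<longlonglongrightarrow> 1"
    using tendsto_inverse[OF KN] by simp
  show "(\<lambda>n. K n * alive_size_prob (N n) s (d n) (nat \<lfloor>K n * x\<rfloor>)) \<longlonglongrightarrow> limit_density a x" if x: "u \<le> x" "x \<le> v" for x
  proof -
    have x01: "0 < x" "x < 1" using x uv by auto
    note m = nat_floor_ratio_tendsto[OF K_top NK x01(1)]
    have "(\<lambda>n. K n / real (N n) * (real (N n) * size_weight (N n) (real (d n) / real s) (nat \<lfloor>K n * x\<rfloor>))) \<longlonglongrightarrow> 1 * limit_density a x"
      by (intro tendsto_mult KN local_limit[OF N c a m x01])
    then have "(\<lambda>n. K n / real (N n) * (real (N n) * size_weight (N n) (real (d n) / real s) (nat \<lfloor>K n * x\<rfloor>))) \<longlonglongrightarrow> limit_density a x"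
      by simp
    moreover have "\<forall>\<^sub>F n in sequentially. K n / real (N n) * (real (N n) * size_weight (N n) (real (d n) / real s) (nat \<lfloor>K n * x\<rfloor>))
        = K n * alive_size_prob (N n) s (d n) (nat \<lfloor>K n * x\<rfloor>)"
      using N0 order_tendstoD(2)[OF m x01(2)]
    proof eventually_elim
      case (elim n)
      then have "nat \<lfloor>K n * x\<rfloor> < N n" by (simp add: divide_less_eq)
      then show ?case using elim s by (simp add: alive_size_prob_eq)
    qed
    ultimately show ?thesis by (rule Lim_transform_eventually)
  qed
  show "(\<integral>\<^sup>+x. ennreal (limit_density a x) * indicator {u..v} x \<partial>lborel) = ennreal (limit_cdf a v - limit_cdf a u)"
    using a uv by (intro nn_integral_limit_density) auto
qed (use uv \<epsilon> in auto)

section \<open>Few dead targets\<close>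

lemma borel_weight_pos: "borel_weight n > 0"
  by (cases "n = 0") (auto simp: borel_weight_def)

text \<open>A positive sequence with positive limit is bounded, and so is its inverse. The shift to
  \<open>Suc n\<close> under the root includes \<open>n = 0\<close>, where the weight is 1.\<close>

lemma borel_weight_bounds:
  obtains A B where "A > 0" "B > 0" "\<And>n. borel_weight n \<le> A / sqrt (real (Suc n))"
    "\<And>n. 1 / borel_weight n \<le> B * sqrt (real (Suc n))"
proof -
  define b where "b n = borel_weight n * sqrt (real (Suc n))" for n
  have b0: "b n > 0" for n by (simp add: b_def borel_weight_pos)
  have lim: "b \<longlonglongrightarrow> 1 / sqrt (2 * pi)"
  proof (rule Lim_transform_eventually)
    have "(\<lambda>n::nat. sqrt (real (Suc n) / real n)) \<longlonglongrightarrow> sqrt 1"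
      by (intro tendsto_real_sqrt) real_asymp
    then have "(\<lambda>n. 1 / stirling_ratio n * sqrt (real (Suc n) / real n)) \<longlonglongrightarrow> 1 / sqrt (2 * pi) * sqrt 1"
      by (intro tendsto_mult tendsto_divide tendsto_const stirling) auto
    then show "(\<lambda>n. 1 / stirling_ratio n * sqrt (real (Suc n) / real n)) \<longlonglongrightarrow> 1 / sqrt (2 * pi)" by simp
    show "\<forall>\<^sub>F n in sequentially. 1 / stirling_ratio n * sqrt (real (Suc n) / real n) = b n"
      using eventually_gt_at_top[of 0]
      by eventually_elim (simp add: b_def borel_weight_eq real_sqrt_divide)
  qed
  then have "Bseq b" by (metis convergentI convergent_imp_Bseq)
  then obtain A where A: "A > 0" "\<And>n. \<bar>b n\<bar> \<le> A" by (auto elim!: BseqE)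
  have "(\<lambda>n. inverse (b n)) \<longlonglongrightarrow> inverse (1 / sqrt (2 * pi))"
    by (intro tendsto_inverse lim) simp
  then have "Bseq (\<lambda>n. inverse (b n))" by (metis convergentI convergent_imp_Bseq)
  then obtain B where B: "B > 0" "\<And>n. \<bar>inverse (b n)\<bar> \<le> B" by (auto elim!: BseqE)
  show thesis
  proof (rule that[OF A(1) B(1)])
    fix n
    show "borel_weight n \<le> A / sqrt (real (Suc n))"
      using A(2)[of n] b0[of n] by (simp add: b_def pos_le_divide_eq)
    have "1 / borel_weight n = inverse (b n) * sqrt (real (Suc n))"
      by (simp add: b_def divide_inverse)
    also have "\<dots> \<le> B * sqrt (real (Suc n))"
      using B(2)[of n] b0[of n] by (intro mult_right_mono) auto
    finally show "1 / borel_weight n \<le> B * sqrt (real (Suc n))" .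
  qed
qed

text \<open>Shows that the quotient of powers in \<open>size_weight\<close> is at most 1.\<close>

lemma one_plus_div_power_mono:
  fixes c :: real
  assumes c: "c \<ge> 0" and l: "0 < l" "l \<le> N"
  shows "(1 + c / real l) ^ l \<le> (1 + c / real N) ^ N"
  using l(2,1)
proof (induction rule: dec_induct)
  case (step n)
  then have n: "n > 0" by simp
  define p q where "p = 1 + c / real n" "q = 1 + c / real (Suc n)"
  have p: "p > 0" and q: "q > 0" using c n by (auto simp: p_q_def intro!: add_pos_nonneg)
  \<comment> \<open>Bernoulli's inequality for the quotient of consecutive bases; its left side is 1
    / p because (n + 1) * (q - p) = 1 - p.\<close>
  have "1 + real (Suc n) * (q / p - 1) \<le> (1 + (q / p - 1)) ^ Suc n"
    using p q by (intro Bernoulli_inequality) auto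
  moreover have "1 + real (Suc n) * (q / p - 1) = 1 / p"
  proof -
    have "real (Suc n) * (q - p) = 1 - p"
    proof -
      have "real (Suc n) * (c / real (Suc n)) = c" by simp
      moreover have "real (Suc n) * (c / real n) = c + c / real n" using n by (simp add: field_simps)
      ultimately show ?thesis unfolding p_q_def by (simp only: add_diff_cancel_left right_diff_distrib)
    qed
    moreover have "1 + real (Suc n) * (q / p - 1) = (p + real (Suc n) * (q - p)) / p"
      using p by (simp add: field_simps)
    ultimately show ?thesis by simp
  qed
  ultimately have "1 / p \<le> (q / p) ^ Suc n" by simp
  then have "1 / p * p ^ Suc n \<le> (q / p) ^ Suc n * p ^ Suc n"
    using p by (intro mult_right_mono) auto
  then have "p ^ n \<le> q ^ Suc n" using p by (simp add: power_divide)
  then show ?case using step.IH n step.prems by (simp add: p_q_def)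
qed simp

lemma sum_inverse_sqrt_le: "(\<Sum>m<N. 1 / sqrt (real (Suc m))) \<le> 2 * sqrt (real N)"
proof (induction N)
  case (Suc N)
  have "1 / sqrt (real (Suc N)) \<le> 2 * (sqrt (real (Suc N)) - sqrt (real N))"
  proof -
    define u v where "u = sqrt (real (Suc N))" "v = sqrt (real N)"
    have uv: "u > 0" "v \<ge> 0" "v \<le> u" "u * u - v * v = 1" by (auto simp: u_v_def)
    have "(u - v) * (u + v) = 1" using uv(4) by (simp add: algebra_simps)
    moreover have "(u - v) * (u + v) \<le> (u - v) * (2 * u)" using uv by (intro mult_left_mono) auto
    ultimately have "1 \<le> (2 * (u - v)) * u" by (simp add: mult_ac)
    then have "1 / u \<le> 2 * (u - v)" using uv(1) by (simp add: pos_divide_le_eq)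
    then show ?thesis by (simp add: u_v_def)
  qed
  then show ?case using Suc by simp
qed simp

text \<open>When at least \<open>\<epsilon> * N\<close> points die, the probability of
  \<open>m\<close> survivors is at most a constant times c / N / sqrt (m + 1), with c = d / s.
  Summing over \<open>m\<close> costs a factor of order sqrt N and leaves c / sqrt N, which tends to
  0.\<close>

lemma alive_size_prob_sum_small:
  fixes N d :: "nat \<Rightarrow> nat" and s :: nat
  assumes s: "s > 0" and N: "filterlim N at_top sequentially"
    and c: "(\<lambda>n. real (d n) / real s / sqrt (real (N n))) \<longlonglongrightarrow> 0"
    and \<epsilon>: "0 < \<epsilon>" "\<epsilon> \<le> 1"
  shows "(\<lambda>n. \<Sum>m\<in>{m. real m \<le> (1 - \<epsilon>) * real (N n)}. alive_size_prob (N n) s (d n) m) \<longlonglongrightarrow> 0"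
proof -
  obtain A B where AB: "A > 0" "B > 0" "\<And>n. borel_weight n \<le> A / sqrt (real (Suc n))"
    "\<And>n. 1 / borel_weight n \<le> B * sqrt (real (Suc n))" using borel_weight_bounds by blast
  \<comment> \<open>The three Borel weights contribute \<open>A * A * B\<close>, comparing
    \<open>N\<close> with \<open>N - m\<close> under the root contributes
    \<open>sqrt \<epsilon>\<close>, and \<open>c / (c + N - m)\<close> contributes
    \<open>\<epsilon>\<close>.\<close>
  define C where "C = A * A * B / (\<epsilon> * sqrt \<epsilon>)"
  define cc where "cc n = real (d n) / real s" for n
  have cc: "cc n \<ge> 0" for n by (simp add: cc_def)
  have N0: "eventually (\<lambda>n. N n > 0) sequentially"
    by (rule eventually_compose_filterlim[OF eventually_gt_at_top[of 0] N])
  have fin: "{m. real m \<le> (1 - \<epsilon>) * real k} \<subseteq> {..<k}" if "k > 0" for k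
  proof
    fix m assume "m \<in> {m. real m \<le> (1 - \<epsilon>) * real k}"
    then have "real m \<le> real k - \<epsilon> * real k" by (simp add: algebra_simps)
    moreover have "\<epsilon> * real k > 0" using \<epsilon> that by simp
    ultimately show "m \<in> {..<k}" by simp
  qed
  have bound: "(\<Sum>m\<in>{m. real m \<le> (1 - \<epsilon>) * real (N n)}. alive_size_prob (N n) s (d n) m) \<le> 2 * C * (cc n / sqrt (real (N n)))"
    if N0: "N n > 0" for n
  proof -
    have "alive_size_prob (N n) s (d n) m \<le> C * cc n / real (N n) * (1 / sqrt (real (Suc m)))"
      if m: "real m \<le> (1 - \<epsilon>) * real (N n)" for m
    proof -
      define l where "l = N n - m"
      have mN: "m < N n" using fin[OF N0] m by auto
      have l: "l > 0" "l \<le> N n" "real l = real (N n) - real m" using mN by (auto simp: l_def)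
      have l\<epsilon>: "real l \<ge> \<epsilon> * real (N n)" using m l(3) by (simp add: algebra_simps)
      have pos: "\<epsilon> * real (N n) > 0" using \<epsilon> N0 by simp
      have 1: "(1 + cc n / real l) ^ l / (1 + cc n / real (N n)) ^ N n \<le> 1"
        using one_plus_div_power_mono[OF cc l(1,2), of n] cc[of n] by (intro divide_le_eq_1[THEN iffD2]) (auto intro!: zero_less_power add_pos_nonneg)
      have cl: "0 < cc n + real l" using cc[of n] l(1) by (simp add: add_nonneg_pos)
      have 2: "cc n / (cc n + real l) \<le> cc n / (\<epsilon> * real (N n))"
        using cc[of n] l\<epsilon> \<epsilon> N0 by (intro divide_left_mono mult_pos_pos cl) auto
      have 3: "sqrt (real (Suc (N n))) / sqrt (real (Suc l)) \<le> 1 / sqrt \<epsilon>"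
      proof -
        have "\<epsilon> * real (Suc (N n)) \<le> real (Suc l)" using l\<epsilon> \<epsilon> by (simp add: algebra_simps)
        then have "real (Suc (N n)) / real (Suc l) \<le> 1 / \<epsilon>"
          using \<epsilon> by (simp add: divide_simps mult.commute)
        then have "sqrt (real (Suc (N n)) / real (Suc l)) \<le> sqrt (1 / \<epsilon>)" by (rule real_sqrt_le_mono)
        then show ?thesis by (simp only: real_sqrt_divide real_sqrt_one)
      qed
      have 4: "borel_weight m * borel_weight l / borel_weight (N n) \<le> A * A * B / sqrt \<epsilon> * (1 / sqrt (real (Suc m)))"
      proof -
        have "borel_weight m * borel_weight l / borel_weight (N n) = borel_weight m * borel_weight l * (1 / borel_weight (N n))"
          by simp
        also have "\<dots> \<le> (A / sqrt (real (Suc m))) * (A / sqrt (real (Suc l))) * (B * sqrt (real (Suc (N n))))"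
          using AB(1,2) by (intro mult_mono AB(3,4) mult_nonneg_nonneg) (auto intro: less_imp_le[OF borel_weight_pos])
        also have "\<dots> = A * A * B * (1 / sqrt (real (Suc m))) * (sqrt (real (Suc (N n))) / sqrt (real (Suc l)))"
          by simp
        also have "\<dots> \<le> A * A * B * (1 / sqrt (real (Suc m))) * (1 / sqrt \<epsilon>)"
          using AB(1,2) by (intro mult_left_mono 3) auto
        finally show ?thesis by (simp add: mult_ac)
      qed
      have "alive_size_prob (N n) s (d n) m = borel_weight m * borel_weight l / borel_weight (N n) *
          ((1 + cc n / real l) ^ l / (1 + cc n / real (N n)) ^ N n) * (cc n / (cc n + real l))"
        unfolding alive_size_prob_eq[OF s mN] size_weight_def cc_def l_def ..
      also have "\<dots> \<le> (A * A * B / sqrt \<epsilon> * (1 / sqrt (real (Suc m)))) * 1 * (cc n / (\<epsilon> * real (N n)))"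
        using AB(1,2) \<epsilon> cc[of n]
        by (intro mult_mono 1 2 4 mult_nonneg_nonneg divide_nonneg_nonneg zero_le_power) (auto intro: less_imp_le[OF borel_weight_pos])
      also have "\<dots> = C * cc n / real (N n) * (1 / sqrt (real (Suc m)))"
        by (simp add: C_def)
      finally show ?thesis .
    qed
    then have "(\<Sum>m\<in>{m. real m \<le> (1 - \<epsilon>) * real (N n)}. alive_size_prob (N n) s (d n) m)
        \<le> (\<Sum>m\<in>{m. real m \<le> (1 - \<epsilon>) * real (N n)}. C * cc n / real (N n) * (1 / sqrt (real (Suc m))))"
      by (intro sum_mono) auto
    also have "\<dots> \<le> (\<Sum>m<N n. C * cc n / real (N n) * (1 / sqrt (real (Suc m))))"
      using fin[OF N0] AB(1,2) cc[of n] \<epsilon> by (intro sum_mono2) (auto simp: C_def)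
    also have "\<dots> = C * cc n / real (N n) * (\<Sum>m<N n. 1 / sqrt (real (Suc m)))"
      by (simp add: sum_distrib_left)
    also have "\<dots> \<le> C * cc n / real (N n) * (2 * sqrt (real (N n)))"
      using AB(1,2) cc[of n] \<epsilon> by (intro mult_left_mono sum_inverse_sqrt_le) (auto simp: C_def)
    also have "\<dots> = 2 * C * (cc n / sqrt (real (N n)))"
    proof -
      have "x / (q * q) * (2 * q) = 2 * (x / q)" if "q > 0" for x q :: real using that by simp
      from this[of "sqrt (real (N n))" "C * cc n"] N0 show ?thesis by simp
    qed
    finally show ?thesis .
  qed
  show ?thesis
  proof (rule tendsto_sandwich)
    show "\<forall>\<^sub>F n in sequentially. 0 \<le> (\<Sum>m\<in>{m. real m \<le> (1 - \<epsilon>) * real (N n)}. alive_size_prob (N n) s (d n) m)"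
      by (intro always_eventually allI sum_nonneg) (simp add: alive_size_prob_def)
    show "\<forall>\<^sub>F n in sequentially. (\<Sum>m\<in>{m. real m \<le> (1 - \<epsilon>) * real (N n)}. alive_size_prob (N n) s (d n) m)
        \<le> 2 * C * (cc n / sqrt (real (N n)))"
      using N0 by eventually_elim (rule bound)
    have "(\<lambda>n. 2 * C * (cc n / sqrt (real (N n)))) \<longlonglongrightarrow> 2 * C * 0"
      unfolding cc_def by (intro tendsto_mult_left c)
    then show "(\<lambda>n. 2 * C * (cc n / sqrt (real (N n)))) \<longlonglongrightarrow> 0" by simp
  qed simp
qed

section \<open>Reduction of the automaton to a random map\<close>

definition shift :: "int \<Rightarrow> (int \<Rightarrow> nat) \<Rightarrow> (int \<Rightarrow> nat)" where
  "shift k \<xi> = (\<lambda>x. \<xi> (x + k))"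

definition periodic_configs :: "nat \<Rightarrow> nat \<Rightarrow> (int \<Rightarrow> nat) set" where
  "periodic_configs \<sigma> n = {\<xi> \<in> configurations n. \<forall>x. \<xi> (x + int \<sigma>) = \<xi> x}"

definition minimal_configs :: "nat \<Rightarrow> nat \<Rightarrow> (int \<Rightarrow> nat) set" where
  "minimal_configs \<sigma> n = {\<xi> \<in> configurations n. has_minimal_period \<xi> \<sigma>}"

text \<open>The number of dead targets.\<close>

abbreviation nonminimal_count :: "nat \<Rightarrow> nat \<Rightarrow> nat" where
  "nonminimal_count \<sigma> n \<equiv> card (periodic_configs \<sigma> n - minimal_configs \<sigma> n)"

lemma translation_rel_iff: "(\<xi>, \<zeta>) \<in> translation_rel \<longleftrightarrow> (\<exists>k. \<zeta> = shift k \<xi>)"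
  by (auto simp: translation_rel_def shift_def fun_eq_iff)

lemma shift_shift: "shift j (shift k \<xi>) = shift (j + k) \<xi>"
  by (simp add: shift_def add.assoc)

lemma shift_0: "shift 0 \<xi> = \<xi>"
  by (simp add: shift_def)

section \<open>Periods of configurations\<close>

lemma period_multiple:
  fixes \<xi> :: "int \<Rightarrow> 'a"
  assumes "\<And>x. \<xi> (x + p) = \<xi> x"
  shows "\<xi> (x + k * p) = \<xi> x"
proof -
  have nat: "\<xi> (x + int j * p) = \<xi> x" for x j
  proof (induction j)
    case (Suc j)
    have "\<xi> (x + int (Suc j) * p) = \<xi> ((x + int j * p) + p)" by (simp add: algebra_simps)
    then show ?case using assms Suc by simp
  qed simp
  show ?thesis
  proof (cases "k \<ge> 0")
    case True
    then show ?thesis using nat[of x "nat k"] by simp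
  next
    case False
    then show ?thesis using nat[of "x + k * p" "nat (- k)"] by simp
  qed
qed

lemma period_mod:
  fixes \<xi> :: "int \<Rightarrow> 'a"
  assumes "\<And>x. \<xi> (x + p) = \<xi> x"
  shows "\<xi> (x mod p) = \<xi> x"
  using period_multiple[of \<xi> p, OF assms, of "x mod p" "x div p"] by simp

lemma period_gcd:
  fixes \<xi> :: "int \<Rightarrow> 'a"
  assumes "\<And>x. \<xi> (x + p) = \<xi> x" "\<And>x. \<xi> (x + q) = \<xi> x"
  shows "\<xi> (x + gcd p q) = \<xi> x"
proof -
  obtain u v where "u * p + v * q = gcd p q" using bezout_int by blast
  then have "\<xi> (x + gcd p q) = \<xi> ((x + u * p) + v * q)" by (simp add: add.assoc)
  then show ?thesis using period_multiple[of \<xi> p, OF assms(1)] period_multiple[of \<xi> q, OF assms(2)] by simp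
qed

lemma nth_concat_replicate:
  "i < q * length u \<Longrightarrow> concat (replicate q u) ! i = u ! (i mod length u)"
proof (induction q arbitrary: i)
  case (Suc q)
  show ?case
  proof (cases "i < length u")
    case False
    then have "i - length u < q * length u" using Suc.prems by simp
    then have "concat (replicate q u) ! (i - length u) = u ! ((i - length u) mod length u)" by (rule Suc.IH)
    then show ?thesis using False by (simp add: nth_append le_mod_geq)
  qed (simp add: nth_append)
qed simp

lemma repetition_word:
  assumes "\<sigma> > 0" "\<And>x. \<xi> (x + int \<sigma>) = \<xi> x"
  shows "repetition (map (\<lambda>i. \<xi> (int i)) [0..<\<sigma>]) = \<xi>"
proof
  fix x
  have "x mod int \<sigma> \<ge> 0" "x mod int \<sigma> < int \<sigma>" using assms(1) by auto
  then show "repetition (map (\<lambda>i. \<xi> (int i)) [0..<\<sigma>]) x = \<xi> x"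
    using period_mod[of \<xi> "int \<sigma>" x] assms(2) by (simp add: repetition_def nat_less_iff)
qed

lemma repetition_periodic: "repetition w (x + int (length w)) = repetition w x"
  by (simp add: repetition_def)

lemma repetition_nth: "i < length w \<Longrightarrow> repetition w (int i) = w ! i"
  by (simp add: repetition_def)

lemma bij_betw_repetition:
  assumes "\<sigma> > 0"
  shows "bij_betw repetition (words \<sigma> n) (periodic_configs \<sigma> n)"
proof (rule bij_betw_byWitness[where f' = "\<lambda>\<xi>. map (\<lambda>i. \<xi> (int i)) [0..<\<sigma>]"])
  show "\<forall>w\<in>words \<sigma> n. map (\<lambda>i. repetition w (int i)) [0..<\<sigma>] = w"
    by (auto simp: words_def repetition_nth intro!: nth_equalityI)
  show "\<forall>\<xi>\<in>periodic_configs \<sigma> n. repetition (map (\<lambda>i. \<xi> (int i)) [0..<\<sigma>]) = \<xi>"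
    using assms by (auto simp: periodic_configs_def intro!: repetition_word)
  show "repetition ` words \<sigma> n \<subseteq> periodic_configs \<sigma> n"
  proof safe
    fix w assume w: "w \<in> words \<sigma> n"
    have "repetition w x < n" for x
    proof -
      have "nat (x mod int (length w)) < length w" using w assms by (simp add: words_def nat_less_iff)
      then have "w ! nat (x mod int (length w)) \<in> set w" by (rule nth_mem)
      then show ?thesis using w by (auto simp: words_def repetition_def)
    qed
    then show "repetition w \<in> periodic_configs \<sigma> n"
      using w repetition_periodic[of w] by (auto simp: periodic_configs_def configurations_def words_def)
  qed
  show "(\<lambda>\<xi>. map (\<lambda>i. \<xi> (int i)) [0..<\<sigma>]) ` periodic_configs \<sigma> n \<subseteq> words \<sigma> n"
    by (auto simp: periodic_configs_def configurations_def words_def Pi_iff)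
qed

lemma card_periodic_configs: "\<sigma> > 0 \<Longrightarrow> card (periodic_configs \<sigma> n) = n ^ \<sigma>"
  using bij_betw_same_card[OF bij_betw_repetition] card_words by metis

lemma finite_periodic_configs: "\<sigma> > 0 \<Longrightarrow> finite (periodic_configs \<sigma> n)"
  using bij_betw_finite[OF bij_betw_repetition] finite_words by metis

text \<open>Replaces words by shifts: writing a word as a power of \<open>u\<close> amounts to
  \<open>length u\<close> being a period of its repetition, and this length is a proper
  divisor.\<close>

lemma has_minimal_period_iff:
  assumes \<sigma>: "\<sigma> > 0"
  shows "has_minimal_period \<xi> \<sigma> \<longleftrightarrow>
    (\<forall>x. \<xi> (x + int \<sigma>) = \<xi> x) \<and> (\<forall>e. e dvd \<sigma> \<longrightarrow> e < \<sigma> \<longrightarrow> (\<exists>x. \<xi> (x + int e) \<noteq> \<xi> x))"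
proof
  assume "has_minimal_period \<xi> \<sigma>"
  then obtain w where w: "length w = \<sigma>" "\<not> divisible_word w" "\<xi> = repetition w"
    by (auto simp: has_minimal_period_def)
  have "\<exists>x. \<xi> (x + int e) \<noteq> \<xi> x" if e: "e dvd \<sigma>" "e < \<sigma>" for e
  proof (rule ccontr)
    assume "\<not> (\<exists>x. \<xi> (x + int e) \<noteq> \<xi> x)"
    then have per: "\<And>x. \<xi> (x + int e) = \<xi> x" by simp
    obtain k where k: "\<sigma> = k * e" using e(1) by (auto simp: dvd_def mult.commute)
    have e0: "e > 0" using k \<sigma> by (cases "e = 0") auto
    have "k \<noteq> 0" "k \<noteq> 1" using k \<sigma> e(2) by auto
    then have k2: "k \<ge> 2" by simp
    have le: "e \<le> length w" using e(2) w(1) by simp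
    have "w = concat (replicate k (take e w))"
    proof (rule nth_equalityI)
      show "length w = length (concat (replicate k (take e w)))"
        using w(1) k le by (simp add: length_concat sum_list_replicate min_absorb2)
      fix i assume i: "i < length w"
      have "concat (replicate k (take e w)) ! i = take e w ! (i mod e)"
        using nth_concat_replicate[of i k "take e w"] i w(1) k le by (simp add: min_absorb2)
      also have "\<dots> = w ! (i mod e)" using e0 by simp
      also have "\<dots> = \<xi> (int (i mod e))"
        using e0 e(2) w(1) by (simp add: w(3) repetition_nth less_trans[OF mod_less_divisor])
      also have "\<dots> = \<xi> (int i)" using period_mod[of \<xi> "int e" "int i", OF per] by (simp add: zmod_int)
      also have "\<dots> = w ! i" using i by (simp add: w(3) repetition_nth)
      finally show "w ! i = concat (replicate k (take e w)) ! i" by simp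
    qed
    then show False using w(2) k2 by (auto simp: divisible_word_def)
  qed
  then show "(\<forall>x. \<xi> (x + int \<sigma>) = \<xi> x) \<and> (\<forall>e. e dvd \<sigma> \<longrightarrow> e < \<sigma> \<longrightarrow> (\<exists>x. \<xi> (x + int e) \<noteq> \<xi> x))"
    using repetition_periodic[of w] w by auto
next
  assume r: "(\<forall>x. \<xi> (x + int \<sigma>) = \<xi> x) \<and> (\<forall>e. e dvd \<sigma> \<longrightarrow> e < \<sigma> \<longrightarrow> (\<exists>x. \<xi> (x + int e) \<noteq> \<xi> x))"
  define w where "w = map (\<lambda>i. \<xi> (int i)) [0..<\<sigma>]"
  have rep: "\<xi> = repetition w" using r \<sigma> repetition_word[of \<sigma> \<xi>] by (simp add: w_def)
  have len: "length w = \<sigma>" by (simp add: w_def)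
  have "\<not> divisible_word w"
  proof
    assume "divisible_word w"
    then obtain k u where k: "k \<ge> 2" "w = concat (replicate k u)" by (auto simp: divisible_word_def)
    have lu: "\<sigma> = k * length u"
      using len k(2) by (simp add: length_concat sum_list_replicate)
    then have u: "length u dvd \<sigma>" "length u < \<sigma>" "length u > 0" using k(1) \<sigma> by (auto intro: ccontr)
    have "\<xi> x = u ! nat (x mod int (length u))" for x
    proof -
      have p: "x mod int \<sigma> \<ge> 0" "nat (x mod int \<sigma>) < k * length u"
        using \<sigma> by (auto simp: nat_less_iff simp flip: lu)
      have "\<xi> x = concat (replicate k u) ! nat (x mod int \<sigma>)"
        unfolding rep repetition_def len k(2)[symmetric] ..
      also have "\<dots> = u ! (nat (x mod int \<sigma>) mod length u)"
        by (rule nth_concat_replicate[OF p(2)])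
      also have "nat (x mod int \<sigma>) mod length u = nat (x mod int (length u))"
      proof -
        have "int (nat (x mod int \<sigma>) mod length u) = (x mod int \<sigma>) mod int (length u)"
          using p(1) by (simp add: zmod_int)
        also have "\<dots> = x mod int (length u)" using u(1) by (simp add: mod_mod_cancel)
        finally show ?thesis by simp
      qed
      finally show ?thesis .
    qed
    then have "\<xi> (x + int (length u)) = \<xi> x" for x by simp
    then show False using r u by blast
  qed
  then show "has_minimal_period \<xi> \<sigma>"
    using rep len \<sigma> by (auto simp: has_minimal_period_def intro!: exI[of _ w])
qed

text \<open>Passes from proper divisors to arbitrary shifts: together with \<open>\<sigma>\<close>,
  a period \<open>k\<close> produces their gcd as a period, which is a proper divisor.\<close>

lemma minimal_period_no_smaller:
  assumes "\<sigma> > 0" "has_minimal_period \<xi> \<sigma>" "0 < k" "k < int \<sigma>"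
  shows "\<exists>x. \<xi> (x + k) \<noteq> \<xi> x"
proof (rule ccontr)
  assume "\<not> (\<exists>x. \<xi> (x + k) \<noteq> \<xi> x)"
  then have k: "\<And>x. \<xi> (x + k) = \<xi> x" by simp
  have s: "\<And>x. \<xi> (x + int \<sigma>) = \<xi> x" using assms has_minimal_period_iff by blast
  define e where "e = gcd (nat k) \<sigma>"
  have "int e = gcd k (int \<sigma>)" using assms by (simp add: e_def gcd_int_int_eq flip: gcd_int_int_eq)
  then have "\<xi> (x + int e) = \<xi> x" for x using period_gcd[of \<xi> k "int \<sigma>", OF k s] by simp
  moreover have "e dvd \<sigma>" by (simp add: e_def)
  moreover have "e < \<sigma>"
  proof -
    have "e dvd nat k" by (simp add: e_def)
    then have "e \<le> nat k" using assms by (intro dvd_imp_le) auto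
    then show ?thesis using assms by linarith
  qed
  ultimately show False using assms has_minimal_period_iff by blast
qed

lemma minimal_configs_subset: "\<sigma> > 0 \<Longrightarrow> minimal_configs \<sigma> n \<subseteq> periodic_configs \<sigma> n"
  by (auto simp: minimal_configs_def periodic_configs_def has_minimal_period_iff)

lemma nonminimal_configs_eq:
  assumes "\<sigma> > 0"
  shows "periodic_configs \<sigma> n - minimal_configs \<sigma> n = (\<Union>e\<in>{e. e dvd \<sigma> \<and> e < \<sigma>}. periodic_configs e n)"
proof (intro equalityI subsetI)
  fix \<xi> assume "\<xi> \<in> periodic_configs \<sigma> n - minimal_configs \<sigma> n"
  then show "\<xi> \<in> (\<Union>e\<in>{e. e dvd \<sigma> \<and> e < \<sigma>}. periodic_configs e n)"
    using assms by (auto simp: minimal_configs_def periodic_configs_def has_minimal_period_iff)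
next
  fix \<xi> assume "\<xi> \<in> (\<Union>e\<in>{e. e dvd \<sigma> \<and> e < \<sigma>}. periodic_configs e n)"
  then obtain e where e: "e dvd \<sigma>" "e < \<sigma>" "\<xi> \<in> configurations n" "\<And>x. \<xi> (x + int e) = \<xi> x"
    by (auto simp: periodic_configs_def)
  obtain k where "\<sigma> = e * k" using e(1) by (auto simp: dvd_def)
  then have "\<xi> (x + int \<sigma>) = \<xi> x" for x
    using period_multiple[of \<xi> "int e", OF e(4), of x "int k"] by (simp add: mult.commute)
  then show "\<xi> \<in> periodic_configs \<sigma> n - minimal_configs \<sigma> n"
    using e assms by (auto simp: minimal_configs_def periodic_configs_def has_minimal_period_iff)
qed

lemma shift_minimal:
  assumes "\<sigma> > 0" "\<xi> \<in> minimal_configs \<sigma> n"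
  shows "shift k \<xi> \<in> minimal_configs \<sigma> n"
proof -
  have c: "\<xi> \<in> configurations n" and m: "has_minimal_period \<xi> \<sigma>" using assms by (auto simp: minimal_configs_def)
  have "has_minimal_period (shift k \<xi>) \<sigma>"
    unfolding has_minimal_period_iff[OF assms(1)]
  proof (intro conjI allI impI)
    fix x
    have "\<xi> ((x + k) + int \<sigma>) = \<xi> (x + k)" using m has_minimal_period_iff[OF assms(1), of \<xi>] by blast
    then show "shift k \<xi> (x + int \<sigma>) = shift k \<xi> x" by (simp add: shift_def algebra_simps)
  next
    fix e assume "e dvd \<sigma>" "e < \<sigma>"
    then obtain x where "\<xi> (x + int e) \<noteq> \<xi> x" using m has_minimal_period_iff[OF assms(1), of \<xi>] by blast
    then show "\<exists>x. shift k \<xi> (x + int e) \<noteq> shift k \<xi> x"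
      by (intro exI[of _ "x - k"]) (simp add: shift_def algebra_simps)
  qed
  then show ?thesis using c by (auto simp: minimal_configs_def configurations_def shift_def)
qed

text \<open>The translates by 0, ..., \<sigma> - 1 are distinct by
  \<open>minimal_period_no_smaller\<close>. The class size becomes the fibre size \<open>s\<close>
  of the random map.\<close>

lemma translation_class_minimal:
  assumes \<sigma>: "\<sigma> > 0" and \<xi>: "\<xi> \<in> minimal_configs \<sigma> n"
  shows "translation_rel `` {\<xi>} \<subseteq> minimal_configs \<sigma> n" "card (translation_rel `` {\<xi>}) = \<sigma>"
proof -
  show "translation_rel `` {\<xi>} \<subseteq> minimal_configs \<sigma> n"
    using shift_minimal[OF assms] by (auto simp: translation_rel_iff)
  have m: "has_minimal_period \<xi> \<sigma>" using \<xi> by (simp add: minimal_configs_def)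
  have per: "\<And>x. \<xi> (x + int \<sigma>) = \<xi> x" using m has_minimal_period_iff[OF \<sigma>] by blast
  have eq: "translation_rel `` {\<xi>} = (\<lambda>k. shift k \<xi>) ` {0..<int \<sigma>}"
  proof (intro equalityI subsetI)
    fix \<zeta> assume "\<zeta> \<in> translation_rel `` {\<xi>}"
    then obtain k where k: "\<zeta> = shift k \<xi>" by (auto simp: translation_rel_iff)
    have "shift k \<xi> = shift (k mod int \<sigma>) \<xi>"
    proof
      fix x
      have "\<xi> (x + k) = \<xi> ((x + k mod int \<sigma>) + (k div int \<sigma>) * int \<sigma>)" by (simp add: algebra_simps)
      also have "\<dots> = \<xi> (x + k mod int \<sigma>)"
        by (rule period_multiple[of \<xi> "int \<sigma>", OF per])
      finally show "shift k \<xi> x = shift (k mod int \<sigma>) \<xi> x"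
        unfolding shift_def .
    qed
    then show "\<zeta> \<in> (\<lambda>k. shift k \<xi>) ` {0..<int \<sigma>}" using k \<sigma> by auto
  qed (auto simp: translation_rel_iff)
  have "inj_on (\<lambda>k. shift k \<xi>) {0..<int \<sigma>}"
  proof (rule linorder_inj_onI)
    fix j k assume jk: "j < k" "j \<in> {0..<int \<sigma>}" "k \<in> {0..<int \<sigma>}"
    obtain x where x: "\<xi> (x + (k - j)) \<noteq> \<xi> x"
      using minimal_period_no_smaller[OF \<sigma> m, of "k - j"] jk by auto
    show "shift j \<xi> \<noteq> shift k \<xi>"
    proof
      assume "shift j \<xi> = shift k \<xi>"
      then have "shift j \<xi> (x - j) = shift k \<xi> (x - j)" by simp
      then show False using x by (simp add: shift_def algebra_simps)
    qed
  qed auto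
  then show "card (translation_rel `` {\<xi>}) = \<sigma>" unfolding eq by (simp add: card_image)
qed

section \<open>Windows of periodic configurations\<close>

abbreviation window :: "nat \<Rightarrow> (int \<Rightarrow> nat) \<Rightarrow> int \<Rightarrow> nat list" where
  "window r \<xi> x \<equiv> map \<xi> [x - int r + 1..x]"

lemma window_in_words: "\<xi> \<in> configurations n \<Longrightarrow> window r \<xi> x \<in> words r n"
  by (auto simp: words_def configurations_def)

lemma ca_step_shift: "ca_step r f (shift k \<xi>) = shift k (ca_step r f \<xi>)"
proof
  fix x
  have "map (shift k \<xi>) [x - int r + 1..x] = map \<xi> [(x + k) - int r + 1..x + k]"
    by (rule nth_equalityI) (auto simp: shift_def algebra_simps)
  then show "ca_step r f (shift k \<xi>) x = shift k (ca_step r f \<xi>) x"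
    by (simp add: ca_step_def shift_def)
qed

lemma ca_step_periodic:
  assumes "f \<in> rules r n" "\<xi> \<in> periodic_configs \<sigma> n"
  shows "ca_step r f \<xi> \<in> periodic_configs \<sigma> n"
proof -
  have "shift (int \<sigma>) \<xi> = \<xi>" using assms by (auto simp: shift_def periodic_configs_def)
  then have "shift (int \<sigma>) (ca_step r f \<xi>) = ca_step r f \<xi>" by (metis ca_step_shift)
  then have "\<And>x. ca_step r f \<xi> (x + int \<sigma>) = ca_step r f \<xi> x" by (metis shift_def)
  moreover have "ca_step r f \<xi> x < n" for x
  proof -
    have "window r \<xi> x \<in> words r n" using assms by (intro window_in_words) (auto simp: periodic_configs_def)
    then show ?thesis using assms(1) by (auto simp: rules_def ca_step_def)
  qed
  ultimately show ?thesis by (auto simp: periodic_configs_def configurations_def)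
qed

text \<open>The source of the condition \<open>\<sigma> \<le> r\<close>: a window then covers a full
  period and determines the configuration relative to its position.\<close>

lemma window_eq_imp_shift:
  assumes \<sigma>: "0 < \<sigma>" "\<sigma> \<le> r"
    and per: "\<And>x. \<xi> (x + int \<sigma>) = \<xi> x" "\<And>x. \<zeta> (x + int \<sigma>) = \<zeta> x"
    and win: "window r \<xi> x = window r \<zeta> y"
  shows "shift x \<xi> = shift y \<zeta>"
proof
  fix z
  \<comment> \<open>The index inside the window whose site is congruent modulo
    \<open>\<sigma>\<close> to the site at distance \<open>z\<close> from the right end; it is valid
    since \<open>j < \<sigma> \<le> r\<close>.\<close>
  define j where "j = nat ((z + int r - 1) mod int \<sigma>)"
  define q where "q = (z + int r - 1) div int \<sigma>"
  have j: "int j = (z + int r - 1) mod int \<sigma>" "j < \<sigma>"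
    using \<sigma> by (auto simp: j_def nat_less_iff)
  have zj: "z = 1 - int r + int j + q * int \<sigma>"
    using div_mult_mod_eq[of "z + int r - 1" "int \<sigma>"] unfolding j(1) q_def by linarith
  have jr: "j < r" using j \<sigma> by simp
  have nth: "window r \<upsilon> u ! j = \<upsilon> (u - int r + 1 + int j)" for \<upsilon> :: "int \<Rightarrow> nat" and u
    using jr by (subst nth_map) auto
  have "\<xi> (x + z) = \<xi> ((x - int r + 1 + int j) + q * int \<sigma>)" unfolding zj by (simp add: algebra_simps)
  also have "\<dots> = \<xi> (x - int r + 1 + int j)" by (rule period_multiple[of \<xi> "int \<sigma>", OF per(1)])
  also have "\<dots> = \<zeta> (y - int r + 1 + int j)" using win nth by metis
  also have "\<dots> = \<zeta> ((y - int r + 1 + int j) + q * int \<sigma>)" by (rule period_multiple[of \<zeta> "int \<sigma>", OF per(2), symmetric])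
  also have "\<dots> = \<zeta> (y + z)" unfolding zj by (simp add: algebra_simps)
  finally show "shift x \<xi> z = shift y \<zeta> z" by (simp add: shift_def add.commute)
qed

lemma card_PiE_prescribed:
  assumes "finite A" "S \<subseteq> A" "\<And>s. s \<in> S \<Longrightarrow> G s \<in> B"
  shows "card {f \<in> A \<rightarrow>\<^sub>E B. \<forall>s\<in>S. f s = G s} = card B ^ (card A - card S)"
proof -
  have "{f \<in> A \<rightarrow>\<^sub>E B. \<forall>s\<in>S. f s = G s} = (\<Pi>\<^sub>E a\<in>A. if a \<in> S then {G a} else B)"
  proof (intro set_eqI iffI)
    fix f assume f: "f \<in> (\<Pi>\<^sub>E a\<in>A. if a \<in> S then {G a} else B)"
    have "f s = G s" if "s \<in> S" for s using PiE_mem[OF f, of s] that assms(2) by auto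
    moreover have "f a \<in> B" if "a \<in> A" for a
      using PiE_mem[OF f that] assms(3)[of a] by (cases "a \<in> S") auto
    ultimately show "f \<in> {f \<in> A \<rightarrow>\<^sub>E B. \<forall>s\<in>S. f s = G s}"
      using f by (auto simp: PiE_def)
  qed (auto simp: PiE_iff)
  then have "card {f \<in> A \<rightarrow>\<^sub>E B. \<forall>s\<in>S. f s = G s} = (\<Prod>a\<in>A. if a \<in> S then 1 else card B)"
    using assms(1) by (simp add: card_PiE if_distrib cong: if_cong)
  also have "\<dots> = (\<Prod>a\<in>A - S. card B)"
    using assms(1) by (intro prod.mono_neutral_cong_right) auto
  also have "\<dots> = card B ^ (card A - card S)"
    using assms by (simp add: card_Diff_subset finite_subset)
  finally show ?thesis .
qed

text \<open>Dictionary: the points are the elements of \<open>R\<close>, the targets are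
  \<open>periodic_configs\<close>, the fibre over a point is its translation class, and the dead
  targets have smaller period. Representatives serve as points so that \<open>ca_step\<close> can be
  applied to them.\<close>

locale transversal =
  fixes r \<sigma> n :: nat and R :: "(int \<Rightarrow> nat) set"
  assumes \<sigma>: "0 < \<sigma>" "\<sigma> \<le> r" and n: "n > 0"
    and R: "R \<subseteq> minimal_configs \<sigma> n"
    and R_cover: "\<And>\<xi>. \<xi> \<in> minimal_configs \<sigma> n \<Longrightarrow> \<exists>\<rho>\<in>R. (\<rho>, \<xi>) \<in> translation_rel"
    and R_unique: "\<And>\<rho> \<rho>'. \<rho> \<in> R \<Longrightarrow> \<rho>' \<in> R \<Longrightarrow> (\<rho>, \<rho>') \<in> translation_rel \<Longrightarrow> \<rho> = \<rho>'"
begin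

abbreviation cls :: "(int \<Rightarrow> nat) \<Rightarrow> (int \<Rightarrow> nat) set" where
  "cls \<rho> \<equiv> translation_rel `` {\<rho>}"

lemma R_periodic: "\<rho> \<in> R \<Longrightarrow> \<rho> \<in> periodic_configs \<sigma> n"
  using R minimal_configs_subset[OF \<sigma>(1)] by auto

lemma R_period: "\<rho> \<in> R \<Longrightarrow> \<rho> (x + int \<sigma>) = \<rho> x"
  using R_periodic by (auto simp: periodic_configs_def)

lemma finite_R: "finite R"
  using R minimal_configs_subset[OF \<sigma>(1)] finite_periodic_configs[OF \<sigma>(1)] finite_subset by meson

lemma cls_subset: "\<rho> \<in> R \<Longrightarrow> cls \<rho> \<subseteq> minimal_configs \<sigma> n"
  using translation_class_minimal(1)[OF \<sigma>(1)] R by blast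

lemma card_cls: "\<rho> \<in> R \<Longrightarrow> card (cls \<rho>) = \<sigma>"
  using translation_class_minimal(2)[OF \<sigma>(1)] R by blast

lemma disjoint_cls: "disjoint_family_on cls R"
proof -
  have "\<rho> = \<rho>'" if "\<rho> \<in> R" "\<rho>' \<in> R" "\<xi> \<in> cls \<rho>" "\<xi> \<in> cls \<rho>'" for \<rho> \<rho>' \<xi>
    using R_unique[OF that(1,2)] that(3,4) equiv_translation_rel
    by (meson Image_singleton_iff equiv_def symE transE)
  then show ?thesis unfolding disjoint_family_on_def by blast
qed

lemma Union_cls: "(\<Union>\<rho>\<in>R. cls \<rho>) = minimal_configs \<sigma> n"
  using cls_subset R_cover by auto

lemma card_minimal: "card (minimal_configs \<sigma> n) = card R * \<sigma>"
proof -
  have fin: "finite (cls \<rho>)" if "\<rho> \<in> R" for \<rho>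
    using card_cls[OF that] \<sigma>(1) by (intro card_ge_0_finite) simp
  show ?thesis
    unfolding Union_cls[symmetric] using finite_R card_cls disjoint_cls fin by (intro card_UN_fibres) auto
qed

lemma card_decomposition:
  "n ^ \<sigma> = nonminimal_count \<sigma> n + card R * \<sigma>"
proof -
  have fin: "finite (periodic_configs \<sigma> n)" using finite_periodic_configs \<sigma>(1) .
  have sub: "minimal_configs \<sigma> n \<subseteq> periodic_configs \<sigma> n" using minimal_configs_subset \<sigma>(1) .
  have "nonminimal_count \<sigma> n = n ^ \<sigma> - card (minimal_configs \<sigma> n)"
    using card_Diff_subset[OF finite_subset[OF sub fin] sub] card_periodic_configs[OF \<sigma>(1)] by simp
  moreover have "card (minimal_configs \<sigma> n) \<le> n ^ \<sigma>"
    using card_mono[OF fin sub] card_periodic_configs[OF \<sigma>(1)] by simp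
  ultimately show ?thesis using card_minimal by simp
qed

text \<open>One step on all representatives thus reads the rule at distinct words. Equal windows
  give equal translates, hence the same representative, and the difference of positions is then a
  period shorter than \<open>\<sigma>\<close>.\<close>

lemma inj_on_window: "inj_on (\<lambda>(\<rho>, x). window r \<rho> x) (R \<times> {0..<int \<sigma>})"
proof (rule inj_onI, clarify)
  fix \<rho> x \<rho>' x' assume *: "\<rho> \<in> R" "\<rho>' \<in> R" "x \<in> {0..<int \<sigma>}" "x' \<in> {0..<int \<sigma>}" "window r \<rho> x = window r \<rho>' x'"
  have sh: "shift x \<rho> = shift x' \<rho>'"
    by (rule window_eq_imp_shift[OF \<sigma> _ _ *(5)]) (use * R_period in auto)
  have "\<rho>' = shift (x - x') \<rho>"
  proof -
    have "\<rho>' = shift (- x') (shift x' \<rho>')" by (simp add: shift_shift shift_0)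
    also have "\<dots> = shift (x - x') \<rho>" unfolding sh[symmetric] by (simp add: shift_shift)
    finally show ?thesis .
  qed
  then have eq: "\<rho> = \<rho>'" using R_unique * by (auto simp: translation_rel_iff)
  have "x = x'"
  proof (rule ccontr)
    assume "x \<noteq> x'"
    have m: "has_minimal_period \<rho> \<sigma>" using R * by (auto simp: minimal_configs_def)
    have same: "\<rho> (z + x) = \<rho> (z + x')" for z
      using fun_cong[OF sh, of z] by (simp add: shift_def eq)
    consider "x < x'" | "x' < x" using \<open>x \<noteq> x'\<close> by linarith
    then show False
    proof cases
      case 1
      then obtain z where "\<rho> (z + (x' - x)) \<noteq> \<rho> z"
        using minimal_period_no_smaller[OF \<sigma>(1) m, of "x' - x"] * by auto
      then show False using same[of "z - x"] by (simp add: algebra_simps)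
    next
      case 2
      then obtain z where "\<rho> (z + (x - x')) \<noteq> \<rho> z"
        using minimal_period_no_smaller[OF \<sigma>(1) m, of "x - x'"] * by auto
      then show False using same[of "z - x'"] by (simp add: algebra_simps)
    qed
  qed
  then show "\<rho> = \<rho>' \<and> x = x'" using eq by simp
qed

text \<open>The count does not depend on \<open>g\<close>: a uniform rule induces a uniform map from
  representatives to periodic configurations.\<close>

lemma card_rules_prescribed:
  assumes g: "g \<in> R \<rightarrow>\<^sub>E periodic_configs \<sigma> n"
  shows "card {f \<in> rules r n. restrict (ca_step r f) R = g} = n ^ (n ^ r - card R * \<sigma>)"
    and "card R * \<sigma> \<le> n ^ r"
proof -
  let ?e = "\<lambda>(\<rho>, x). window r \<rho> x" and ?D = "R \<times> {0..<int \<sigma>}"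
  define S where "S = ?e ` ?D"
  define G where "G s = (case inv_into ?D ?e s of (\<rho>, x) \<Rightarrow> g \<rho> x)" for s
  have G: "G (window r \<rho> x) = g \<rho> x" if "\<rho> \<in> R" "x \<in> {0..<int \<sigma>}" for \<rho> x
    using inv_into_f_f[OF inj_on_window, of "(\<rho>, x)"] that by (simp add: G_def)
  have gper: "g \<rho> \<in> periodic_configs \<sigma> n" if "\<rho> \<in> R" for \<rho> using g that by auto
  have SW: "S \<subseteq> words r n"
    using R_periodic window_in_words by (fastforce simp: S_def periodic_configs_def)
  have cS: "card S = card R * \<sigma>"
    unfolding S_def using card_image[OF inj_on_window] by (simp add: card_cartesian_product)
  show "card R * \<sigma> \<le> n ^ r"
    using card_mono[OF finite_words SW] cS by (simp add: card_words)
  have "{f \<in> rules r n. restrict (ca_step r f) R = g} = {f \<in> words r n \<rightarrow>\<^sub>E {..<n}. \<forall>s\<in>S. f s = G s}"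
  proof (intro Collect_cong conj_cong)
    fix f assume f: "f \<in> words r n \<rightarrow>\<^sub>E {..<n}"
    show "restrict (ca_step r f) R = g \<longleftrightarrow> (\<forall>s\<in>S. f s = G s)"
    proof
      assume "restrict (ca_step r f) R = g"
      then have "ca_step r f \<rho> = g \<rho>" if "\<rho> \<in> R" for \<rho> using that by (metis restrict_apply')
      then show "\<forall>s\<in>S. f s = G s" using G by (auto simp: S_def ca_step_def fun_eq_iff)
    next
      assume a: "\<forall>s\<in>S. f s = G s"
      show "restrict (ca_step r f) R = g"
      proof (rule extensionalityI[of _ R])
        show "g \<in> extensional R" using g by (auto simp: PiE_def)
        fix \<rho> assume \<rho>: "\<rho> \<in> R"
        have "ca_step r f \<rho> x = g \<rho> x" for x
        proof -
          have x: "x mod int \<sigma> \<in> {0..<int \<sigma>}" using \<sigma> by auto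
          have "ca_step r f \<rho> \<in> periodic_configs \<sigma> n"
            using f R_periodic[OF \<rho>] by (intro ca_step_periodic) (auto simp: rules_def)
          then have "ca_step r f \<rho> x = ca_step r f \<rho> (x mod int \<sigma>)"
            using period_mod[of "ca_step r f \<rho>" "int \<sigma>" x] by (auto simp: periodic_configs_def)
          also have "\<dots> = g \<rho> (x mod int \<sigma>)"
          proof -
            have "window r \<rho> (x mod int \<sigma>) \<in> S" using \<rho> x unfolding S_def by force
            then show ?thesis using a G[OF \<rho> x] by (simp add: ca_step_def)
          qed
          also have "\<dots> = g \<rho> x"
            using period_mod[of "g \<rho>" "int \<sigma>" x] gper[OF \<rho>] by (auto simp: periodic_configs_def)
          finally show ?thesis .
        qed
        then show "restrict (ca_step r f) R \<rho> = g \<rho>" using \<rho> by auto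
      qed auto
    qed
  qed (simp add: rules_def)
  moreover have "card {f \<in> words r n \<rightarrow>\<^sub>E {..<n}. \<forall>s\<in>S. f s = G s} = card {..<n} ^ (card (words r n) - card S)"
  proof (rule card_PiE_prescribed[OF finite_words SW])
    fix s assume "s \<in> S"
    then obtain \<rho> x where "\<rho> \<in> R" "x \<in> {0..<int \<sigma>}" "s = window r \<rho> x" by (auto simp: S_def)
    then show "G s \<in> {..<n}" using G gper[of \<rho>] by (auto simp: periodic_configs_def configurations_def)
  qed
  ultimately show "card {f \<in> rules r n. restrict (ca_step r f) R = g} = n ^ (n ^ r - card R * \<sigma>)"
    by (simp add: cS card_words)
qed

abbreviation surviving :: "(nat list \<Rightarrow> nat) \<Rightarrow> (int \<Rightarrow> nat) set" where
  "surviving f \<equiv> alive cls R (restrict (ca_step r f) R)"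

lemma prob_card_surviving:
  "measure_pmf.prob (random_rule r n) {f. card (surviving f) = m} =
   alive_size_prob (card R) \<sigma> (nonminimal_count \<sigma> n) m"
proof -
  let ?Y = "periodic_configs \<sigma> n" and ?N = "card R"
  let ?d = "card (?Y - minimal_configs \<sigma> n)"
  define Gs where "Gs = {g \<in> R \<rightarrow>\<^sub>E ?Y. card (alive cls R g) = m}"
  have finY: "finite ?Y" using finite_periodic_configs \<sigma>(1) .
  have finG: "finite Gs"
    unfolding Gs_def using finite_R finY by (intro finite_subset[OF _ finite_PiE[of R "\<lambda>_. ?Y"]]) auto
  have cG: "card Gs = (?N choose m) * ((m * \<sigma>) ^ m * forest_count \<sigma> (?N - m) ?d)"
    unfolding Gs_def
  proof (rule card_card_alive_eq[OF finite_R finY _ _ disjoint_cls])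
    show "cls i \<subseteq> ?Y" if "i \<in> R" for i using cls_subset[OF that] minimal_configs_subset[OF \<sigma>(1)] by blast
    show "card (cls i) = \<sigma>" if "i \<in> R" for i using card_cls[OF that] .
    show "card ?Y = ?d + ?N * \<sigma>" using card_decomposition card_periodic_configs[OF \<sigma>(1)] by simp
  qed
  have Nr: "?N * \<sigma> \<le> n ^ r"
  proof -
    have "(\<lambda>\<rho>\<in>R. \<rho>) \<in> R \<rightarrow>\<^sub>E ?Y" using R_periodic by auto
    then show ?thesis by (rule card_rules_prescribed(2))
  qed
  have split: "rules r n \<inter> {f. card (surviving f) = m} = (\<Union>g\<in>Gs. {f \<in> rules r n. restrict (ca_step r f) R = g})"
    using ca_step_periodic R_periodic by (auto simp: Gs_def)
  have "card (rules r n \<inter> {f. card (surviving f) = m}) = (\<Sum>g\<in>Gs. card {f \<in> rules r n. restrict (ca_step r f) R = g})"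
    unfolding split using finG finite_rules by (intro card_UN_disjoint) auto
  also have "\<dots> = card Gs * n ^ (n ^ r - ?N * \<sigma>)"
    using card_rules_prescribed(1) by (simp add: Gs_def)
  finally have c: "card (rules r n \<inter> {f. card (surviving f) = m}) = card Gs * n ^ (n ^ r - ?N * \<sigma>)" .
  \<comment> \<open>The values of a rule that \<open>g\<close> leaves free cancel; what remains is
    the number of all maps from \<open>R\<close> to the \<open>n ^ \<sigma>\<close> targets.\<close>
  have tot: "n ^ (n ^ r) = n ^ (n ^ r - ?N * \<sigma>) * (n ^ \<sigma>) ^ ?N"
    using Nr by (simp add: mult.commute[of ?N] flip: power_mult power_add)
  have "measure_pmf.prob (random_rule r n) {f. card (surviving f) = m} = real (card Gs * n ^ (n ^ r - ?N * \<sigma>)) / real (n ^ (n ^ r))"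
    unfolding random_rule_def using finite_rules rules_nonempty[OF n]
    by (subst measure_pmf_of_set) (auto simp: c card_rules)
  also have "\<dots> = real (card Gs) / real ((n ^ \<sigma>) ^ ?N)"
    unfolding tot using n by simp
  also have "\<dots> = alive_size_prob ?N \<sigma> ?d m"
    unfolding cG alive_size_prob_def using card_decomposition by simp
  finally show ?thesis .
qed

section \<open>Survival under the automaton\<close>

lemma evolution_shift: "evolution r f (shift k \<xi>) t = shift k (evolution r f \<xi> t)"
  by (induction t) (simp_all add: evolution_def ca_step_shift)

lemma evolution_Suc_left: "evolution r f \<xi> (Suc t) = evolution r f (ca_step r f \<xi>) t"
  by (simp add: evolution_def funpow_swap1)

lemma evolution_Suc_step: "evolution r f \<xi> (Suc t) = ca_step r f (evolution r f \<xi> t)"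
  by (simp add: evolution_def)

lemma persistent_eq: "persistent_configurations r \<sigma> n f =
    {\<xi> \<in> configurations n. \<forall>t. has_minimal_period (evolution r f \<xi> t) \<sigma>}"
  using evolution_0 by (auto simp: persistent_configurations_def never_reduces_period_def dest: spec[of _ 0])

lemma persistent_minimal: "persistent_configurations r \<sigma> n f \<subseteq> minimal_configs \<sigma> n"
  by (auto simp: persistent_configurations_def minimal_configs_def)

lemma persistent_shift:
  assumes "\<xi> \<in> persistent_configurations r \<sigma> n f"
  shows "shift k \<xi> \<in> persistent_configurations r \<sigma> n f"
proof -
  have "has_minimal_period (shift k (evolution r f \<xi> t)) \<sigma>" for t
  proof -
    \<comment> \<open>As \<open>f\<close> is arbitrary here, the evolution may leave the alphabet of
      size \<open>n\<close>. A periodic configuration takes finitely many values, so some larger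
      alphabet makes \<open>shift_minimal\<close> applicable.\<close>
    define m where "m = Suc (Max (range (evolution r f \<xi> t)))"
    have mp: "has_minimal_period (evolution r f \<xi> t) \<sigma>" using assms by (auto simp: persistent_eq)
    have "range (evolution r f \<xi> t) \<subseteq> evolution r f \<xi> t ` {0..<int \<sigma>}"
    proof safe
      fix x
      have "evolution r f \<xi> t x = evolution r f \<xi> t (x mod int \<sigma>)"
        using period_mod[of "evolution r f \<xi> t" "int \<sigma>" x] mp has_minimal_period_iff[OF \<sigma>(1)] by simp
      then show "evolution r f \<xi> t x \<in> evolution r f \<xi> t ` {0..<int \<sigma>}" using \<sigma> by auto
    qed
    then have "finite (range (evolution r f \<xi> t))" by (rule finite_subset) simp
    then have "evolution r f \<xi> t \<in> configurations m"
      by (auto simp: configurations_def m_def less_Suc_eq_le)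
    then show ?thesis
      using shift_minimal[OF \<sigma>(1), of "evolution r f \<xi> t" m k] mp by (simp add: minimal_configs_def)
  qed
  moreover have "shift k \<xi> \<in> configurations n"
    using assms by (auto simp: persistent_eq configurations_def shift_def)
  ultimately show ?thesis
    by (simp add: persistent_eq evolution_shift)
qed

text \<open>The automaton commutes with translations, so the persistent representatives form a
  closed set. Conversely, the evolution of a surviving representative always stays within translates
  of surviving ones, all of minimal period \<open>\<sigma>\<close>.\<close>

lemma surviving_eq:
  assumes f: "f \<in> rules r n"
  shows "surviving f = persistent_configurations r \<sigma> n f \<inter> R"
proof
  let ?P = "persistent_configurations r \<sigma> n f"
  have "closed_under cls (restrict (ca_step r f) R) (?P \<inter> R)"
    unfolding closed_under_def
  proof
    fix \<xi> assume \<xi>: "\<xi> \<in> ?P \<inter> R"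
    have Y: "ca_step r f \<xi> \<in> periodic_configs \<sigma> n" using \<xi> R_periodic f by (intro ca_step_periodic) auto
    then have P: "ca_step r f \<xi> \<in> ?P"
      using \<xi> unfolding persistent_eq by (auto simp: periodic_configs_def simp flip: evolution_Suc_left)
    then obtain \<rho> where \<rho>: "\<rho> \<in> R" "(\<rho>, ca_step r f \<xi>) \<in> translation_rel"
      using R_cover persistent_minimal by blast
    then obtain k where "ca_step r f \<xi> = shift k \<rho>" by (auto simp: translation_rel_iff)
    then have "\<rho> = shift (- k) (ca_step r f \<xi>)" by (simp add: shift_shift shift_0)
    then have "\<rho> \<in> ?P" using persistent_shift[OF P] by simp
    then show "restrict (ca_step r f) R \<xi> \<in> (\<Union>j\<in>?P \<inter> R. cls j)" using \<rho> \<xi> by auto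
  qed
  then show "?P \<inter> R \<subseteq> surviving f" by (auto simp: alive_def)
  show "surviving f \<subseteq> ?P \<inter> R"
  proof
    fix \<xi> assume \<xi>: "\<xi> \<in> surviving f"
    have sub: "surviving f \<subseteq> R" by (rule alive_subset)
    have "\<exists>\<rho>\<in>surviving f. (\<rho>, evolution r f \<xi> t) \<in> translation_rel" for t
    proof (induction t)
      case 0
      have "(\<xi>, \<xi>) \<in> translation_rel" unfolding translation_rel_iff by (intro exI[of _ 0]) (simp add: shift_0)
      then show ?case using \<xi> unfolding evolution_0 by blast
    next
      case (Suc t)
      then obtain \<rho> k where \<rho>: "\<rho> \<in> surviving f" "evolution r f \<xi> t = shift k \<rho>"
        unfolding translation_rel_iff by blast
      obtain \<rho>' where \<rho>': "\<rho>' \<in> surviving f" "ca_step r f \<rho> \<in> cls \<rho>'"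
        using closed_under_alive[of cls "restrict (ca_step r f) R" R] \<rho>(1) sub
        unfolding closed_under_def by fastforce
      then obtain j where "ca_step r f \<rho> = shift j \<rho>'" by (auto simp: translation_rel_iff)
      then have "evolution r f \<xi> (Suc t) = shift (k + j) \<rho>'"
        unfolding evolution_Suc_step \<rho>(2) ca_step_shift by (simp add: shift_shift)
      then show ?case using \<rho>'(1) unfolding translation_rel_iff by blast
    qed
    then have "evolution r f \<xi> t \<in> minimal_configs \<sigma> n" for t using sub cls_subset by blast
    then have "\<xi> \<in> ?P"
      using \<xi> sub R unfolding persistent_eq minimal_configs_def by blast
    then show "\<xi> \<in> ?P \<inter> R" using \<xi> sub by blast
  qed
qed

lemma num_classes_eq:
  assumes "f \<in> rules r n"
  shows "num_classes r \<sigma> n f = card (surviving f)"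
proof -
  let ?P = "persistent_configurations r \<sigma> n f"
  have "bij_betw cls (?P \<inter> R) (?P // translation_rel)"
  proof (rule bij_betw_imageI)
    show "inj_on cls (?P \<inter> R)"
      using R_unique equiv_translation_rel by (auto intro!: inj_onI simp: eq_equiv_class_iff)
    show "cls ` (?P \<inter> R) = ?P // translation_rel"
    proof (intro equalityI subsetI)
      fix C assume "C \<in> ?P // translation_rel"
      then obtain \<xi> where \<xi>: "\<xi> \<in> ?P" "C = cls \<xi>" by (auto simp: quotient_def)
      then obtain \<rho> where \<rho>: "\<rho> \<in> R" "(\<rho>, \<xi>) \<in> translation_rel" using R_cover persistent_minimal by blast
      then obtain k where "\<xi> = shift k \<rho>" by (auto simp: translation_rel_iff)
      then have "\<rho> = shift (- k) \<xi>" by (simp add: shift_shift shift_0)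
      then have "\<rho> \<in> ?P" using persistent_shift[OF \<xi>(1)] by simp
      moreover have "cls \<rho> = C" unfolding \<xi>(2) by (rule equiv_class_eq[OF equiv_translation_rel \<rho>(2)])
      ultimately show "C \<in> cls ` (?P \<inter> R)" using \<rho> by blast
    qed (auto simp: quotient_def)
  qed
  then show ?thesis
    unfolding num_classes_def surviving_eq[OF assms] by (rule bij_betw_same_card[symmetric])
qed

lemma prob_num_classes:
  "measure_pmf.prob (random_rule r n) {f. num_classes r \<sigma> n f = m} =
   alive_size_prob (card R) \<sigma> (nonminimal_count \<sigma> n) m"
proof -
  have supp: "set_pmf (random_rule r n) = rules r n"
    unfolding random_rule_def using finite_rules rules_nonempty[OF n] by (rule set_pmf_of_set[OF _ _, rotated])
  show ?thesis
    unfolding prob_card_surviving[symmetric]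
    by (rule measure_pmf.finite_measure_eq_AE) (auto simp: AE_measure_pmf_iff supp num_classes_eq)
qed

end

lemma transversal_exists:
  assumes "0 < \<sigma>" "\<sigma> \<le> r" "n > 0"
  shows "\<exists>R. transversal r \<sigma> n R"
proof -
  let ?X = "minimal_configs \<sigma> n"
  define rep where "rep \<xi> = (SOME \<rho>. (\<xi>, \<rho>) \<in> translation_rel)" for \<xi>
  have eqv: "sym translation_rel" "trans translation_rel" "refl translation_rel"
    using equiv_translation_rel by (auto simp: equiv_def)
  have rep: "(\<xi>, rep \<xi>) \<in> translation_rel" for \<xi>
    unfolding rep_def by (rule someI[of _ \<xi>]) (use eqv(3) in \<open>auto dest: reflD\<close>)
  have rep_eq: "rep \<xi> = rep \<zeta>" if "(\<xi>, \<zeta>) \<in> translation_rel" for \<xi> \<zeta>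
  proof -
    have "(\<xi>, \<rho>) \<in> translation_rel \<longleftrightarrow> (\<zeta>, \<rho>) \<in> translation_rel" for \<rho>
      using that eqv by (meson symD transD)
    then show ?thesis by (simp add: rep_def)
  qed
  have "transversal r \<sigma> n (rep ` ?X)"
  proof
    show "rep ` ?X \<subseteq> ?X"
    proof
      fix \<rho> assume "\<rho> \<in> rep ` ?X"
      then obtain \<xi> where "\<xi> \<in> ?X" "\<rho> = rep \<xi>" by auto
      then show "\<rho> \<in> ?X" using translation_class_minimal(1)[OF assms(1), of \<xi> n] rep[of \<xi>] by auto
    qed
    show "\<exists>\<rho>\<in>rep ` ?X. (\<rho>, \<xi>) \<in> translation_rel" if "\<xi> \<in> ?X" for \<xi>
      using that rep[of \<xi>] eqv by (meson imageI symD)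
    fix \<rho> \<rho>' assume \<rho>: "\<rho> \<in> rep ` ?X" "\<rho>' \<in> rep ` ?X" "(\<rho>, \<rho>') \<in> translation_rel"
    then obtain \<xi> \<zeta> where "\<rho> = rep \<xi>" "\<rho>' = rep \<zeta>" by auto
    then show "\<rho> = \<rho>'" using rep_eq[OF \<rho>(3)] rep_eq[OF rep[of \<xi>]] rep_eq[OF rep[of \<zeta>]] by simp
  qed (use assms in auto)
  then show ?thesis by blast
qed

section \<open>Counting configurations of smaller period\<close>

lemma card_nonminimal_ge:
  assumes "\<sigma> > 0" "even \<sigma>"
  shows "n ^ (\<sigma> div 2) \<le> nonminimal_count \<sigma> n"
proof -
  have h: "\<sigma> div 2 dvd \<sigma>" "\<sigma> div 2 < \<sigma>" "\<sigma> div 2 > 0" using assms by auto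
  have "card (periodic_configs (\<sigma> div 2) n) \<le> nonminimal_count \<sigma> n"
    using finite_periodic_configs[OF assms(1)] h
    by (intro card_mono finite_Diff) (auto simp: nonminimal_configs_eq[OF assms(1)])
  then show ?thesis using card_periodic_configs[OF h(3)] by simp
qed

lemma card_nonminimal_le:
  assumes "\<sigma> > 0"
  shows "nonminimal_count \<sigma> n \<le> (\<Sum>e\<in>{e. e dvd \<sigma> \<and> e < \<sigma>}. n ^ e)"
proof -
  have e0: "e > 0" if "e dvd \<sigma>" for e using that assms by (auto intro: ccontr)
  have "nonminimal_count \<sigma> n \<le> (\<Sum>e\<in>{e. e dvd \<sigma> \<and> e < \<sigma>}. card (periodic_configs e n))"
    unfolding nonminimal_configs_eq[OF assms] by (rule card_UN_le) simp
  also have "\<dots> = (\<Sum>e\<in>{e. e dvd \<sigma> \<and> e < \<sigma>}. n ^ e)"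
    using e0 by (intro sum.cong refl card_periodic_configs) auto
  finally show ?thesis .
qed

text \<open>Only the divisor \<open>\<sigma> div 2\<close> contributes to leading order: every other
  proper divisor is at most a third of \<open>\<sigma>\<close>, hence at most
  \<open>\<sigma> div 2 - 1\<close>.\<close>

lemma card_nonminimal_even_le:
  assumes "\<sigma> > 0" "even \<sigma>" "n > 0"
  shows "nonminimal_count \<sigma> n \<le> n ^ (\<sigma> div 2) + \<sigma> * n ^ (\<sigma> div 2 - 1)"
proof -
  let ?E = "{e. e dvd \<sigma> \<and> e < \<sigma>}" and ?h = "\<sigma> div 2"
  have h: "?h \<in> ?E" using assms by auto
  have le: "e \<le> ?h - 1" if "e \<in> ?E - {?h}" for e
  proof -
    obtain k where k: "\<sigma> = e * k" using \<open>e \<in> ?E - {?h}\<close> by (auto simp: dvd_def)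
    have "k \<noteq> 0" "k \<noteq> 1" "k \<noteq> 2" using that k assms(1) by auto
    then have "3 \<le> k" by simp
    then have "e * 3 \<le> \<sigma>" using k by simp
    then show ?thesis using assms(1,2) that by (auto elim!: evenE)
  qed
  have "(\<Sum>e\<in>?E. n ^ e) = n ^ ?h + (\<Sum>e\<in>?E - {?h}. n ^ e)" using h by (intro sum.remove) auto
  also have "(\<Sum>e\<in>?E - {?h}. n ^ e) \<le> (\<Sum>e\<in>?E - {?h}. n ^ (?h - 1))"
    using le assms(3) by (intro sum_mono power_increasing) auto
  also have "\<dots> \<le> \<sigma> * n ^ (?h - 1)"
  proof -
    have "card (?E - {?h}) \<le> card {..<\<sigma>}" by (intro card_mono) auto
    then show ?thesis by simp
  qed
  finally show ?thesis using card_nonminimal_le[OF assms(1), of n] by linarith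
qed

text \<open>An odd number has no divisor equal to its half, so all exponents stay below \<sigma> / 2
  and the count is negligible against the square root of \<open>n ^ \<sigma>\<close>.\<close>

lemma card_nonminimal_odd_le:
  assumes "\<sigma> > 0" "odd \<sigma>" "n > 0"
  shows "nonminimal_count \<sigma> n \<le> \<sigma> * n ^ ((\<sigma> - 1) div 2)"
proof -
  let ?E = "{e. e dvd \<sigma> \<and> e < \<sigma>}"
  have le: "e \<le> (\<sigma> - 1) div 2" if "e \<in> ?E" for e
  proof -
    obtain k where k: "\<sigma> = e * k" using \<open>e \<in> ?E\<close> by (auto simp: dvd_def)
    have "k \<noteq> 0" "k \<noteq> 1" using that k assms(1) by auto
    then have "2 \<le> k" by simp
    then have "e * 2 \<le> \<sigma>" using k by simp
    then show ?thesis using assms(2) by (auto elim!: oddE)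
  qed
  have "(\<Sum>e\<in>?E. n ^ e) \<le> (\<Sum>e\<in>?E. n ^ ((\<sigma> - 1) div 2))"
    using le assms(3) by (intro sum_mono power_increasing) auto
  also have "\<dots> \<le> \<sigma> * n ^ ((\<sigma> - 1) div 2)"
  proof -
    have "card ?E \<le> card {..<\<sigma>}" by (intro card_mono) auto
    then show ?thesis by simp
  qed
  finally show ?thesis using card_nonminimal_le[OF assms(1), of n] by linarith
qed

section \<open>The limit theorem\<close>

text \<open>As \<open>d\<close> is of smaller order than the total, \<open>N\<close> is asymptotic
  to the total divided by \<open>\<sigma>\<close>. Normalising by sqrt N instead of the root of the
  total turns \<open>b\<close> into \<open>b / sqrt \<sigma>\<close>; it is used with b = 1 for even
  and b = 0 for odd \<sigma>.\<close>

lemma parameter_asymptotics: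
  fixes N d :: "nat \<Rightarrow> nat" and \<sigma> :: nat
  assumes \<sigma>: "\<sigma> > 0" and tot: "\<And>n. Suc n ^ \<sigma> = d n + N n * \<sigma>"
    and d: "(\<lambda>n. real (d n) / sqrt (real (Suc n) ^ \<sigma>)) \<longlonglongrightarrow> b"
  shows "filterlim N at_top sequentially"
    and "(\<lambda>n. real (N n) / (real (d n + N n * \<sigma>) / real \<sigma>)) \<longlonglongrightarrow> 1"
    and "(\<lambda>n. real (d n) / real \<sigma> / sqrt (real (N n))) \<longlonglongrightarrow> b / sqrt (real \<sigma>)"
proof -
  define X where "X n = real (Suc n) ^ \<sigma>" for n
  have X0: "X n > 0" for n by (simp add: X_def)
  have XdN: "real (d n + N n * \<sigma>) = X n" for n unfolding X_def tot[symmetric] by simp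
  then have NX: "real (N n) * real \<sigma> = X n - real (d n)" for n
    by (metis add_diff_cancel_left' of_nat_add of_nat_mult)
  have Xtop: "filterlim X at_top sequentially"
    unfolding X_def by (intro filterlim_pow_at_top \<sigma> filterlim_compose[OF filterlim_real_sequentially filterlim_Suc])
  have "filterlim (\<lambda>n. sqrt (X n)) at_top sequentially"
    by (rule filterlim_compose[OF sqrt_at_top Xtop])
  then have "(\<lambda>n. (real (d n) / sqrt (X n)) / sqrt (X n)) \<longlonglongrightarrow> 0"
    by (rule real_tendsto_divide_at_top[OF d[folded X_def]])
  then have dX: "(\<lambda>n. real (d n) / X n) \<longlonglongrightarrow> 0"
    using X0 by (simp add: less_imp_le)
  have "(\<lambda>n. 1 - real (d n) / X n) \<longlonglongrightarrow> 1 - 0" by (intro tendsto_intros dX)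
  moreover have "1 - real (d n) / X n = real (N n) * real \<sigma> / X n" for n
    using X0[of n] by (simp add: NX diff_divide_distrib)
  ultimately have NsX: "(\<lambda>n. real (N n) * real \<sigma> / X n) \<longlonglongrightarrow> 1" by simp
  then show "(\<lambda>n. real (N n) / (real (d n + N n * \<sigma>) / real \<sigma>)) \<longlonglongrightarrow> 1"
    unfolding XdN by simp
  have "(\<lambda>n. real (N n) * real \<sigma> / X n / real \<sigma>) \<longlonglongrightarrow> 1 / real \<sigma>"
    using \<sigma> by (intro tendsto_divide NsX tendsto_const) auto
  then have NX': "(\<lambda>n. real (N n) / X n) \<longlonglongrightarrow> 1 / real \<sigma>" using \<sigma> by simp
  have "filterlim (\<lambda>n. real (N n) / X n * X n) at_top sequentially"
    using \<sigma> by (intro filterlim_tendsto_pos_mult_at_top[OF NX' _ Xtop]) simp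
  moreover have "real (N n) / X n * X n = real (N n)" for n using X0[of n] by simp
  ultimately have "filterlim (\<lambda>n. real (N n)) at_top sequentially" by simp
  then show "filterlim N at_top sequentially" by (simp add: filterlim_sequentially_iff_filterlim_real)
  have lim: "(\<lambda>n. (real (d n) / sqrt (X n)) / real \<sigma> / sqrt (real (N n) / X n)) \<longlonglongrightarrow> b / real \<sigma> / sqrt (1 / real \<sigma>)"
    using \<sigma> by (intro tendsto_divide d[folded X_def] tendsto_real_sqrt NX' tendsto_const) auto
  have eq: "(real (d n) / sqrt (X n)) / real \<sigma> / sqrt (real (N n) / X n) = real (d n) / real \<sigma> / sqrt (real (N n))" for n
    using X0[of n] by (simp add: real_sqrt_divide)
  have b: "b / real \<sigma> / sqrt (1 / real \<sigma>) = b / sqrt (real \<sigma>)"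
  proof -
    have "b / (q * q) / (1 / q) = b / q" if "q > 0" for q :: real using that by simp
    from this[of "sqrt (real \<sigma>)"] \<sigma> show ?thesis by (simp add: real_sqrt_divide)
  qed
  show "(\<lambda>n. real (d n) / real \<sigma> / sqrt (real (N n))) \<longlonglongrightarrow> b / sqrt (real \<sigma>)"
    using lim unfolding eq b .
qed

lemma nonminimal_count_even:
  assumes "\<sigma> > 0" "even \<sigma>"
  shows "(\<lambda>n. real (nonminimal_count \<sigma> (Suc n)) / sqrt (real (Suc n) ^ \<sigma>)) \<longlonglongrightarrow> 1"
proof (rule tendsto_sandwich)
  obtain h where h: "\<sigma> = 2 * h" using assms(2) by blast
  have h0: "h > 0" using h assms(1) by simp
  have sq: "sqrt (real (Suc n) ^ \<sigma>) = real (Suc n) ^ h" for n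
  proof -
    have "real (Suc n) ^ \<sigma> = (real (Suc n) ^ h) ^ 2" by (simp add: h mult.commute flip: power_mult)
    then show ?thesis by simp
  qed
  have pos: "real (Suc n) ^ h > 0" for n by simp
  show "\<forall>\<^sub>F n in sequentially. 1 \<le> real (nonminimal_count \<sigma> (Suc n)) / sqrt (real (Suc n) ^ \<sigma>)"
  proof (intro always_eventually allI)
    fix n
    have "real (Suc n ^ h) \<le> real (nonminimal_count \<sigma> (Suc n))"
      using card_nonminimal_ge[OF assms, of "Suc n"] by (simp only: of_nat_le_iff) (simp add: h)
    then show "1 \<le> real (nonminimal_count \<sigma> (Suc n)) / sqrt (real (Suc n) ^ \<sigma>)"
      unfolding sq using pos[of n] by (simp add: le_divide_eq)
  qed
  show "\<forall>\<^sub>F n in sequentially. real (nonminimal_count \<sigma> (Suc n)) / sqrt (real (Suc n) ^ \<sigma>) \<le> 1 + real \<sigma> / real (Suc n)"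
  proof (intro always_eventually allI)
    fix n
    have "real (nonminimal_count \<sigma> (Suc n)) \<le> real (Suc n ^ h + \<sigma> * Suc n ^ (h - 1))"
      using card_nonminimal_even_le[OF assms, of "Suc n"] by (simp only: of_nat_le_iff) (simp add: h)
    also have "\<dots> = real (Suc n) ^ h * (1 + real \<sigma> / real (Suc n))"
    proof -
      obtain j where "h = Suc j" using h0 gr0_implies_Suc by blast
      moreover have "x ^ Suc j * (1 + s / x) = x ^ Suc j + s * x ^ j" if "x > 0" for x s :: real
        using that by (simp add: distrib_left)
      ultimately show ?thesis by (simp del: power_Suc of_nat_Suc)
    qed
    finally show "real (nonminimal_count \<sigma> (Suc n)) / sqrt (real (Suc n) ^ \<sigma>) \<le> 1 + real \<sigma> / real (Suc n)"
      unfolding sq using pos[of n] by (simp add: divide_le_eq mult.commute)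
  qed
  show "(\<lambda>n. 1 + real \<sigma> / real (Suc n)) \<longlonglongrightarrow> 1" by real_asymp
qed simp

lemma nonminimal_count_odd:
  assumes "\<sigma> > 0" "odd \<sigma>"
  shows "(\<lambda>n. real (nonminimal_count \<sigma> (Suc n)) / sqrt (real (Suc n) ^ \<sigma>)) \<longlonglongrightarrow> 0"
proof (rule tendsto_sandwich[OF _ _ tendsto_const])
  obtain h where h: "\<sigma> = 2 * h + 1" using assms(2) by (elim oddE)
  have sq: "sqrt (real (Suc n) ^ \<sigma>) = real (Suc n) ^ h * sqrt (real (Suc n))" for n
  proof -
    have "real (Suc n) ^ \<sigma> = (real (Suc n) ^ h) ^ 2 * real (Suc n)"
      by (simp add: h mult.commute flip: power_mult)
    then show ?thesis by (simp add: real_sqrt_mult)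
  qed
  show "\<forall>\<^sub>F n in sequentially. real (nonminimal_count \<sigma> (Suc n)) / sqrt (real (Suc n) ^ \<sigma>) \<le> real \<sigma> / sqrt (real (Suc n))"
  proof (intro always_eventually allI)
    fix n
    have "real (nonminimal_count \<sigma> (Suc n)) \<le> real (\<sigma> * Suc n ^ h)"
      using card_nonminimal_odd_le[OF assms, of "Suc n"] by (simp only: of_nat_le_iff) (simp add: h)
    then have "real (nonminimal_count \<sigma> (Suc n)) / sqrt (real (Suc n) ^ \<sigma>) \<le>
        (real \<sigma> * real (Suc n) ^ h) / (real (Suc n) ^ h * sqrt (real (Suc n)))"
      unfolding sq by (intro divide_right_mono) auto
    also have "\<dots> = real \<sigma> / sqrt (real (Suc n))" by simp
    finally show "real (nonminimal_count \<sigma> (Suc n)) / sqrt (real (Suc n) ^ \<sigma>) \<le> real \<sigma> / sqrt (real (Suc n))" .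
  qed
  show "(\<lambda>n. real \<sigma> / sqrt (real (Suc n))) \<longlonglongrightarrow> 0" by real_asymp
qed (auto intro!: always_eventually)

text \<open>At 1 the formula of \<open>limit_cdf\<close> divides by 0 and evaluates to 0 rather than
  1, and beyond [0, 1] it has no meaning; hence the explicit values.\<close>

definition extended_limit_cdf :: "real \<Rightarrow> real \<Rightarrow> real" where
  "extended_limit_cdf a y = (if y \<le> 0 then 0 else if y \<ge> 1 then 1 else limit_cdf a y)"

lemma limit_cdf_right:
  assumes "0 \<le> y" "y < 1" "y < b" "\<epsilon> > 0"
  obtains u where "y < u" "u < b" "u < 1" "limit_cdf a u < limit_cdf a y + \<epsilon>"
proof -
  have "\<exists>\<delta>>0. \<forall>u. \<bar>u - y\<bar> < \<delta> \<longrightarrow> \<bar>limit_cdf a u - limit_cdf a y\<bar> < \<epsilon>"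
    using continuous_limit_cdf[OF assms(1,2), of a] assms(4) unfolding continuous_at_eps_delta dist_real_def by blast
  then obtain \<delta> where \<delta>: "\<delta> > 0" "\<And>u. \<bar>u - y\<bar> < \<delta> \<Longrightarrow> \<bar>limit_cdf a u - limit_cdf a y\<bar> < \<epsilon>" by blast
  define u where "u = y + min \<delta> (min b 1 - y) / 2"
  have "min \<delta> (min b 1 - y) > 0" using \<delta> assms by auto
  then have "y < u" "u < b" "u < 1" "\<bar>u - y\<bar> < \<delta>"
    unfolding u_def by (auto simp: min_def abs_if field_simps split: if_splits)
  then show thesis using that[of u] \<delta>(2)[of u] by linarith
qed

lemma limit_cdf_near_1:
  assumes "a > 0" "b < 1" "\<epsilon> > 0"
  obtains v where "b < v" "v < 1" "limit_cdf a v > 1 - \<epsilon>"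
proof -
  have "eventually (\<lambda>v. limit_cdf a v > 1 - \<epsilon>) (at_left 1)"
    using limit_cdf_tendsto_1[OF assms(1)] assms(3) by (intro order_tendstoD(1)) auto
  then obtain b' where b': "b' < 1" "\<And>v. b' < v \<Longrightarrow> v < 1 \<Longrightarrow> limit_cdf a v > 1 - \<epsilon>"
    unfolding eventually_at_left_field by blast
  define v where "v = (max b b' + 1) / 2"
  have "b < v" "b' < v" "v < 1" using assms(2) b'(1) by (auto simp: v_def max_def)
  then show thesis using that b'(2) by blast
qed

text \<open>\<open>prob_hit\<close> concerns weak inequalities, but the complement of the event is
  the strict one. Comparing with slightly larger \<open>u\<close> and using continuity of
  \<open>limit_cdf\<close> removes the difference.\<close>

lemma (in bridge_to_zero) prob_survival:
  "prob {\<omega> \<in> space M. 1 - \<tau> \<omega> \<le> y} = extended_limit_cdf a y"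
proof -
  define F where "F y = prob {\<omega> \<in> space M. 1 - \<tau> \<omega> \<le> y}" for y
  have m: "{\<omega> \<in> space M. 1 - \<tau> \<omega> \<le> y} \<in> sets M" for y by measurable
  have mono: "F y \<le> F y'" if "y \<le> y'" for y y'
    unfolding F_def using that m by (intro finite_measure_mono) auto
  have compl: "F y = 1 - prob {\<omega> \<in> space M. \<tau> \<omega> < 1 - y}" for y
  proof -
    have "{\<omega> \<in> space M. 1 - \<tau> \<omega> \<le> y} = space M - {\<omega> \<in> space M. \<tau> \<omega> < 1 - y}" by auto
    moreover have "{\<omega> \<in> space M. \<tau> \<omega> < 1 - y} \<in> sets M" by measurable
    ultimately show ?thesis unfolding F_def by (simp add: prob_compl)
  qed
  have hit: "prob {\<omega> \<in> space M. \<tau> \<omega> \<le> 1 - y} = 1 - limit_cdf a y" if "0 < y" "y < 1" for y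
    using prob_hit[of "1 - y"] that by (simp add: limit_cdf_def)
  have ge: "F y \<ge> limit_cdf a y" if y: "0 < y" "y < 1" for y
  proof -
    have "prob {\<omega> \<in> space M. \<tau> \<omega> < 1 - y} \<le> prob {\<omega> \<in> space M. \<tau> \<omega> \<le> 1 - y}"
      by (intro finite_measure_mono) auto
    then show ?thesis using hit[OF y] compl[of y] by linarith
  qed
  have le: "F y \<le> limit_cdf a u" if u: "y < u" "0 < u" "u < 1" for y u
  proof -
    have "prob {\<omega> \<in> space M. \<tau> \<omega> \<le> 1 - u} \<le> prob {\<omega> \<in> space M. \<tau> \<omega> < 1 - y}"
      using u by (intro finite_measure_mono) auto
    then show ?thesis using hit[OF u(2,3)] compl[of y] by linarith
  qed
  have le': "F y \<le> limit_cdf a y" if y: "0 \<le> y" "y < 1" for y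
  proof (rule field_le_epsilon)
    fix e :: real assume e: "e > 0"
    obtain u where "y < u" "u < 1" "limit_cdf a u < limit_cdf a y + e"
      using limit_cdf_right[OF y y(2) e, of a] by blast
    then show "F y \<le> limit_cdf a y + e" using le[of y u] y by linarith
  qed
  consider "y \<le> 0" | "0 < y" "y < 1" | "y \<ge> 1" by linarith
  then have "F y = extended_limit_cdf a y"
  proof cases
    case 1
    have "F y \<ge> 0" by (simp add: F_def)
    moreover have "F y \<le> 0" using mono[OF 1] le'[of 0] limit_cdf_0[of a] by simp
    ultimately show ?thesis using 1 by (simp add: extended_limit_cdf_def)
  next
    case 2
    then show ?thesis using ge[of y] le'[of y] by (simp add: extended_limit_cdf_def)
  next
    case 3
    have "{\<omega> \<in> space M. 1 - \<tau> \<omega> \<le> y} = space M"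
      using 3 by (auto dest: \<tau>_path(1))
    then show ?thesis using 3 by (simp add: F_def extended_limit_cdf_def prob_space)
  qed
  then show ?thesis by (simp add: F_def)
qed

section \<open>Convergence of the scaled count\<close>

lemma prob_finite_values:
  assumes "finite S"
  shows "measure_pmf.prob p {f. h f \<in> S} = (\<Sum>m\<in>S. measure_pmf.prob p {f. h f = (m::nat)})"
proof -
  have "{f. h f \<in> S} = (\<Union>m\<in>S. {f. h f = m})" by auto
  also have "measure_pmf.prob p \<dots> = (\<Sum>m\<in>S. measure_pmf.prob p {f. h f = m})"
    using assms by (intro measure_pmf.finite_measure_finite_Union) (auto simp: disjoint_family_on_def)
  finally show ?thesis .
qed

locale scaled_limit =
  fixes r \<sigma> :: nat
  assumes \<sigma>: "0 < \<sigma>" "\<sigma> \<le> r"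
begin

text \<open>In this locale the index \<open>n\<close> stands for \<open>Suc n\<close> states, which
  keeps the set of rules nonempty.\<close>

definition reps :: "nat \<Rightarrow> (int \<Rightarrow> nat) set" where
  "reps n = (SOME R. transversal r \<sigma> (Suc n) R)"

lemma transversal_reps: "transversal r \<sigma> (Suc n) (reps n)"
  unfolding reps_def by (rule someI_ex[OF transversal_exists[OF \<sigma> zero_less_Suc]])

abbreviation N :: "nat \<Rightarrow> nat" where "N n \<equiv> card (reps n)"
abbreviation d :: "nat \<Rightarrow> nat" where "d n \<equiv> nonminimal_count \<sigma> (Suc n)"
abbreviation rule_prob :: "nat \<Rightarrow> (nat list \<Rightarrow> nat) set \<Rightarrow> real" where
  "rule_prob n \<equiv> measure_pmf.prob (random_rule r (Suc n))"

definition K :: "nat \<Rightarrow> real" where "K n = real (d n + N n * \<sigma>) / real \<sigma>"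

lemma total: "Suc n ^ \<sigma> = d n + N n * \<sigma>"
  using transversal.card_decomposition[OF transversal_reps] .

lemma K_eq: "K n = real (Suc n) ^ \<sigma> / real \<sigma>"
  unfolding K_def total[symmetric] by simp

lemma K_pos: "K n > 0"
  using \<sigma> by (simp add: K_eq)

lemma K_top: "filterlim K at_top sequentially"
proof -
  have "filterlim (\<lambda>n. real (Suc n) ^ \<sigma>) at_top sequentially"
    by (intro filterlim_pow_at_top \<sigma> filterlim_compose[OF filterlim_real_sequentially filterlim_Suc])
  then have "filterlim (\<lambda>n. 1 / real \<sigma> * real (Suc n) ^ \<sigma>) at_top sequentially"
    using \<sigma> by (intro filterlim_tendsto_pos_mult_at_top[OF tendsto_const]) auto
  then show ?thesis by (simp add: K_eq[abs_def])
qed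

lemma scaled_eq: "scaled_classes r \<sigma> (Suc n) f = real (num_classes r \<sigma> (Suc n) f) / K n"
  by (simp add: scaled_classes_def K_eq)

lemma prob_num: "rule_prob n {f. num_classes r \<sigma> (Suc n) f = m} = alive_size_prob (N n) \<sigma> (d n) m"
  using transversal.prob_num_classes[OF transversal_reps] .

lemma prob_num_in:
  "finite S \<Longrightarrow> rule_prob n {f. num_classes r \<sigma> (Suc n) f \<in> S} = (\<Sum>m\<in>S. alive_size_prob (N n) \<sigma> (d n) m)"
  by (subst prob_finite_values) (simp_all add: prob_num)

text \<open>An interval to the left of \<open>y\<close> bounds the distribution function from below,
  one to the right of \<open>y\<close> bounds its complement. Stretching them towards 0 and 1 loses
  nothing, as \<open>limit_cdf\<close> is 0 at 0 and tends to 1 at 1.\<close>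

lemma scaled_cdf_tendsto:
  assumes "even \<sigma>"
  defines "a \<equiv> 1 / sqrt (real \<sigma>)"
  shows "(\<lambda>n. rule_prob n {f. scaled_classes r \<sigma> (Suc n) f \<le> y}) \<longlonglongrightarrow> extended_limit_cdf a y"
proof -
  have a: "a > 0" using \<sigma> by (simp add: a_def)
  note asym = parameter_asymptotics[OF \<sigma>(1) total nonminimal_count_even[OF \<sigma>(1) assms(1)], folded a_def]
  let ?A = "\<lambda>n u v. {f. num_classes r \<sigma> (Suc n) f \<in> {nat \<lfloor>K n * u\<rfloor>..nat \<lfloor>K n * v\<rfloor>}}"
  have main: "eventually (\<lambda>n. rule_prob n (?A n u v) >
      limit_cdf a v - limit_cdf a u - \<epsilon>) sequentially"
    if "0 < u" "u < v" "v < 1" "\<epsilon> > 0" for u v \<epsilon>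
  proof -
    have "d n + N n * \<sigma> > 0" for n unfolding total[symmetric] by simp
    from alive_size_prob_sum_ge[OF \<sigma>(1) asym(1) a asym(3) this that]
    show ?thesis unfolding K_def[symmetric] prob_num_in[OF finite_atLeastAtMost] .
  qed
  define F where "F n = rule_prob n {f. scaled_classes r \<sigma> (Suc n) f \<le> y}" for n
  have lower: "eventually (\<lambda>n. F n > limit_cdf a v - limit_cdf a u - \<epsilon>) sequentially"
    if uv: "0 < u" "u < v" "v < 1" "\<epsilon> > 0" "v \<le> y" for u v \<epsilon>
    using main[OF uv(1-4)]
  proof eventually_elim
    case (elim n)
    have "?A n u v \<subseteq> {f. scaled_classes r \<sigma> (Suc n) f \<le> y}"
    proof clarify
      fix f assume f: "num_classes r \<sigma> (Suc n) f \<in> {nat \<lfloor>K n * u\<rfloor>..nat \<lfloor>K n * v\<rfloor>}"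
      have "K n * v \<ge> 0" using K_pos[of n] uv by simp
      then have "real (nat \<lfloor>K n * v\<rfloor>) \<le> K n * v" by simp
      then have "real (num_classes r \<sigma> (Suc n) f) \<le> K n * v" using f by simp
      also have "\<dots> \<le> K n * y" using uv K_pos[of n] by simp
      finally show "scaled_classes r \<sigma> (Suc n) f \<le> y"
        unfolding scaled_eq using K_pos[of n] by (simp add: divide_le_eq mult.commute)
    qed
    then have "rule_prob n (?A n u v) \<le> F n"
      unfolding F_def by (intro measure_pmf.finite_measure_mono) auto
    then show ?case using elim by linarith
  qed
  have upper: "eventually (\<lambda>n. F n < 1 - (limit_cdf a v - limit_cdf a u - \<epsilon>)) sequentially"
    if uv: "0 < u" "u < v" "v < 1" "\<epsilon> > 0" "y < u" for u v \<epsilon>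
  proof -
    \<comment> \<open>Rounding \<open>K n * u\<close> down loses less than one unit, which
      \<open>K n * (u - y) > 1\<close> absorbs.\<close>
    have "eventually (\<lambda>n. K n > 1 / (u - y)) sequentially"
      using K_top by (rule filterlim_at_top_dense[THEN iffD1, rule_format])
    with main[OF uv(1-4)] show ?thesis
    proof eventually_elim
      case (elim n)
      have "1 < K n * (u - y)" using elim(2) uv by (simp add: pos_divide_less_eq)
      have "?A n u v \<subseteq> - {f. scaled_classes r \<sigma> (Suc n) f \<le> y}"
      proof clarify
        fix f assume f: "num_classes r \<sigma> (Suc n) f \<in> {nat \<lfloor>K n * u\<rfloor>..nat \<lfloor>K n * v\<rfloor>}"
          and le: "scaled_classes r \<sigma> (Suc n) f \<le> y"
        have "real (num_classes r \<sigma> (Suc n) f) \<le> K n * y"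
          using le unfolding scaled_eq using K_pos[of n] by (simp add: divide_le_eq mult.commute)
        moreover have "K n * u - 1 < real (nat \<lfloor>K n * u\<rfloor>)" using K_pos[of n] uv by linarith
        moreover have "real (nat \<lfloor>K n * u\<rfloor>) \<le> real (num_classes r \<sigma> (Suc n) f)" using f by simp
        ultimately show False using \<open>1 < K n * (u - y)\<close> by (simp add: right_diff_distrib)
      qed
      then have "rule_prob n (?A n u v) \<le> rule_prob n (- {f. scaled_classes r \<sigma> (Suc n) f \<le> y})"
        by (intro measure_pmf.finite_measure_mono) auto
      also have "\<dots> = 1 - F n"
        unfolding F_def using measure_pmf.prob_compl[of "{f. scaled_classes r \<sigma> (Suc n) f \<le> y}"] by (simp add: Compl_eq_Diff_UNIV)
      finally show ?case using elim by linarith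
    qed
  qed
  have nn: "0 \<le> F n" "F n \<le> 1" for n by (simp_all add: F_def)
  have low: "eventually (\<lambda>n. F n > extended_limit_cdf a y - e) sequentially" if e: "e > 0" for e
  proof (cases "y \<le> 0")
    case True
    then show ?thesis using nn(1) e by (intro always_eventually) (auto simp: extended_limit_cdf_def intro: less_le_trans[of _ 0])
  next
    case False
    \<comment> \<open>The error is split into thirds: for the right end \<open>v\<close>, for the
      left end \<open>u\<close>, and for the approximation of the interval mass.\<close>
    obtain v where v: "0 < v" "v < 1" "v \<le> y" "limit_cdf a v > extended_limit_cdf a y - e / 3"
    proof (cases "y < 1")
      case True
      then show thesis using that[of y] False e by (simp add: extended_limit_cdf_def)
    next
      case F: False
      obtain v where "0 < v" "v < 1" "limit_cdf a v > 1 - e / 3"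
        using limit_cdf_near_1[OF a, of 0 "e / 3"] e by auto
      then show thesis using that[of v] F by (simp add: extended_limit_cdf_def)
    qed
    obtain u where u: "0 < u" "u < v" "limit_cdf a u < e / 3"
      using limit_cdf_right[of 0 v "e / 3" a] v e limit_cdf_0[of a] by auto
    have "e / 3 > 0" using e by simp
    from lower[OF u(1,2) v(2) this v(3)] show ?thesis
      by (rule eventually_mono) (use u v in linarith)
  qed
  have upp: "eventually (\<lambda>n. F n < extended_limit_cdf a y + e) sequentially" if e: "e > 0" for e
  proof -
    consider "y \<ge> 1" | "y < 0" | "0 \<le> y" "y < 1" by linarith
    then show ?thesis
    proof cases
      case 1
      then show ?thesis using nn(2) e by (intro always_eventually) (auto simp: extended_limit_cdf_def intro: le_less_trans[of _ 1])
    next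
      case 2
      have "scaled_classes r \<sigma> (Suc n) f \<ge> 0" for n f by (simp add: scaled_classes_def)
      then have "\<not> scaled_classes r \<sigma> (Suc n) f \<le> y" for n f using 2 by (meson not_le order.strict_trans2)
      then have "F n = 0" for n by (simp add: F_def)
      then show ?thesis using 2 e by (simp add: extended_limit_cdf_def)
    next
      case 3
      have E: "extended_limit_cdf a y = limit_cdf a y" using 3 limit_cdf_0[of a] by (auto simp: extended_limit_cdf_def)
      have e3: "e / 3 > 0" using e by simp
      obtain u where u: "y < u" "u < 1" "limit_cdf a u < limit_cdf a y + e / 3"
        using limit_cdf_right[OF 3 3(2) e3, of a] by auto
      obtain v where v: "u < v" "v < 1" "limit_cdf a v > 1 - e / 3"
        using limit_cdf_near_1[OF a u(2) e3] by auto
      have u0: "0 < u" using u(1) 3(1) by linarith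
      from upper[OF u0 v(1,2) e3 u(1)] show ?thesis
        unfolding E by (rule eventually_mono) (use u v in linarith)
    qed
  qed
  have "F \<longlonglongrightarrow> extended_limit_cdf a y"
  proof (rule tendstoI)
    fix e :: real assume e: "e > 0"
    show "eventually (\<lambda>n. dist (F n) (extended_limit_cdf a y) < e) sequentially"
      using low[OF e] upp[OF e] by eventually_elim (simp add: dist_real_def abs_less_iff)
  qed
  then show ?thesis by (simp add: F_def[abs_def])
qed

text \<open>The scaled count is at most \<open>N / K \<le> 1\<close>, so only deviations downwards
  occur. The margin between \<open>e / 2\<close> and \<open>e\<close> absorbs the convergence of
  \<open>N / K\<close> to 1.\<close>

lemma scaled_deviation_tendsto:
  assumes "odd \<sigma>" and \<epsilon>: "\<epsilon> > 0"
  shows "(\<lambda>n. rule_prob n {f. \<bar>scaled_classes r \<sigma> (Suc n) f - 1\<bar> > \<epsilon>}) \<longlonglongrightarrow> 0"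
proof -
  note asym = parameter_asymptotics[OF \<sigma>(1) total nonminimal_count_odd[OF \<sigma>(1) assms(1)], folded K_def]
  \<comment> \<open>Capping makes the parameter admissible in
    \<open>alive_size_prob_sum_small\<close>, which requires it to be at most 1.\<close>
  define e where "e = min \<epsilon> (1 / 2)"
  have e: "0 < e" "e \<le> 1 / 2" "e \<le> \<epsilon>" using \<epsilon> by (auto simp: e_def)
  have lim: "(\<lambda>n. \<Sum>m\<in>{m. real m \<le> (1 - e / 2) * real (N n)}. alive_size_prob (N n) \<sigma> (d n) m) \<longlonglongrightarrow> 0"
    using asym(3) e by (intro alive_size_prob_sum_small[OF \<sigma>(1) asym(1)]) auto
  have fin: "finite {m. real m \<le> x}" for x :: real
    by (rule finite_subset[of _ "{..nat \<lfloor>x\<rfloor>}"]) (auto simp: le_nat_floor)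
  have "(\<lambda>n. (1 - e / 2) * (real (N n) / K n)) \<longlonglongrightarrow> (1 - e / 2) * 1" by (intro tendsto_intros asym(2))
  then have "eventually (\<lambda>n. (1 - e / 2) * (real (N n) / K n) > 1 - e) sequentially"
    using e by (intro order_tendstoD(1)) auto
  then have "eventually (\<lambda>n. rule_prob n {f. \<bar>scaled_classes r \<sigma> (Suc n) f - 1\<bar> > \<epsilon>}
      \<le> (\<Sum>m\<in>{m. real m \<le> (1 - e / 2) * real (N n)}. alive_size_prob (N n) \<sigma> (d n) m)) sequentially"
  proof eventually_elim
    case (elim n)
    have "rule_prob n {f. \<bar>scaled_classes r \<sigma> (Suc n) f - 1\<bar> > \<epsilon>} \<le>
       rule_prob n {f. num_classes r \<sigma> (Suc n) f \<in> {m. real m \<le> (1 - e / 2) * real (N n)}}"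
    proof (rule measure_pmf.finite_measure_mono_AE)
      have supp: "set_pmf (random_rule r (Suc n)) = rules r (Suc n)"
        unfolding random_rule_def by (rule set_pmf_of_set) (simp_all add: finite_rules rules_nonempty)
      have "real (num_classes r \<sigma> (Suc n) f) \<le> (1 - e / 2) * real (N n)"
        if f: "f \<in> rules r (Suc n)" and dev: "\<bar>scaled_classes r \<sigma> (Suc n) f - 1\<bar> > \<epsilon>" for f
      proof -
        have "num_classes r \<sigma> (Suc n) f \<le> N n"
          unfolding transversal.num_classes_eq[OF transversal_reps f]
          by (intro card_mono transversal.finite_R[OF transversal_reps] alive_subset)
        moreover have "real (N n) \<le> K n" using \<sigma> by (simp add: K_def field_simps)
        ultimately have "real (num_classes r \<sigma> (Suc n) f) \<le> K n" by linarith
        then have "scaled_classes r \<sigma> (Suc n) f \<le> 1" unfolding scaled_eq using K_pos[of n] by simp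
        then have "scaled_classes r \<sigma> (Suc n) f < 1 - e" using dev e by linarith
        also have "\<dots> < (1 - e / 2) * (real (N n) / K n)" by (rule elim)
        finally show ?thesis unfolding scaled_eq using K_pos[of n] by (simp add: divide_less_cancel)
      qed
      then show "AE f in measure_pmf (random_rule r (Suc n)). f \<in> {f. \<bar>scaled_classes r \<sigma> (Suc n) f - 1\<bar> > \<epsilon>} \<longrightarrow>
          f \<in> {f. num_classes r \<sigma> (Suc n) f \<in> {m. real m \<le> (1 - e / 2) * real (N n)}}"
        by (auto simp: AE_measure_pmf_iff supp)
    qed simp
    then show ?case unfolding prob_num_in[OF fin] .
  qed
  then show ?thesis
    by (intro tendsto_sandwich[OF _ _ tendsto_const lim]) auto
qed

end

theorem theorem2:
  fixes r \<sigma> :: nat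
  assumes "r \<ge> 2" and "\<sigma> \<ge> 1" and "\<sigma> \<le> r"
  shows "(even \<sigma> \<longrightarrow>
            (\<forall>(M :: 'a measure) \<eta>. brownian_bridge M (1 / sqrt (real \<sigma>)) 0 \<eta> \<longrightarrow>
               weak_conv_m
                 (\<lambda>n. distr (measure_pmf (random_rule r n)) borel (scaled_classes r \<sigma> n))
                 (distr M borel (\<lambda>\<omega>. 1 - hitting_time_zero \<eta> \<omega>)))) \<and>
         (odd \<sigma> \<longrightarrow>
            (\<forall>\<epsilon>>0. (\<lambda>n. measure_pmf.prob (random_rule r n)
                          {f. \<bar>scaled_classes r \<sigma> n f - 1\<bar> > \<epsilon>}) \<longlonglongrightarrow> 0))"
proof (intro conjI impI allI)
  interpret scaled_limit r \<sigma> using assms by unfold_locales auto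
  {
    fix M :: "'a measure" and \<eta>
    assume even: "even \<sigma>" and br: "brownian_bridge M (1 / sqrt (real \<sigma>)) 0 \<eta>"
    interpret B: bridge_to_zero M "1 / sqrt (real \<sigma>)" \<eta> using br assms by unfold_locales auto
    \<comment> \<open>The limit law has no atoms, so convergence is obtained at every
      \<open>y\<close>.\<close>
    have "(\<lambda>n. cdf (distr (measure_pmf (random_rule r n)) borel (scaled_classes r \<sigma> n)) y)
        \<longlonglongrightarrow> cdf (distr M borel (\<lambda>\<omega>. 1 - hitting_time_zero \<eta> \<omega>)) y" for y
    proof -
      have "cdf (distr M borel (\<lambda>\<omega>. 1 - hitting_time_zero \<eta> \<omega>)) y =
          B.prob {\<omega> \<in> space M. 1 - hitting_time_zero \<eta> \<omega> \<le> y}"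
        unfolding cdf_def by (subst measure_distr) (auto intro!: arg_cong[where f = B.prob])
      also have "\<dots> = extended_limit_cdf (1 / sqrt (real \<sigma>)) y" by (rule B.prob_survival)
      finally have "cdf (distr M borel (\<lambda>\<omega>. 1 - hitting_time_zero \<eta> \<omega>)) y = extended_limit_cdf (1 / sqrt (real \<sigma>)) y" .
      moreover have "cdf (distr (measure_pmf (random_rule r n)) borel (scaled_classes r \<sigma> n)) y =
          measure_pmf.prob (random_rule r n) {f. scaled_classes r \<sigma> n f \<le> y}" for n
        unfolding cdf_def by (subst measure_distr) (auto simp: vimage_def)
      ultimately show ?thesis
        using scaled_cdf_tendsto[OF even, of y]
        by (subst filterlim_sequentially_Suc[symmetric]) simp
    qed
    then show "weak_conv_m (\<lambda>n. distr (measure_pmf (random_rule r n)) borel (scaled_classes r \<sigma> n))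
        (distr M borel (\<lambda>\<omega>. 1 - hitting_time_zero \<eta> \<omega>))"
      by (simp add: weak_conv_m_def weak_conv_def)
  }
  fix \<epsilon> :: real assume "odd \<sigma>" "\<epsilon> > 0"
  then show "(\<lambda>n. measure_pmf.prob (random_rule r n) {f. \<bar>scaled_classes r \<sigma> n f - 1\<bar> > \<epsilon>}) \<longlonglongrightarrow> 0"
    using scaled_deviation_tendsto[of \<epsilon>] by (subst filterlim_sequentially_Suc[symmetric])
qed

end
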